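(* Let $q\in[1,\infty]$ with dual exponent $q'$, and let $u \in BV^{(p_i)}(\Omega) \cap L^{\max(p_k,q)}(\Omega)$ and $\mathbf{z}=(\mathbf{z}_1,\dots,\mathbf{z}_k) \in X^{(p'_i)}_{q'}(\Omega)$. Then the distribution $(\mathbf{z},Du)$ is a Radon measure in $\Omega$. Moreover, $$\bigg\vert \int_{B} (\mathbf{z},Du) \bigg\vert \leq \| \mathbf{z}_1 \|_{\infty} \int_{B} \vert D_{x_1} u \vert + \sum_{i=2}^k \| \mathbf{z}_i \|_{p'_i} \| \nabla_{x_i} u \|_{p_i}$$ for any Borel set $B \subseteq \Omega$. Moreover, $(\mathbf{z}_1, D_{x_1} u)$ is also a Radon measure and it satisfies $$\bigg\vert \int_B (\mathbf{z}_1, D_{x_1} u) \bigg\vert \leq \| \mathbf{z}_1 \|_{\infty} \int_B |D_{x_1} u|$$ for any Borel set $B \subseteq \Omega$, i.e. it is absolutely continuous with respect to $\vert D_{x_1} u \vert$.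
   Context: Setting. $\Omega_1\subset\mathbb{R}^{n_1}$ and $\Omega_2\subset\mathbb{R}^{n_2+\dots+n_k}$ ($k\ge 2$) are bounded open sets, $N=n_1+\dots+n_k$, and $\Omega=\Omega_1\times\Omega_2\subset\mathbb{R}^N$ is assumed to have Lipschitz boundary. Points are written $x=(x_1,\dots,x_k)$ with $x_i\in\mathbb{R}^{n_i}$; $\nabla_{x_i}$ (or $D_{x_i}$ for measures) is the distributional gradient in the variables $x_i$; $\mathrm{div}$ is the full (distributional) divergence in $\mathbb{R}^N$. Exponents: $p_1=1<p_2\le\dots\le p_k<\infty$, and $p_i'$ is the dual exponent (so $p_1'=\infty$). Norms $\|\cdot\|_{p_i},\|\cdot\|_{p_i'},\|\cdot\|_\infty$ are Lebesgue norms over $\Omega$. Spaces. $BV^{(p_i)}(\Omega)=\{u\in BV(\Omega): \nabla_{x_i}u\in L^{p_i}(\Omega;\mathbb{R}^{n_i}),\ i=2,\dots,k\}$ (so $D_{x_1}u$ is a finite Radon measure). For $r\in[1,\infty]$, $X_r^{(p_i')}(\Omega)=\{\mathbf{z}=(\mathbf{z}_1,\dots,\mathbf{z}_k)\in L^{p_1'}(\Omega;\mathbb{R}^{n_1})\times\dots\times L^{p_k'}(\Omega;\mathbb{R}^{n_k}):\mathrm{div}(\mathbf{z})\in L^r(\Omega)\}$. Pairings. For such $u,\mathbf{z}$ and $\varphi\in C_c^\infty(\Omega)$ define the distributions $$\langle(\mathbf{z},Du),\varphi\rangle=-\int_\Omega u\,\mathrm{div}(\varphi\mathbf{z})\,dx=-\int_\Omega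 u\,\varphi\,\mathrm{div}(\mathbf{z})\,dx-\sum_{i=1}^k\int_\Omega u\,\mathbf{z}_i\cdot\nabla_{x_i}\varphi\,dx,$$ $$\langle(\mathbf{z}_1,D_{x_1}u),\varphi\rangle=\langle(\mathbf{z},Du),\varphi\rangle-\sum_{i=2}^k\int_\Omega\varphi\,\mathbf{z}_i\cdot\nabla_{x_i}u\,dx .$$ *)

theory Defs
  imports "HOL-Probability.Essential_Supremum"
begin

text \<open>Exponents range over \<^typ>\<open>ennreal\<close>, so that the exponent infinity is available.\<close>

definition dual_exp :: "ennreal \<Rightarrow> ennreal" where
  "dual_exp r = inverse (1 - inverse r)"

definition in_Lp :: "ennreal \<Rightarrow> 'a::euclidean_space set \<Rightarrow> ('a \<Rightarrow> 'b::euclidean_space) \<Rightarrow> bool" where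
  "in_Lp r \<Omega> f \<longleftrightarrow> f \<in> borel_measurable (lebesgue_on \<Omega>) \<and>
     (if r = \<infinity> then esssup (lebesgue_on \<Omega>) (\<lambda>x. ennreal (norm (f x))) < \<infinity>
      else integrable (lebesgue_on \<Omega>) (\<lambda>x. norm (f x) powr enn2real r))"

definition Lp_norm :: "ennreal \<Rightarrow> 'a::euclidean_space set \<Rightarrow> ('a \<Rightarrow> 'b::euclidean_space) \<Rightarrow> ennreal" where
  "Lp_norm r \<Omega> f =
     (if r = \<infinity> then esssup (lebesgue_on \<Omega>) (\<lambda>x. ennreal (norm (f x)))
      else ennreal ((LINT x|lebesgue_on \<Omega>. norm (f x) powr enn2real r) powr (1 / enn2real r)))"

definition loc_integrable :: "'a::euclidean_space set \<Rightarrow> ('a \<Rightarrow> 'b::euclidean_space) \<Rightarrow> bool" where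
  "loc_integrable \<Omega> f \<longleftrightarrow> (\<forall>K. compact K \<and> K \<subseteq> \<Omega> \<longrightarrow> integrable (lebesgue_on K) f)"


definition partial :: "'a::euclidean_space \<Rightarrow> ('a \<Rightarrow> real) \<Rightarrow> 'a \<Rightarrow> real" where
  "partial b \<phi> x = frechet_derivative \<phi> (at x) b"

definition grad :: "('a::euclidean_space \<Rightarrow> real) \<Rightarrow> 'a \<Rightarrow> 'a" where
  "grad \<phi> x = (\<Sum>b\<in>Basis. partial b \<phi> x *\<^sub>R b)"

primrec C_k :: "nat \<Rightarrow> ('a::euclidean_space \<Rightarrow> real) \<Rightarrow> bool" where
  "C_k 0 \<phi> \<longleftrightarrow> continuous_on UNIV \<phi>"
| "C_k (Suc n) \<phi> \<longleftrightarrow> (\<forall>x. \<phi> differentiable (at x)) \<and> (\<forall>b\<in>Basis. C_k n (partial b \<phi>))"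

text \<open>Elements of \<open>C\<^sub>c\<^sup>\<infinity>(\<Omega>)\<close> are identified with their extensions by zero to the whole space.\<close>

definition test_functions :: "'a::euclidean_space set \<Rightarrow> ('a \<Rightarrow> real) set" where
  "test_functions \<Omega> = {\<phi>. (\<forall>n. C_k n \<phi>) \<and>
     compact (closure {x. \<phi> x \<noteq> 0}) \<and> closure {x. \<phi> x \<noteq> 0} \<subseteq> \<Omega>}"


text \<open>Near every boundary point the set is the strict epigraph of a Lipschitz function over the
  hyperplane orthogonal to some unit vector \<open>e\<close>.\<close>

definition lipschitz_boundary :: "'a::euclidean_space set \<Rightarrow> bool" where
  "lipschitz_boundary \<Omega> \<longleftrightarrow>
     (\<forall>x\<in>frontier \<Omega>. \<exists>r e \<gamma> L. 0 < r \<and> norm e = 1 \<and> L-lipschitz_on {v. v \<bullet> e = 0} \<gamma> \<and>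
        \<Omega> \<inter> ball x r = {y \<in> ball x r. \<gamma> (y - (y \<bullet> e) *\<^sub>R e) < y \<bullet> e})"


text \<open>Finite vector-valued (in particular signed) Radon measures on an open set are represented by
  countably additive set functions on its Borel subsets; values on other sets are irrelevant.
  Regularity is automatic for finite Borel measures on open subsets of Euclidean space.\<close>

definition borel_subsets :: "'a::topological_space set \<Rightarrow> 'a set set" where
  "borel_subsets \<Omega> = {B \<in> sets borel. B \<subseteq> \<Omega>}"

definition radon_measure :: "'a::euclidean_space set \<Rightarrow> ('a set \<Rightarrow> 'b::euclidean_space) \<Rightarrow> bool" where
  "radon_measure \<Omega> \<nu> \<longleftrightarrow>
     (\<forall>A :: nat \<Rightarrow> 'a set. range A \<subseteq> borel_subsets \<Omega> \<and> disjoint_family A \<longrightarrow>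
        (\<lambda>n. \<nu> (A n)) sums \<nu> (\<Union>n. A n))"

definition total_variation :: "('a::topological_space set \<Rightarrow> 'b::real_normed_vector) \<Rightarrow> 'a set \<Rightarrow> ennreal" where
  "total_variation \<nu> B =
     (SUP A\<in>{A :: nat \<Rightarrow> 'a set. range A \<subseteq> sets borel \<and> disjoint_family A \<and> (\<Union>n. A n) = B}.
        \<Sum>n. ennreal (norm (\<nu> (A n))))"

text \<open>The positive part of the Jordan decomposition of a signed measure; the negative part is the
  positive part of the negated measure. Negative values are truncated to zero by \<^const>\<open>ennreal\<close>,
  which does not affect the supremum since the empty set contributes zero.\<close>

definition positive_part :: "'a::topological_space set \<Rightarrow> ('a set \<Rightarrow> real) \<Rightarrow> 'a measure" where
  "positive_part \<Omega> \<nu> =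
     measure_of \<Omega> (borel_subsets \<Omega>) (\<lambda>B. SUP A\<in>borel_subsets B. ennreal (\<nu> A))"

definition signed_integral :: "'a::topological_space set \<Rightarrow> ('a set \<Rightarrow> real) \<Rightarrow> ('a \<Rightarrow> real) \<Rightarrow> real" where
  "signed_integral \<Omega> \<nu> f =
     (LINT x|positive_part \<Omega> \<nu>. f x) - (LINT x|positive_part \<Omega> (\<lambda>B. - \<nu> B). f x)"

definition represents :: "'a::euclidean_space set \<Rightarrow> ('a set \<Rightarrow> real) \<Rightarrow> (('a \<Rightarrow> real) \<Rightarrow> real) \<Rightarrow> bool" where
  "represents \<Omega> \<mu> T \<longleftrightarrow> (\<forall>\<phi>\<in>test_functions \<Omega>. T \<phi> = signed_integral \<Omega> \<mu> \<phi>)"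

definition abs_continuous ::
  "'a::euclidean_space set \<Rightarrow> ('a set \<Rightarrow> 'b::euclidean_space) \<Rightarrow> ('a set \<Rightarrow> 'c::euclidean_space) \<Rightarrow> bool" where
  "abs_continuous \<Omega> \<mu> \<nu> \<longleftrightarrow>
     (\<forall>B\<in>borel_subsets \<Omega>. total_variation \<nu> B = 0 \<longrightarrow> total_variation \<mu> B = 0)"


text \<open>A block structure on the coordinates is a labelling \<open>bl\<close> of the standard basis by natural
  numbers. The component \<open>x\<^sub>i\<close> of \<open>x\<close> is identified with the vector having the same coordinates as
  \<open>x\<close> in the directions labelled \<open>i\<close> and zero coordinates in all others; a tuple of fields
  \<open>(z\<^sub>1, \<dots>, z\<^sub>k)\<close> is thus a single vector field \<open>z\<close>.\<close>

definition block :: "('a::euclidean_space \<Rightarrow> nat) \<Rightarrow> nat \<Rightarrow> 'a \<Rightarrow> 'a" where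
  "block bl i x = (\<Sum>b\<in>{b\<in>Basis. bl b = i}. (x \<bullet> b) *\<^sub>R b)"

text \<open>On a product, the first factor is block 1 and the second factor carries the given labelling.\<close>

definition prod_blocks :: "('b \<Rightarrow> nat) \<Rightarrow> 'a::euclidean_space \<times> 'b::euclidean_space \<Rightarrow> nat" where
  "prod_blocks bl c = (if snd c = 0 then 1 else bl (snd c))"


definition is_deriv_measure :: "'a::euclidean_space set \<Rightarrow> ('a \<Rightarrow> real) \<Rightarrow> ('a set \<Rightarrow> 'a) \<Rightarrow> bool" where
  "is_deriv_measure \<Omega> u \<nu> \<longleftrightarrow> radon_measure \<Omega> \<nu> \<and>
     (\<forall>b\<in>Basis. \<forall>\<phi>\<in>test_functions \<Omega>.
        (LINT x|lebesgue_on \<Omega>. u x * partial b \<phi> x) = - signed_integral \<Omega> (\<lambda>B. \<nu> B \<bullet> b) \<phi>)"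

definition BV :: "'a::euclidean_space set \<Rightarrow> ('a \<Rightarrow> real) set" where
  "BV \<Omega> = {u. in_Lp 1 \<Omega> u \<and> (\<exists>\<nu>. is_deriv_measure \<Omega> u \<nu>)}"

text \<open>The objects chosen below are unique: the measure on Borel subsets of \<open>\<Omega>\<close>, the functions up
  to null sets.\<close>

definition deriv_measure :: "'a::euclidean_space set \<Rightarrow> ('a \<Rightarrow> real) \<Rightarrow> 'a set \<Rightarrow> 'a" where
  "deriv_measure \<Omega> u = (SOME \<nu>. is_deriv_measure \<Omega> u \<nu>)"

definition block_deriv_measure ::
  "'a::euclidean_space set \<Rightarrow> ('a \<Rightarrow> nat) \<Rightarrow> nat \<Rightarrow> ('a \<Rightarrow> real) \<Rightarrow> 'a set \<Rightarrow> 'a" where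
  "block_deriv_measure \<Omega> bl i u B = block bl i (deriv_measure \<Omega> u B)"

definition is_weak_grad ::
  "'a::euclidean_space set \<Rightarrow> ('a \<Rightarrow> nat) \<Rightarrow> nat \<Rightarrow> ('a \<Rightarrow> real) \<Rightarrow> ('a \<Rightarrow> 'a) \<Rightarrow> bool" where
  "is_weak_grad \<Omega> bl i u g \<longleftrightarrow> loc_integrable \<Omega> g \<and> (\<forall>x. block bl i (g x) = g x) \<and>
     (\<forall>b\<in>{b\<in>Basis. bl b = i}. \<forall>\<phi>\<in>test_functions \<Omega>.
        (LINT x|lebesgue_on \<Omega>. u x * partial b \<phi> x) = - (LINT x|lebesgue_on \<Omega>. (g x \<bullet> b) * \<phi> x))"

definition weak_grad ::
  "'a::euclidean_space set \<Rightarrow> ('a \<Rightarrow> nat) \<Rightarrow> nat \<Rightarrow> ('a \<Rightarrow> real) \<Rightarrow> 'a \<Rightarrow> 'a" where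
  "weak_grad \<Omega> bl i u = (SOME g. is_weak_grad \<Omega> bl i u g)"

definition is_weak_div ::
  "'a::euclidean_space set \<Rightarrow> ('a \<Rightarrow> 'a) \<Rightarrow> ('a \<Rightarrow> real) \<Rightarrow> bool" where
  "is_weak_div \<Omega> z d \<longleftrightarrow> loc_integrable \<Omega> d \<and>
     (\<forall>\<phi>\<in>test_functions \<Omega>.
        (LINT x|lebesgue_on \<Omega>. z x \<bullet> grad \<phi> x) = - (LINT x|lebesgue_on \<Omega>. d x * \<phi> x))"

definition weak_div :: "'a::euclidean_space set \<Rightarrow> ('a \<Rightarrow> 'a) \<Rightarrow> 'a \<Rightarrow> real" where
  "weak_div \<Omega> z = (SOME d. is_weak_div \<Omega> z d)"

definition BV_aniso ::
  "'a::euclidean_space set \<Rightarrow> ('a \<Rightarrow> nat) \<Rightarrow> nat \<Rightarrow> (nat \<Rightarrow> real) \<Rightarrow> ('a \<Rightarrow> real) set" where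
  "BV_aniso \<Omega> bl k p = {u \<in> BV \<Omega>. \<forall>i\<in>{2..k}.
     (\<exists>g. is_weak_grad \<Omega> bl i u g) \<and> in_Lp (ennreal (p i)) \<Omega> (weak_grad \<Omega> bl i u)}"

definition X_aniso ::
  "'a::euclidean_space set \<Rightarrow> ('a \<Rightarrow> nat) \<Rightarrow> nat \<Rightarrow> (nat \<Rightarrow> real) \<Rightarrow> ennreal \<Rightarrow> ('a \<Rightarrow> 'a) set" where
  "X_aniso \<Omega> bl k p r = {z.
     (\<forall>i\<in>{1..k}. in_Lp (dual_exp (ennreal (p i))) \<Omega> (\<lambda>x. block bl i (z x))) \<and>
     (\<exists>d. is_weak_div \<Omega> z d) \<and> in_Lp r \<Omega> (weak_div \<Omega> z)}"

definition pairing ::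
  "'a::euclidean_space set \<Rightarrow> ('a \<Rightarrow> nat) \<Rightarrow> nat \<Rightarrow> ('a \<Rightarrow> 'a) \<Rightarrow> ('a \<Rightarrow> real) \<Rightarrow> ('a \<Rightarrow> real) \<Rightarrow> real" where
  "pairing \<Omega> bl k z u \<phi> =
     - (LINT x|lebesgue_on \<Omega>. u x * \<phi> x * weak_div \<Omega> z x)
     - (\<Sum>i=1..k. LINT x|lebesgue_on \<Omega>. u x * (block bl i (z x) \<bullet> block bl i (grad \<phi> x)))"

definition pairing_1 ::
  "'a::euclidean_space set \<Rightarrow> ('a \<Rightarrow> nat) \<Rightarrow> nat \<Rightarrow> ('a \<Rightarrow> 'a) \<Rightarrow> ('a \<Rightarrow> real) \<Rightarrow> ('a \<Rightarrow> real) \<Rightarrow> real" where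
  "pairing_1 \<Omega> bl k z u \<phi> = pairing \<Omega> bl k z u \<phi>
     - (\<Sum>i=2..k. LINT x|lebesgue_on \<Omega>. \<phi> x * (block bl i (z x) \<bullet> weak_grad \<Omega> bl i u x))"

end

theory Submission
  imports Defs
begin

text \<open>Formally \<open>(z\<^sub>1, D\<^sub>1 u)\<close> is the measure \<open>z\<^sub>1 \<cdot> D\<^sub>1 u\<close>, which has no direct meaning:
\<open>z\<^sub>1\<close> is defined up to Lebesgue null sets, and \<open>D\<^sub>1 u\<close> may charge such sets. The proof gives a
meaning to it by mollifying the field. For \<open>z\<^sub>n = \<rho>\<^sub>n * z\<close> and a test function \<open>\<phi>\<close> the field
\<open>\<phi> z\<^sub>n\<close> is smooth with compact support, so the definitions of the derivative measure and of the weak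
gradients give, once \<open>\<rho>\<^sub>n\<close> is supported in a small enough ball,

\<open>- \<integral> u \<phi> (\<rho>\<^sub>n * div z) - \<integral> u z\<^sub>n \<cdot> \<nabla>\<phi> - \<Sum>\<^sub>i\<^sub>\<ge>\<^sub>2 \<integral> \<phi> z\<^sub>n\<^sub>,\<^sub>i \<cdot> \<nabla>\<^sub>i u = \<integral> \<phi> z\<^sub>n\<^sub>,\<^sub>1 \<cdot> dD\<^sub>1 u\<close>

(lemma \<open>mollified_identity\<close>). Each integral on the left pairs a fixed function in some \<open>L\<^sup>s\<close> with
the mollification of a function in the dual space, hence converges (\<open>tendsto_conv_pairing\<close>): the left side
tends to \<open>\<langle>(z\<^sub>1, D\<^sub>1 u), \<phi>\<rangle>\<close>. On the right, \<open>z\<^sub>n\<^sub>,\<^sub>1\<close> is bounded at every point by the essential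
supremum of \<open>z\<^sub>1\<close>, so a Mazur type argument (\<open>bounded_sequence_weak_limit\<close>) produces a field \<open>w\<close>, measurable
with respect to a measure that dominates \<open>D\<^sub>1 u\<close> and with the same bound, such that the right side tends to
\<open>\<integral> \<phi> w \<cdot> dD\<^sub>1 u\<close>. Thus \<open>w \<cdot> D\<^sub>1 u\<close> is the measure \<open>(z\<^sub>1, D\<^sub>1 u)\<close>, and both its bound and its
absolute continuity can be read off. Adding the integrable function \<open>\<Sum>\<^sub>i\<^sub>\<ge>\<^sub>2 z\<^sub>i \<cdot> \<nabla>\<^sub>i u\<close> gives
\<open>(z, Du)\<close>, and Hoelder's inequality bounds the added part.

Signed and vector measures are countably additive set functions here. A Hahn decomposition and the
Radon-Nikodym theorem turn the coordinates of \<open>Du\<close>, together with Lebesgue measure, into densities with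
respect to one finite positive measure (\<open>vector_measure_density\<close>). Signed integrals become ordinary
integrals (\<open>signed_integral_density\<close>), and the integral of the norm of the density is at most the total
variation (\<open>nn_integral_norm_le_total_variation\<close>).\<close>

section \<open>Densities of vector measures\<close>

lemma borel_subsets_eq_restrict:
  assumes "\<Omega> \<in> sets borel"
  shows "borel_subsets \<Omega> = sets (restrict_space borel \<Omega>)"
  using assms unfolding borel_subsets_def sets_restrict_space by auto

text \<open>The measure space \<open>M\<close> supplies the sigma-algebra.\<close>

locale signed_measure =
  fixes M :: "'a measure" and \<nu> :: "'a set \<Rightarrow> real"
  assumes sums_disjoint:
    "range A \<subseteq> sets M \<Longrightarrow> disjoint_family A \<Longrightarrow> (\<lambda>n. \<nu> (A n)) sums \<nu> (\<Union>n. A n)"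
begin

lemma empty: "\<nu> {} = 0"
proof -
  have "(\<lambda>n::nat. \<nu> {}) sums \<nu> {}"
    using sums_disjoint[of "\<lambda>_. {}"] by (auto simp: disjoint_family_on_def)
  then have "(\<lambda>n::nat. \<nu> {}) \<longlonglongrightarrow> 0"
    using sums_summable summable_LIMSEQ_zero by blast
  then show ?thesis
    using LIMSEQ_unique tendsto_const by blast
qed

lemma Un:
  assumes "A \<in> sets M" "B \<in> sets M" "A \<inter> B = {}"
  shows "\<nu> (A \<union> B) = \<nu> A + \<nu> B"
proof -
  have d: "disjoint_family (binaryset A B)"
    using assms by (auto simp: disjoint_family_on_def binaryset_def)
  have "range (binaryset A B) \<subseteq> sets M"
    using assms by (auto simp: binaryset_def)
  from sums_disjoint[OF this d]
  have "(\<lambda>n. \<nu> (binaryset A B n)) sums \<nu> (A \<union> B)"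
    by (simp add: UN_binaryset_eq)
  moreover have "(\<lambda>n. \<nu> (binaryset A B n)) sums (\<nu> A + \<nu> B)"
    by (rule binaryset_sums) (rule empty)
  ultimately show ?thesis using sums_unique2 by blast
qed

lemma Diff:
  assumes "A \<in> sets M" "B \<in> sets M" "B \<subseteq> A"
  shows "\<nu> (A - B) = \<nu> A - \<nu> B"
proof -
  have "\<nu> (B \<union> (A - B)) = \<nu> B + \<nu> (A - B)"
    using assms by (intro Un) auto
  moreover have "B \<union> (A - B) = A" using assms by auto
  ultimately show ?thesis by simp
qed

lemma LIMSEQ_incseq:
  assumes A: "range A \<subseteq> sets M" and inc: "incseq A"
  shows "(\<lambda>n. \<nu> (A n)) \<longlonglongrightarrow> \<nu> (\<Union>n. A n)"
proof -
  have m: "range (disjointed A) \<subseteq> sets M"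
    using A by (rule sets.range_disjointed_sets)
  have s: "(\<lambda>n. \<nu> (disjointed A n)) sums \<nu> (\<Union>n. A n)"
    using sums_disjoint[OF m disjoint_family_disjointed] by (simp add: UN_disjointed_eq)
  have "(\<Sum>i<Suc n. \<nu> (disjointed A i)) = \<nu> (A n)" for n
  proof (induction n)
    case 0
    then show ?case by simp
  next
    case (Suc n)
    have "disjointed A (Suc n) = A (Suc n) - A n"
      using inc by (rule disjointed_mono)
    then have "\<nu> (disjointed A (Suc n)) = \<nu> (A (Suc n)) - \<nu> (A n)"
      using A inc by (auto intro!: Diff simp: incseq_Suc_iff)
    with Suc show ?case by simp
  qed
  moreover have "(\<lambda>n. \<Sum>i<Suc n. \<nu> (disjointed A i)) \<longlonglongrightarrow> \<nu> (\<Union>n. A n)"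
    using s unfolding sums_def by (rule LIMSEQ_Suc)
  ultimately show ?thesis by simp
qed

lemma LIMSEQ_decseq:
  assumes A: "range A \<subseteq> sets M" and dec: "decseq A"
  shows "(\<lambda>n. \<nu> (A n)) \<longlonglongrightarrow> \<nu> (\<Inter>n. A n)"
proof -
  have I: "(\<Inter>n. A n) \<in> sets M" using A by auto
  have "(\<lambda>n. \<nu> (A 0 - A n)) \<longlonglongrightarrow> \<nu> (\<Union>n. A 0 - A n)"
    using A dec by (intro LIMSEQ_incseq) (auto simp: monotone_def)
  moreover have "(\<Union>n. A 0 - A n) = A 0 - (\<Inter>n. A n)" by auto
  moreover have "\<nu> (A 0 - A n) = \<nu> (A 0) - \<nu> (A n)" for n
    using A dec by (intro Diff) (auto simp: decseq_def)
  moreover have "\<nu> (A 0 - (\<Inter>n. A n)) = \<nu> (A 0) - \<nu> (\<Inter>n. A n)"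
    using A I by (intro Diff) auto
  ultimately have "(\<lambda>n. \<nu> (A 0) - \<nu> (A n)) \<longlonglongrightarrow> \<nu> (A 0) - \<nu> (\<Inter>n. A n)" by simp
  then have "(\<lambda>n. \<nu> (A 0) - (\<nu> (A 0) - \<nu> (A n))) \<longlonglongrightarrow> \<nu> (A 0) - (\<nu> (A 0) - \<nu> (\<Inter>n. A n))"
    by (rule tendsto_diff[OF tendsto_const])
  then show ?thesis by simp
qed

definition positive :: "'a set \<Rightarrow> bool" where
  "positive P \<longleftrightarrow> P \<in> sets M \<and> (\<forall>C\<in>sets M. C \<subseteq> P \<longrightarrow> 0 \<le> \<nu> C)"

text \<open>As long as the conclusion fails, a subset of measure at most \<open>- e\<close> can be removed,
and this does not decrease the measure of what remains. If it failed for ever, the measures of the decreasing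
remainders would increase by at least \<open>e\<close> in each step, although they converge.\<close>

lemma almost_positive_subset:
  assumes A: "A \<in> sets M" and e: "0 < (e::real)"
  shows "\<exists>B\<in>sets M. B \<subseteq> A \<and> \<nu> A \<le> \<nu> B \<and> (\<forall>C\<in>sets M. C \<subseteq> B \<longrightarrow> - e < \<nu> C)"
proof (rule ccontr)
  assume contra: "\<not> ?thesis"
  define good where "good B \<longleftrightarrow> B \<in> sets M \<and> B \<subseteq> A \<and> \<nu> A \<le> \<nu> B" for B
  have "\<exists>B'. good B' \<and> B' \<subseteq> B \<and> \<nu> (B - B') \<le> - e" if "good B" for B
  proof -
    have "\<not> (\<forall>C\<in>sets M. C \<subseteq> B \<longrightarrow> - e < \<nu> C)"
      using contra that unfolding good_def by blast
    then obtain C where C: "C \<in> sets M" "C \<subseteq> B" "\<nu> C \<le> - e"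
      by (auto simp: not_less)
    have "\<nu> (B - C) = \<nu> B - \<nu> C"
      using C that by (intro Diff) (auto simp: good_def)
    moreover have "B - (B - C) = C" using C by auto
    ultimately show ?thesis
      using C that e by (intro exI[of _ "B - C"]) (auto simp: good_def)
  qed
  then obtain f where f: "\<And>B. good B \<Longrightarrow> good (f B) \<and> f B \<subseteq> B \<and> \<nu> (B - f B) \<le> - e"
    by metis
  define S where "S n = (f ^^ n) A" for n
  have g: "good (S n)" for n
    by (induction n) (use A f in \<open>auto simp: S_def good_def\<close>)
  have S: "S (Suc n) \<subseteq> S n" "\<nu> (S n - S (Suc n)) \<le> - e" for n
    using f[OF g[of n]] by (auto simp: S_def)
  have dec: "decseq S" using S by (simp add: decseq_Suc_iff)
  have "(\<lambda>n. \<nu> (S n)) \<longlonglongrightarrow> \<nu> (\<Inter>n. S n)"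
    using g dec by (intro LIMSEQ_decseq) (auto simp: good_def)
  then have "(\<lambda>n. \<nu> (S n) - \<nu> (S (Suc n))) \<longlonglongrightarrow> \<nu> (\<Inter>n. S n) - \<nu> (\<Inter>n. S n)"
    by (intro tendsto_diff LIMSEQ_Suc)
  moreover have "\<nu> (S n) - \<nu> (S (Suc n)) = \<nu> (S n - S (Suc n))" for n
    using g[of n] g[of "Suc n"] S(1)[of n] by (subst Diff) (auto simp: good_def)
  ultimately have "(\<lambda>n. \<nu> (S n - S (Suc n))) \<longlonglongrightarrow> 0" by simp
  then have "0 \<le> - e"
    by (rule LIMSEQ_le_const2) (use S in auto)
  with e show False by simp
qed

text \<open>Shrinking repeatedly, with tolerance \<open>1 / n\<close> in step \<open>n\<close>, leaves an intersection
none of whose subsets has negative measure.\<close>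

lemma positive_subset:
  assumes A: "A \<in> sets M"
  shows "\<exists>P. positive P \<and> P \<subseteq> A \<and> \<nu> A \<le> \<nu> P"
proof -
  have "\<forall>n B. \<exists>B'. B \<in> sets M \<longrightarrow> B' \<in> sets M \<and> B' \<subseteq> B \<and> \<nu> B \<le> \<nu> B' \<and>
      (\<forall>C\<in>sets M. C \<subseteq> B' \<longrightarrow> - (1 / real (Suc n)) < \<nu> C)"
    using almost_positive_subset by (metis of_nat_0_less_iff zero_less_Suc zero_less_divide_1_iff)
  then obtain f where f: "\<And>n B. B \<in> sets M \<Longrightarrow> f n B \<in> sets M \<and> f n B \<subseteq> B \<and> \<nu> B \<le> \<nu> (f n B) \<and>
      (\<forall>C\<in>sets M. C \<subseteq> f n B \<longrightarrow> - (1 / real (Suc n)) < \<nu> C)"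
    by metis
  define S where "S = rec_nat A f"
  have S0: "S 0 = A" and SS: "S (Suc n) = f n (S n)" for n by (auto simp: S_def)
  have Sm: "S n \<in> sets M" for n
    by (induction n) (use A f in \<open>auto simp: S0 SS\<close>)
  have inc: "\<nu> A \<le> \<nu> (S n)" for n
  proof (induction n)
    case (Suc n)
    then show ?case using f[OF Sm[of n], of n] by (auto simp: SS)
  qed (simp add: S0)
  have dec: "decseq S" using f[OF Sm] by (simp add: decseq_Suc_iff SS)
  have lim: "(\<lambda>n. \<nu> (S n)) \<longlonglongrightarrow> \<nu> (\<Inter>n. S n)"
    using Sm dec by (intro LIMSEQ_decseq) auto
  show ?thesis
  proof (intro exI conjI)
    show "\<nu> A \<le> \<nu> (\<Inter>n. S n)"
      by (rule LIMSEQ_le_const[OF lim]) (use inc in auto)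
    show "(\<Inter>n. S n) \<subseteq> A" using S0 by auto
    show "positive (\<Inter>n. S n)"
      unfolding positive_def
    proof safe
      show "(\<Inter>n. S n) \<in> sets M" using Sm by auto
      fix C assume C: "C \<in> sets M" "C \<subseteq> (\<Inter>n. S n)"
      have "- (1 / real (Suc n)) \<le> \<nu> C" for n
      proof -
        have "C \<subseteq> S (Suc n)" using C by auto
        then show ?thesis using f[OF Sm[of n], of n] C(1) unfolding SS by fastforce
      qed
      moreover have "(\<lambda>n. - (1 / real (Suc n))) \<longlonglongrightarrow> - 0"
        by (intro tendsto_minus LIMSEQ_Suc[OF lim_1_over_n])
      ultimately show "0 \<le> \<nu> C"
        by (intro LIMSEQ_le_const2[of "\<lambda>n. - (1 / real (Suc n))" 0]) auto
    qed
  qed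
qed

lemma positive_Un:
  assumes "positive P" "positive Q"
  shows "positive (P \<union> Q)"
  unfolding positive_def
proof safe
  show "P \<union> Q \<in> sets M" using assms by (auto simp: positive_def)
  fix C assume C: "C \<in> sets M" "C \<subseteq> P \<union> Q"
  have "C = C \<inter> P \<union> (C - P)" by auto
  moreover have "\<nu> (C \<inter> P \<union> (C - P)) = \<nu> (C \<inter> P) + \<nu> (C - P)"
    using C assms by (intro Un) (auto simp: positive_def)
  moreover have "0 \<le> \<nu> (C \<inter> P)" "0 \<le> \<nu> (C - P)"
  proof -
    have "C \<inter> P \<in> sets M" "C - P \<in> sets M" "C \<inter> P \<subseteq> P" "C - P \<subseteq> Q"
      using C assms by (auto simp: positive_def)
    then show "0 \<le> \<nu> (C \<inter> P)" "0 \<le> \<nu> (C - P)"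
      using assms unfolding positive_def by blast+
  qed
  ultimately show "0 \<le> \<nu> C" by simp
qed

lemma positive_mono:
  assumes "positive Q" "P \<in> sets M" "P \<subseteq> Q"
  shows "\<nu> P \<le> \<nu> Q"
proof -
  have "\<nu> (Q - P) = \<nu> Q - \<nu> P" using assms by (intro Diff) (auto simp: positive_def)
  moreover have "0 \<le> \<nu> (Q - P)" using assms unfolding positive_def by auto
  ultimately show ?thesis by simp
qed

text \<open>Some positive set has maximal measure. A set of positive measure in its complement would
contain a positive set, whose union with the maximal one would have larger measure.\<close>

lemma Hahn_decomposition:
  "\<exists>P. positive P \<and> (\<forall>C\<in>sets M. C \<inter> P = {} \<longrightarrow> \<nu> C \<le> 0)"
proof -
  define V where "V = \<nu> ` {P. positive P}"
  have nonempty: "V \<noteq> {}" unfolding V_def positive_def using empty by auto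
  \<comment> \<open>Countable unions of positive sets are positive, so a set of maximal measure exists.\<close>
  have union: "positive (\<Union>n. P n)" if P: "\<And>n::nat. positive (P n)" for P
  proof -
    define S where "S n = (\<Union>i<Suc n. P i)" for n
    have pS: "positive (S n)" for n
    proof (induction n)
      case 0
      have "S 0 = P 0" by (auto simp: S_def)
      then show ?case using P by simp
    next
      case (Suc n)
      have "S (Suc n) = S n \<union> P (Suc n)" by (auto simp: S_def less_Suc_eq)
      then show ?case using positive_Un[OF Suc P] by simp
    qed
    have U: "(\<Union>n. S n) = (\<Union>n. P n)" by (auto simp: S_def)
    show ?thesis unfolding positive_def
    proof safe
      show "(\<Union>n. P n) \<in> sets M" using P by (auto simp: positive_def)
      fix C assume C: "C \<in> sets M" "C \<subseteq> (\<Union>n. P n)"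
      have "(\<lambda>n. \<nu> (C \<inter> S n)) \<longlonglongrightarrow> \<nu> (\<Union>n. C \<inter> S n)"
        using C pS by (intro LIMSEQ_incseq)
          (auto simp: positive_def incseq_Suc_iff S_def less_Suc_eq)
      moreover have "(\<Union>n. C \<inter> S n) = C" using C U by auto
      moreover have "0 \<le> \<nu> (C \<inter> S n)" for n
        using C pS[of n] unfolding positive_def by auto
      ultimately show "0 \<le> \<nu> C" by (metis LIMSEQ_le_const)
    qed
  qed
  have bdd: "bdd_above V"
  proof (rule ccontr)
    assume "\<not> bdd_above V"
    then have "\<forall>n::nat. \<exists>P. positive P \<and> real n < \<nu> P"
      unfolding bdd_above_def V_def by (auto simp: not_le)
    then obtain P where P: "\<And>n. positive (P n)" "\<And>n. real n < \<nu> (P n)" by metis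
    have "real n < \<nu> (\<Union>n. P n)" for n
      using P(2)[of n] positive_mono[OF union[of P], of "P n"] P(1) by (force simp: positive_def)
    then show False using reals_Archimedean2 less_asym by blast
  qed
  have "\<forall>n. \<exists>P. positive P \<and> Sup V - 1 / real (Suc n) < \<nu> P"
  proof
    fix n
    have "Sup V - 1 / real (Suc n) < Sup V" by simp
    then show "\<exists>P. positive P \<and> Sup V - 1 / real (Suc n) < \<nu> P"
      using less_cSup_iff[OF nonempty bdd] unfolding V_def by auto
  qed
  then obtain P where P: "\<And>n. positive (P n)" "\<And>n. Sup V - 1 / real (Suc n) < \<nu> (P n)" by metis
  let ?Q = "\<Union>n. P n"
  have Q: "positive ?Q" using union P by blast
  have "Sup V - 1 / real (Suc n) \<le> \<nu> ?Q" for n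
    using P(2)[of n] positive_mono[OF Q, of "P n"] P(1) by (force simp: positive_def)
  moreover have "(\<lambda>n. Sup V - 1 / real (Suc n)) \<longlonglongrightarrow> Sup V - 0"
    by (intro tendsto_diff tendsto_const LIMSEQ_Suc[OF lim_1_over_n])
  ultimately have max: "Sup V \<le> \<nu> ?Q"
    by (intro LIMSEQ_le_const2[of "\<lambda>n. Sup V - 1 / real (Suc n)" "Sup V"]) auto
  have "\<nu> C \<le> 0" if C: "C \<in> sets M" "C \<inter> ?Q = {}" for C
  proof -
    obtain R where R: "positive R" "R \<subseteq> C" "\<nu> C \<le> \<nu> R" using positive_subset[OF C(1)] by auto
    have "\<nu> (?Q \<union> R) = \<nu> ?Q + \<nu> R"
      using C R Q by (intro Un) (auto simp: positive_def)
    moreover have "\<nu> (?Q \<union> R) \<le> Sup V"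
      using positive_Un[OF Q R(1)] bdd by (intro cSup_upper) (auto simp: V_def)
    ultimately show ?thesis using max R by simp
  qed
  with Q show ?thesis by blast
qed

text \<open>\<open>N\<close> is the variation of \<open>\<nu>\<close>, and \<open>f\<close> is the sign given by the Hahn decomposition.\<close>

lemma real_density:
  "\<exists>N f. finite_measure N \<and> sets N = sets M \<and> f \<in> borel_measurable N \<and> (\<forall>x. \<bar>f x\<bar> \<le> 1) \<and>
     (\<forall>B\<in>sets M. \<nu> B = (LINT x|N. indicator B x * f x))"
proof -
  obtain P where P: "positive P" "\<And>C. C \<in> sets M \<Longrightarrow> C \<inter> P = {} \<Longrightarrow> \<nu> C \<le> 0"
    using Hahn_decomposition by auto
  have Pm[measurable]: "P \<in> sets M" using P by (simp add: positive_def)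
  define N where "N = measure_of (space M) (sets M) (\<lambda>B. ennreal (\<nu> (B \<inter> P) - \<nu> (B - P)))"
  have N_sets[measurable_cong]: "sets N = sets M" and N_space: "space N = space M" by (auto simp: N_def)
  have nonneg: "0 \<le> \<nu> (B \<inter> P)" "0 \<le> - \<nu> (B - P)" if "B \<in> sets M" for B
    using P(1) P(2)[of "B - P"] that by (auto simp: positive_def)
  have ca: "countably_additive (sets N) (\<lambda>B. ennreal (\<nu> (B \<inter> P) - \<nu> (B - P)))"
    unfolding countably_additive_def N_sets
  proof safe
    fix A :: "nat \<Rightarrow> 'a set" assume A: "range A \<subseteq> sets M" "disjoint_family A"
    have "(\<lambda>n. \<nu> (A n \<inter> P)) sums \<nu> (\<Union>n. A n \<inter> P)" "(\<lambda>n. \<nu> (A n - P)) sums \<nu> (\<Union>n. A n - P)"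
      using A sums_disjoint[of "\<lambda>n. A n \<inter> P"] sums_disjoint[of "\<lambda>n. A n - P"]
      by (auto simp: disjoint_family_on_def image_subset_iff)
    from sums_diff[OF this]
    have "(\<lambda>n. \<nu> (A n \<inter> P) - \<nu> (A n - P)) sums (\<nu> (\<Union> (range A) \<inter> P) - \<nu> (\<Union> (range A) - P))"
      by (simp only: UN_simps)
    then show "(\<Sum>i. ennreal (\<nu> (A i \<inter> P) - \<nu> (A i - P))) = ennreal (\<nu> (\<Union> (range A) \<inter> P) - \<nu> (\<Union> (range A) - P))"
      using nonneg A by (intro suminf_ennreal_eq) (auto intro!: add_nonneg_nonneg simp: diff_conv_add_uminus simp del: add_uminus_conv_diff)
  qed
  have emeasure_N: "emeasure N B = ennreal (\<nu> (B \<inter> P) - \<nu> (B - P))" if "B \<in> sets M" for B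
    using ca that by (intro emeasure_measure_of[OF N_def]) (auto simp: positive_def Sigma_Algebra.positive_def empty sets.space_closed N_sets)
  have fin: "finite_measure N" by (rule finite_measureI) (simp add: N_space emeasure_N)
  have measure_N: "measure N B = \<nu> (B \<inter> P) - \<nu> (B - P)" if "B \<in> sets M" for B
    using nonneg[OF that] by (simp add: measure_def emeasure_N[OF that])
  interpret finite_measure N by fact
  define f where "f x = (indicator P x - indicator (space M - P) x :: real)" for x
  have "\<nu> B = (LINT x|N. indicator B x * f x)" if B: "B \<in> sets M" for B
  proof -
    have "(LINT x|N. indicator B x * f x) = (LINT x|N. indicator (B \<inter> P) x - indicator (B - P) x)"
      using sets.sets_into_space[OF B] by (intro Bochner_Integration.integral_cong) (auto simp: f_def indicator_def)
    also have "\<dots> = measure N (B \<inter> P) - measure N (B - P)"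
      using B by (subst Bochner_Integration.integral_diff) (auto simp: N_sets less_top[symmetric])
    also have "\<dots> = \<nu> (B \<inter> P) + \<nu> (B - P)"
    proof -
      have e: "(B - P) \<inter> P = {}" "B \<inter> P - P = {}" "B \<inter> P \<inter> P = B \<inter> P" "B - P - P = B - P" by auto
      show ?thesis
        unfolding measure_N[OF sets.Int[OF B Pm]] measure_N[OF sets.Diff[OF B Pm]] e empty by simp
    qed
    also have "\<dots> = \<nu> (B \<inter> P \<union> (B - P))" using B by (intro Un[symmetric]) auto
    also have "B \<inter> P \<union> (B - P) = B" by auto
    finally show ?thesis by simp
  qed
  moreover have "f \<in> borel_measurable N" unfolding f_def by measurable
  moreover have "\<bar>f x\<bar> \<le> 1" for x by (auto simp: f_def indicator_def)
  ultimately show ?thesis using fin N_sets by blast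
qed

end

text \<open>The sum of the measures dominates each of them, so Radon-Nikodym applies.\<close>

lemma common_dominating_measure:
  assumes I: "finite I" and M: "\<And>j. j \<in> I \<Longrightarrow> finite_measure (M j)" "\<And>j. j \<in> I \<Longrightarrow> sets (M j) = sets K"
  shows "\<exists>\<Lambda> e. finite_measure \<Lambda> \<and> sets \<Lambda> = sets K \<and> (\<forall>j\<in>I. e j \<in> borel_measurable \<Lambda> \<and>
    (\<forall>x. 0 \<le> e j x) \<and> M j = density \<Lambda> (\<lambda>x. ennreal (e j x)))"
proof -
  define \<Lambda> where "\<Lambda> = measure_of (space K) (sets K) (\<lambda>B. \<Sum>j\<in>I. emeasure (M j) B)"
  have \<Lambda>_sets: "sets \<Lambda> = sets K" and \<Lambda>_space: "space \<Lambda> = space K" by (auto simp: \<Lambda>_def)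
  have ca: "countably_additive (sets \<Lambda>) (\<lambda>B. \<Sum>j\<in>I. emeasure (M j) B)"
    unfolding countably_additive_def \<Lambda>_sets
  proof safe
    fix A :: "nat \<Rightarrow> 'b set" assume A: "range A \<subseteq> sets K" "disjoint_family A"
    have "(\<Sum>i. \<Sum>j\<in>I. emeasure (M j) (A i)) = (\<Sum>j\<in>I. \<Sum>i. emeasure (M j) (A i))"
      by (rule suminf_sum) simp
    also have "\<dots> = (\<Sum>j\<in>I. emeasure (M j) (\<Union> (range A)))"
      using A M by (intro sum.cong refl suminf_emeasure) auto
    finally show "(\<Sum>i. \<Sum>j\<in>I. emeasure (M j) (A i)) = (\<Sum>j\<in>I. emeasure (M j) (\<Union> (range A)))" .
  qed
  have em: "emeasure \<Lambda> B = (\<Sum>j\<in>I. emeasure (M j) B)" if "B \<in> sets K" for B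
    using ca that by (intro emeasure_measure_of[OF \<Lambda>_def]) (auto simp: Sigma_Algebra.positive_def sets.space_closed \<Lambda>_sets)
  have fin: "finite_measure \<Lambda>"
  proof (rule finite_measureI)
    have "emeasure (M j) (space K) \<noteq> \<infinity>" if "j \<in> I" for j
      using finite_measure.emeasure_finite[OF M(1)[OF that]] by simp
    then show "emeasure \<Lambda> (space \<Lambda>) \<noteq> \<infinity>" using I by (simp add: \<Lambda>_space em ennreal_sum_eq_top)
  qed
  interpret finite_measure \<Lambda> by fact
  have "\<exists>e. e \<in> borel_measurable \<Lambda> \<and> (\<forall>x. 0 \<le> e x) \<and> M j = density \<Lambda> (\<lambda>x. ennreal (e x))" if j: "j \<in> I" for j
  proof -
    have ac: "absolutely_continuous \<Lambda> (M j)"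
      unfolding absolutely_continuous_def
    proof
      fix B assume "B \<in> null_sets \<Lambda>"
      then have B: "B \<in> sets K" "(\<Sum>j\<in>I. emeasure (M j) B) = 0" using em by (auto simp: \<Lambda>_sets null_sets_def)
      then have "emeasure (M j) B = 0" using j I by (simp add: sum_eq_0_iff)
      then show "B \<in> null_sets (M j)" using B M j by (auto simp: null_sets_def)
    qed
    have s: "sets (M j) = sets \<Lambda>" using M j by (simp add: \<Lambda>_sets)
    obtain D where D: "D \<in> borel_measurable \<Lambda>" "AE x in \<Lambda>. RN_deriv \<Lambda> (M j) x = ennreal (D x)" "\<And>x. 0 \<le> D x"
      using real_RN_deriv[OF M(1)[OF j] ac s] by metis
    have "M j = density \<Lambda> (RN_deriv \<Lambda> (M j))" using density_RN_deriv[OF ac s] by simp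
    also have "\<dots> = density \<Lambda> (\<lambda>x. ennreal (D x))"
      using D by (intro density_cong) auto
    finally show ?thesis using D by blast
  qed
  then obtain e where "\<And>j. j \<in> I \<Longrightarrow> e j \<in> borel_measurable \<Lambda> \<and> (\<forall>x. 0 \<le> e j x) \<and> M j = density \<Lambda> (\<lambda>x. ennreal (e j x))"
    by metis
  then show ?thesis using fin \<Lambda>_sets by blast
qed

text \<open>Among the subsets of \<open>B\<close>, the part of \<open>B\<close> where \<open>g\<close> is positive
has the largest measure.\<close>

lemma positive_part_eq_density:
  fixes M :: "'a::topological_space measure" and g :: "'a \<Rightarrow> real"
  assumes \<Omega>: "\<Omega> \<in> sets borel" and M: "sets M = borel_subsets \<Omega>" and sp: "space M = \<Omega>"
    and g: "integrable M g"
    and \<nu>: "\<And>B. B \<in> sets M \<Longrightarrow> \<nu> B = (LINT x|M. indicator B x * g x)"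
  shows "positive_part \<Omega> \<nu> = density M (\<lambda>x. ennreal (g x))"
proof -
  have [measurable]: "g \<in> borel_measurable M" using g by auto
  have *: "(SUP A\<in>borel_subsets B. ennreal (\<nu> A)) = emeasure (density M (\<lambda>x. ennreal (g x))) B"
    if B: "B \<in> sets M" for B
  proof (rule antisym)
    have ind: "integrable M (\<lambda>x. indicator A x * g x)" if "A \<in> sets M" for A
      using integrable_mult_indicator[OF that g] by simp
    show "(SUP A\<in>borel_subsets B. ennreal (\<nu> A)) \<le> emeasure (density M (\<lambda>x. ennreal (g x))) B"
    proof (rule SUP_least)
      fix A assume "A \<in> borel_subsets B"
      then have A: "A \<in> sets M" "A \<subseteq> B" using B unfolding M by (auto simp: borel_subsets_def)
      have "\<nu> A \<le> (LINT x|M. indicator A x * max 0 (g x))"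
        unfolding \<nu>[OF A(1)]
        by (intro integral_mono ind A) (use integrable_mult_indicator[OF A(1) integrable_max[OF integrable_zero g]] in \<open>auto simp: indicator_def\<close>)
      then have "ennreal (\<nu> A) \<le> ennreal (LINT x|M. indicator A x * max 0 (g x))" by (rule ennreal_leI)
      also have "\<dots> = (\<integral>\<^sup>+x. ennreal (indicator A x * max 0 (g x)) \<partial>M)"
        using integrable_mult_indicator[OF A(1) integrable_max[OF integrable_zero g]]
        by (intro nn_integral_eq_integral[symmetric]) (auto simp: indicator_def)
      also have "\<dots> \<le> (\<integral>\<^sup>+x. ennreal (g x) * indicator B x \<partial>M)"
        using A by (intro nn_integral_mono) (auto simp: indicator_def max_def ennreal_neg)
      also have "\<dots> = emeasure (density M (\<lambda>x. ennreal (g x))) B"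
        using B by (subst emeasure_density) auto
      finally show "ennreal (\<nu> A) \<le> emeasure (density M (\<lambda>x. ennreal (g x))) B" .
    qed
    let ?A = "B \<inter> {x\<in>space M. 0 < g x}"
    have A: "?A \<in> sets M" using B by measurable
    have "emeasure (density M (\<lambda>x. ennreal (g x))) B = (\<integral>\<^sup>+x. ennreal (g x) * indicator B x \<partial>M)"
      using B by (subst emeasure_density) auto
    also have "\<dots> = (\<integral>\<^sup>+x. ennreal (indicator ?A x * g x) \<partial>M)"
      by (intro nn_integral_cong) (auto simp: indicator_def ennreal_neg not_less)
    also have "\<dots> = ennreal (\<nu> ?A)"
      unfolding \<nu>[OF A] using ind[OF A] by (intro nn_integral_eq_integral) (auto simp: indicator_def)
    also have "\<dots> \<le> (SUP A\<in>borel_subsets B. ennreal (\<nu> A))"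
      using A unfolding M by (intro SUP_upper) (auto simp: borel_subsets_def)
    finally show "emeasure (density M (\<lambda>x. ennreal (g x))) B \<le> (SUP A\<in>borel_subsets B. ennreal (\<nu> A))" .
  qed
  have sig: "sigma_sets \<Omega> (borel_subsets \<Omega>) = sets M"
    using sets.sigma_sets_eq[of M] by (simp add: M sp)
  have "positive_part \<Omega> \<nu> = measure_of \<Omega> (borel_subsets \<Omega>) (emeasure (density M (\<lambda>x. ennreal (g x))))"
    unfolding positive_part_def
    by (rule measure_of_eq) (use * sig in \<open>auto simp: borel_subsets_def\<close>)
  also have "\<dots> = density M (\<lambda>x. ennreal (g x))"
    using measure_of_of_measure[of "density M (\<lambda>x. ennreal (g x))"] by (simp add: M sp)
  finally show ?thesis .
qed

text \<open>Reduces integrals defined through the Jordan decomposition to ordinary ones.\<close>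

lemma signed_integral_density:
  fixes M :: "'a::topological_space measure" and g :: "'a \<Rightarrow> real"
  assumes \<Omega>: "\<Omega> \<in> sets borel" and M: "sets M = borel_subsets \<Omega>" and sp: "space M = \<Omega>"
    and g: "integrable M g"
    and \<nu>: "\<And>B. B \<in> sets M \<Longrightarrow> \<nu> B = (LINT x|M. indicator B x * g x)"
    and \<phi>[measurable]: "\<phi> \<in> borel_measurable M" and bdd: "\<And>x. \<bar>\<phi> x\<bar> \<le> C"
  shows "signed_integral \<Omega> \<nu> \<phi> = (LINT x|M. \<phi> x * g x)"
proof -
  have [measurable]: "g \<in> borel_measurable M" using g by auto
  have half: "(LINT x|density M (\<lambda>x. ennreal (h x)). \<phi> x) = (LINT x|M. max 0 (h x) * \<phi> x)"
    if [measurable]: "h \<in> borel_measurable M" for h :: "'a \<Rightarrow> real"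
  proof -
    have "density M (\<lambda>x. ennreal (h x)) = density M (\<lambda>x. ennreal (max 0 (h x)))"
      by (intro arg_cong2[where f=density] ext) (auto simp: max_def ennreal_neg)
    then show ?thesis by (simp add: integral_density)
  qed
  have int: "integrable M (\<lambda>x. max 0 (h x) * \<phi> x)" if h: "integrable M h" for h :: "'a \<Rightarrow> real"
  proof (rule Bochner_Integration.integrable_bound)
    show "integrable M (\<lambda>x. C * h x)" using h by auto
    have [measurable]: "h \<in> borel_measurable M" using h by auto
    show "(\<lambda>x. max 0 (h x) * \<phi> x) \<in> borel_measurable M" by measurable
    have "0 \<le> C" using bdd[of undefined] by linarith
    then show "AE x in M. norm (max 0 (h x) * \<phi> x) \<le> norm (C * h x)"
      using bdd by (intro AE_I2) (auto simp: abs_mult mult.commute intro!: mult_mono)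
  qed
  have "positive_part \<Omega> \<nu> = density M (\<lambda>x. ennreal (g x))"
    by (rule positive_part_eq_density[OF \<Omega> M sp g \<nu>])
  moreover have "positive_part \<Omega> (\<lambda>B. - \<nu> B) = density M (\<lambda>x. ennreal (- g x))"
    by (rule positive_part_eq_density[OF \<Omega> M sp]) (use g \<nu> in auto)
  ultimately have "signed_integral \<Omega> \<nu> \<phi> = (LINT x|M. max 0 (g x) * \<phi> x) - (LINT x|M. max 0 (- g x) * \<phi> x)"
    by (simp add: signed_integral_def half)
  also have "\<dots> = (LINT x|M. max 0 (g x) * \<phi> x - max 0 (- g x) * \<phi> x)"
    using int[OF g] int[of "\<lambda>x. - g x"] g by simp
  also have "\<dots> = (LINT x|M. \<phi> x * g x)"
    by (intro Bochner_Integration.integral_cong) (auto simp: max_def)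
  finally show ?thesis .
qed

text \<open>Around the points of a countable dense set, space is cut into countably
many pieces on which \<open>f\<close> varies by less than \<open>e\<close>. On such a piece the norm of the integral falls short of
the integral of the norm by at most \<open>2 * e\<close> times its measure.\<close>

lemma nn_integral_norm_le_total_variation:
  fixes M :: "'a::topological_space measure" and f :: "'a \<Rightarrow> 'b::euclidean_space"
  assumes M: "finite_measure M" "sets M = borel_subsets \<Omega>" and f: "integrable M f"
    and \<nu>: "\<And>B. B \<in> sets M \<Longrightarrow> \<nu> B = (LINT x|M. indicator B x *\<^sub>R f x)"
    and B: "B \<in> sets M"
  shows "(\<integral>\<^sup>+x. ennreal (norm (f x)) * indicator B x \<partial>M) \<le> total_variation \<nu> B"
proof -
  interpret finite_measure M by fact
  have [measurable]: "f \<in> borel_measurable M" using f by auto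
  obtain D :: "'b set" where D: "countable D" "\<And>X. open X \<Longrightarrow> X \<noteq> {} \<Longrightarrow> \<exists>d\<in>D. d \<in> X"
    using countable_dense_setE by metis
  have "D \<noteq> {}" using D(2)[of UNIV] by auto
  define d where "d = from_nat_into D"
  have approx: "\<exists>n. norm (y - d n) < e" if "0 < e" for y e
  proof -
    obtain c where "c \<in> D" "c \<in> ball y e" using D(2)[of "ball y e"] \<open>0 < e\<close> by auto
    then show ?thesis using from_nat_into_surj[OF D(1)] by (auto simp: d_def dist_norm)
  qed
  have main: "(\<integral>\<^sup>+x. ennreal (norm (f x)) * indicator B x \<partial>M) \<le> total_variation \<nu> B + ennreal (2 * e) * emeasure M B"
    if e: "0 < e" for e
  proof -
    define S where "S n = {x\<in>space M. norm (f x - d n) < e}" for n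
    define A where "A n = disjointed S n \<inter> B" for n
    have S[measurable]: "S n \<in> sets M" for n unfolding S_def by measurable
    have A[measurable]: "A n \<in> sets M" for n
      using B sets.range_disjointed_sets[of S M] S by (auto simp: A_def image_subset_iff)
    have disj: "disjoint_family A"
      using disjoint_family_disjointed[of S] by (auto simp: A_def disjoint_family_on_def)
    have "(\<Union>n. S n) = space M" using approx[OF e] by (auto simp: S_def)
    then have U: "(\<Union>n. A n) = B"
      using sets.sets_into_space[OF B] by (simp add: A_def UN_disjointed_eq flip: Int_UN_distrib2) auto
    have close: "norm (f x - d n) < e" if "x \<in> A n" for x n
      using that disjointed_subset[of S n] by (auto simp: A_def S_def)
    have piece: "(\<integral>\<^sup>+x. ennreal (norm (f x)) * indicator (A n) x \<partial>M) \<le>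
        ennreal (norm (\<nu> (A n))) + ennreal (2 * e) * emeasure M (A n)" for n
    proof -
      have int1: "integrable M (\<lambda>x. indicator (A n) x *\<^sub>R f x)"
        using integrable_mult_indicator[OF A f] .
      have int2: "integrable M (\<lambda>x. indicator (A n) x *\<^sub>R d n)"
        using integrable_mult_indicator[OF A integrable_const] .
      have int3: "integrable M (\<lambda>x. indicator (A n) x * norm (f x))"
        using integrable_mult_indicator[OF A integrable_norm[OF f]] by simp
      have c: "(LINT x|M. indicator (A n) x *\<^sub>R d n) = measure M (A n) *\<^sub>R d n"
        using sets.sets_into_space[OF A] by (simp add: Int_absorb2 less_top[symmetric])
      have "norm (\<nu> (A n) - measure M (A n) *\<^sub>R d n) = norm (LINT x|M. indicator (A n) x *\<^sub>R f x - indicator (A n) x *\<^sub>R d n)"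
        unfolding \<nu>[OF A] using int1 int2 c by simp
      also have "\<dots> \<le> (LINT x|M. norm (indicator (A n) x *\<^sub>R f x - indicator (A n) x *\<^sub>R d n))"
        by (rule integral_norm_bound)
      also have "\<dots> \<le> (LINT x|M. indicator (A n) x * e)"
      proof (rule integral_mono)
        show "integrable M (\<lambda>x. norm (indicator (A n) x *\<^sub>R f x - indicator (A n) x *\<^sub>R d n))"
          using int1 int2 by auto
        show "integrable M (\<lambda>x. indicator (A n) x * e)" by (auto simp: less_top[symmetric])
        show "norm (indicator (A n) x *\<^sub>R f x - indicator (A n) x *\<^sub>R d n) \<le> indicator (A n) x * e" for x
          using close[of x n] by (auto simp: indicator_def)
      qed
      also have "\<dots> = e * measure M (A n)"
        using sets.sets_into_space[OF A] by (simp add: Int_absorb2)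
      finally have 1: "measure M (A n) * norm (d n) \<le> norm (\<nu> (A n)) + e * measure M (A n)"
        using norm_triangle_ineq2[of "measure M (A n) *\<^sub>R d n" "\<nu> (A n)"] by (simp add: norm_minus_commute)
      have "(LINT x|M. indicator (A n) x * norm (f x)) \<le> (LINT x|M. indicator (A n) x * (norm (d n) + e))"
      proof (rule integral_mono[OF int3])
        show "integrable M (\<lambda>x. indicator (A n) x * (norm (d n) + e))" by (auto simp: less_top[symmetric])
        show "indicator (A n) x * norm (f x) \<le> indicator (A n) x * (norm (d n) + e)" for x
          using close[of x n] norm_triangle_ineq2[of "f x" "d n"] by (auto simp: indicator_def)
      qed
      also have "\<dots> = (norm (d n) + e) * measure M (A n)"
        using sets.sets_into_space[OF A] by (simp add: Int_absorb2)
      finally have 2: "(LINT x|M. indicator (A n) x * norm (f x)) \<le> norm (\<nu> (A n)) + 2 * e * measure M (A n)"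
        using 1 by (simp add: algebra_simps)
      have "(\<integral>\<^sup>+x. ennreal (norm (f x)) * indicator (A n) x \<partial>M) = (\<integral>\<^sup>+x. ennreal (indicator (A n) x * norm (f x)) \<partial>M)"
        by (intro nn_integral_cong) (auto simp: indicator_def)
      also have "\<dots> = ennreal (LINT x|M. indicator (A n) x * norm (f x))"
        using int3 by (intro nn_integral_eq_integral) auto
      also have "\<dots> \<le> ennreal (norm (\<nu> (A n)) + 2 * e * measure M (A n))" using 2 by (rule ennreal_leI)
      also have "\<dots> = ennreal (norm (\<nu> (A n))) + ennreal (2 * e) * emeasure M (A n)"
        using e by (simp add: ennreal_plus ennreal_mult emeasure_eq_measure)
      finally show ?thesis .
    qed
    have "(\<integral>\<^sup>+x. ennreal (norm (f x)) * indicator B x \<partial>M) = (\<integral>\<^sup>+x. (\<Sum>n. ennreal (norm (f x)) * indicator (A n) x) \<partial>M)"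
      unfolding U[symmetric] using disj by (intro nn_integral_cong) (simp add: suminf_indicator)
    also have "\<dots> = (\<Sum>n. \<integral>\<^sup>+x. ennreal (norm (f x)) * indicator (A n) x \<partial>M)"
      by (rule nn_integral_suminf) measurable
    also have "\<dots> \<le> (\<Sum>n. ennreal (norm (\<nu> (A n))) + ennreal (2 * e) * emeasure M (A n))"
      by (intro suminf_le piece) auto
    also have "\<dots> = (\<Sum>n. ennreal (norm (\<nu> (A n)))) + ennreal (2 * e) * (\<Sum>n. emeasure M (A n))"
      by (simp add: suminf_add[symmetric])
    also have "(\<Sum>n. emeasure M (A n)) = emeasure M B"
      using disj A by (subst suminf_emeasure) (auto simp: U)
    also have "(\<Sum>n. ennreal (norm (\<nu> (A n)))) \<le> total_variation \<nu> B"
      unfolding total_variation_def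
      by (rule SUP_upper) (use A disj U in \<open>auto simp: M borel_subsets_def\<close>)
    finally show ?thesis by (auto intro: add_right_mono)
  qed
  show ?thesis
  proof (rule ennreal_le_epsilon)
    fix \<eta> :: real assume \<eta>: "0 < \<eta>"
    \<comment> \<open>The summand one keeps the denominator positive when \<open>B\<close> is a null set.\<close>
    define e where "e = \<eta> / (2 * (measure M B + 1))"
    have pos: "0 < measure M B + 1" by (simp add: add_nonneg_pos)
    have e: "0 < e" using \<eta> pos by (simp add: e_def)
    have "2 * e * measure M B \<le> \<eta>" using \<eta> pos by (simp add: e_def field_simps)
    then have "ennreal (2 * e) * emeasure M B \<le> ennreal \<eta>"
      using e by (simp add: emeasure_eq_measure ennreal_mult[symmetric] ennreal_leI)
    then show "(\<integral>\<^sup>+x. ennreal (norm (f x)) * indicator B x \<partial>M) \<le> total_variation \<nu> B + ennreal \<eta>"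
      using main[OF e] by (meson add_left_mono order_trans)
  qed
qed

lemma radon_measure_density:
  assumes M: "sets M = borel_subsets \<Omega>" and h: "integrable M (h :: 'a::euclidean_space \<Rightarrow> real)"
  shows "radon_measure \<Omega> (\<lambda>B. LINT x|M. indicator B x * h x)"
  unfolding radon_measure_def
proof safe
  fix A :: "nat \<Rightarrow> 'a set" assume A: "range A \<subseteq> borel_subsets \<Omega>" "disjoint_family A"
  then have Am: "A n \<in> sets M" for n using M by auto
  define S where "S n = (\<Union>i<n. A i)" for n
  have ind: "indicator (S n) x = (\<Sum>i<n. indicator (A i) x :: real)" for n x
    unfolding S_def using A(2) by (intro indicator_UN_disjoint) (auto simp: disjoint_family_on_def)
  have int: "integrable M (\<lambda>x. indicator (A i) x * h x)" for i
    using integrable_mult_indicator[OF Am h] by simp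
  have "(\<lambda>n. LINT x|M. indicator (S n) x * h x) \<longlonglongrightarrow> (LINT x|M. indicator (\<Union> (range A)) x * h x)"
  proof (rule integral_dominated_convergence)
    show "integrable M (\<lambda>x. norm (h x))" using h by auto
    show "AE x in M. (\<lambda>n. indicator (S n) x * h x) \<longlonglongrightarrow> indicator (\<Union> (range A)) x * h x"
    proof (rule AE_I2)
      fix x
      have "(\<lambda>n. indicator (\<Union>i<n. A i) x :: real) \<longlonglongrightarrow> indicator (\<Union> (range A)) x"
        by (rule LIMSEQ_indicator_UN)
      then show "(\<lambda>n. indicator (S n) x * h x) \<longlonglongrightarrow> indicator (\<Union> (range A)) x * h x"
        unfolding S_def by (rule tendsto_mult_right)
    qed
    show "AE x in M. norm (indicator (S n) x * h x) \<le> norm (h x)" for n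
      by (auto simp: indicator_def)
    have "S n \<in> sets M" for n using Am by (auto simp: S_def)
    then show "(\<lambda>x. indicator (S n) x * h x) \<in> borel_measurable M" for n using h by auto
    have "\<Union> (range A) \<in> sets M" using Am by auto
    then show "(\<lambda>x. indicator (\<Union> (range A)) x * h x) \<in> borel_measurable M" using h by auto
  qed
  moreover have "(LINT x|M. indicator (S n) x * h x) = (\<Sum>i<n. LINT x|M. indicator (A i) x * h x)" for n
    using Bochner_Integration.integral_sum[of "{..<n}" M "\<lambda>i x. indicator (A i) x * h x"] int
    by (simp only: ind sum_distrib_right)
  ultimately show "(\<lambda>n. LINT x|M. indicator (A n) x * h x) sums (LINT x|M. indicator (\<Union> (range A)) x * h x)"
    by (simp add: sums_def)
qed

text \<open>Lebesgue measure on \<open>\<Omega>\<close> is included among the dominated measures, with density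
\<open>e\<close>, in order that a measure given by a density with respect to \<open>\<nu>\<close> and one given by an integrable function
can be added as densities with respect to the same \<open>M\<close>.\<close>

lemma vector_measure_density:
  fixes \<nu> :: "'a::euclidean_space set \<Rightarrow> 'a"
  assumes \<Omega>: "open \<Omega>" "bounded \<Omega>" and \<nu>: "radon_measure \<Omega> \<nu>"
  shows "\<exists>M f e. finite_measure M \<and> sets M = borel_subsets \<Omega> \<and>
    (\<forall>c\<in>Basis. integrable M (f c) \<and> (\<forall>B\<in>borel_subsets \<Omega>. \<nu> B \<bullet> c = (LINT x|M. indicator B x * f c x))) \<and>
    (\<forall>H :: 'a \<Rightarrow> real. integrable lborel H \<longrightarrow> integrable M (\<lambda>x. e x * H x) \<and>
      (\<forall>B\<in>borel_subsets \<Omega>. (LINT x|lborel. indicator B x * H x) = (LINT x|M. indicator B x * (e x * H x))))"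
proof -
  define K where "K = restrict_space (lborel :: 'a measure) \<Omega>"
  have \<Omega>b: "\<Omega> \<in> sets borel" using \<Omega> by auto
  have K: "sets K = borel_subsets \<Omega>"
    unfolding K_def borel_subsets_eq_restrict[OF \<Omega>b] by (intro sets_restrict_space_cong) simp
  have K_fin: "finite_measure K"
    using emeasure_bounded_finite[OF \<Omega>(2)] \<Omega>b
    by (intro finite_measureI) (simp add: K_def emeasure_restrict_space space_restrict_space less_top[symmetric])
  have "signed_measure K (\<lambda>B. \<nu> B \<bullet> c)" for c
  proof
    fix A :: "nat \<Rightarrow> 'a set" assume "range A \<subseteq> sets K" "disjoint_family A"
    then have "(\<lambda>n. \<nu> (A n)) sums \<nu> (\<Union>n. A n)" using \<nu> K by (simp add: radon_measure_def)
    then show "(\<lambda>n. \<nu> (A n) \<bullet> c) sums (\<nu> (\<Union>n. A n) \<bullet> c)"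
      by (rule bounded_linear.sums[OF bounded_linear_inner_left])
  qed
  then have "\<forall>c. \<exists>N h. finite_measure N \<and> sets N = sets K \<and> h \<in> borel_measurable N \<and> (\<forall>x. \<bar>h x\<bar> \<le> 1) \<and>
     (\<forall>B\<in>sets K. \<nu> B \<bullet> c = (LINT x|N. indicator B x * h x))"
    using signed_measure.real_density by blast
  then obtain N h where N: "\<And>c. finite_measure (N c)" "\<And>c. sets (N c) = sets K" "\<And>c. h c \<in> borel_measurable (N c)"
    "\<And>c x. \<bar>h c x\<bar> \<le> (1::real)" "\<And>c B. B \<in> sets K \<Longrightarrow> \<nu> B \<bullet> c = (LINT x|N c. indicator B x * h c x)"
    by metis
  \<comment> \<open>The index \<open>0\<close>, which is no basis vector, stands for Lebesgue measure.\<close>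
  define J where "J c = (if c = 0 then K else N c)" for c
  have "\<exists>M e. finite_measure M \<and> sets M = sets K \<and> (\<forall>c\<in>insert 0 Basis. e c \<in> borel_measurable M \<and>
    (\<forall>x. 0 \<le> e c x) \<and> J c = density M (\<lambda>x. ennreal (e c x)))"
    by (rule common_dominating_measure) (use N K_fin in \<open>auto simp: J_def\<close>)
  then obtain M e where M: "finite_measure M" "sets M = sets K"
    and e: "\<And>c. c \<in> insert 0 Basis \<Longrightarrow> e c \<in> borel_measurable M"
      "\<And>c x. c \<in> insert 0 Basis \<Longrightarrow> 0 \<le> e c x"
      "\<And>c. c \<in> insert 0 Basis \<Longrightarrow> J c = density M (\<lambda>x. ennreal (e c x))"
    by metis
  have dens: "integrable M (\<lambda>x. e c x * g x)" "(LINT x|J c. g x) = (LINT x|M. e c x * g x)"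
    if c: "c \<in> insert 0 Basis" and g: "integrable (J c) g" for c and g :: "'a \<Rightarrow> real"
  proof -
    have gm: "g \<in> borel_measurable M"
      using borel_measurable_integrable[OF g] e(3)[OF c] by simp
    show "integrable M (\<lambda>x. e c x * g x)"
      using g unfolding e(3)[OF c] by (subst (asm) integrable_density) (use gm e(1,2)[OF c] in auto)
    show "(LINT x|J c. g x) = (LINT x|M. e c x * g x)"
      unfolding e(3)[OF c] by (subst integral_density) (use gm e(1,2)[OF c] in auto)
  qed
  have "integrable M (\<lambda>x. e c x * h c x) \<and> (\<forall>B\<in>borel_subsets \<Omega>. \<nu> B \<bullet> c = (LINT x|M. indicator B x * (e c x * h c x)))"
    if c: "c \<in> Basis" for c
  proof -
    have J: "J c = N c" using c by (auto simp: J_def)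
    interpret finite_measure "N c" by (rule N(1))
    have hi: "integrable (N c) (h c)" by (rule integrable_const_bound[where B=1]) (use N in auto)
    have "integrable M (\<lambda>x. e c x * h c x)" using dens(1)[of c "h c"] hi c J by simp
    moreover have "\<nu> B \<bullet> c = (LINT x|M. indicator B x * (e c x * h c x))" if B: "B \<in> borel_subsets \<Omega>" for B
    proof -
      have Bm: "B \<in> sets K" using B K by simp
      have "integrable (N c) (\<lambda>x. indicator B x * h c x)"
        using integrable_mult_indicator[OF _ hi, of B] Bm N(2) by simp
      then have "(LINT x|N c. indicator B x * h c x) = (LINT x|M. e c x * (indicator B x * h c x))"
        using dens(2)[of c "\<lambda>x. indicator B x * h c x"] c J by simp
      then show ?thesis using N(5)[OF Bm] by (simp add: mult_ac)
    qed
    ultimately show ?thesis by blast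
  qed
  moreover have "integrable M (\<lambda>x. e 0 x * H x) \<and>
      (\<forall>B\<in>borel_subsets \<Omega>. (LINT x|lborel. indicator B x * H x) = (LINT x|M. indicator B x * (e 0 x * H x)))"
    if H: "integrable lborel H" for H :: "'a \<Rightarrow> real"
  proof -
    have KI: "integrable K g \<longleftrightarrow> integrable lborel (\<lambda>x. indicator \<Omega> x *\<^sub>R g x)"
      "(LINT x|K. g x) = (LINT x|lborel. indicator \<Omega> x *\<^sub>R g x)" for g :: "'a \<Rightarrow> real"
      unfolding K_def using \<Omega>b by (simp_all add: integrable_restrict_space integral_restrict_space)
    have HK: "integrable K H" unfolding KI using integrable_mult_indicator[OF _ H, of \<Omega>] \<Omega>b by simp
    have J: "J 0 = K" by (simp add: J_def)
    have "integrable M (\<lambda>x. e 0 x * H x)" using dens(1)[of 0 H] HK J by simp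
    moreover have "(LINT x|lborel. indicator B x * H x) = (LINT x|M. indicator B x * (e 0 x * H x))"
      if B: "B \<in> borel_subsets \<Omega>" for B
    proof -
      have "(LINT x|lborel. indicator B x * H x) = (LINT x|K. indicator B x * H x)"
        unfolding KI(2) using B by (intro Bochner_Integration.integral_cong refl) (auto simp: borel_subsets_def indicator_def)
      also have "\<dots> = (LINT x|M. e 0 x * (indicator B x * H x))"
        using dens(2)[of 0 "\<lambda>x. indicator B x * H x"] integrable_mult_indicator[OF _ HK, of B] B K J by simp
      finally show ?thesis by (simp add: mult_ac)
    qed
    ultimately show ?thesis by blast
  qed
  ultimately show ?thesis using M K
    by (intro exI[of _ M] exI[of _ "\<lambda>c x. e c x * h c x"] exI[of _ "e 0"]) auto
qed

section \<open>Weak limits of bounded sequences\<close>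

text \<open>A substitute for the convex hull: bounds and almost equal integrals are inherited by midpoints,
and midpoints are all that the parallelogram identity needs.\<close>

inductive_set midpoint_hull :: "('a \<Rightarrow> 'b::real_vector) set \<Rightarrow> ('a \<Rightarrow> 'b) set" for S where
  base: "g \<in> S \<Longrightarrow> g \<in> midpoint_hull S"
| midpoint: "g \<in> midpoint_hull S \<Longrightarrow> h \<in> midpoint_hull S \<Longrightarrow>
    (\<lambda>x. (1/2) *\<^sub>R (g x + h x)) \<in> midpoint_hull S"

lemma midpoint_hull_mono:
  assumes "g \<in> midpoint_hull S" "S \<subseteq> T"
  shows "g \<in> midpoint_hull T"
  using assms by induction (auto intro: midpoint_hull.intros)

lemma integrable_bounded_inner:
  fixes f g :: "'a \<Rightarrow> 'b::euclidean_space"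
  assumes f: "integrable M f" and g: "g \<in> borel_measurable M" "\<And>x. norm (g x) \<le> C"
  shows "integrable M (\<lambda>x. f x \<bullet> g x)"
proof (rule Bochner_Integration.integrable_bound)
  show "integrable M (\<lambda>x. C * norm (f x))" using f by auto
  show "(\<lambda>x. f x \<bullet> g x) \<in> borel_measurable M"
    using f g by (intro borel_measurable_inner) auto
  have "0 \<le> C" using g(2)[of undefined] norm_ge_zero order_trans by blast
  have "norm (f x \<bullet> g x) \<le> C * norm (f x)" for x
    using Cauchy_Schwarz_ineq2[of "f x" "g x"] mult_left_mono[OF g(2)[of x] norm_ge_zero[of "f x"]]
    by (simp add: mult.commute)
  then show "AE x in M. norm (f x \<bullet> g x) \<le> norm (C * norm (f x))"
    using \<open>0 \<le> C\<close> by auto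
qed

text \<open>Mazur's argument in \<open>L\<^sup>2(M)\<close>. For every \<open>n\<close> choose a nearly minimal
element \<open>h n\<close>, in mean square, of the midpoint hull of \<open>{g m | m \<ge> n}\<close>. By the parallelogram identity these
elements form a Cauchy sequence, so a subsequence converges almost everywhere, to \<open>w\<close>. If the pairings of \<open>F\<close>
with \<open>g n\<close> converge to \<open>L\<close>, so do those with the elements of the hulls of the tails, and dominated
convergence identifies \<open>L\<close> with the pairing of \<open>F\<close> with \<open>w\<close>. A single \<open>w\<close> serves all \<open>F\<close>.\<close>

lemma bounded_sequence_weak_limit:
  fixes g :: "nat \<Rightarrow> 'a \<Rightarrow> 'b::euclidean_space"
  assumes "finite_measure M" and meas: "\<And>n. g n \<in> borel_measurable M"
    and bdd: "\<And>n x. norm (g n x) \<le> C"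
  shows "\<exists>w\<in>borel_measurable M. (\<forall>x. norm (w x) \<le> C) \<and>
    (\<forall>F L. integrable M F \<longrightarrow> (\<lambda>n. LINT x|M. F x \<bullet> g n x) \<longlonglongrightarrow> L \<longrightarrow> (LINT x|M. F x \<bullet> w x) = L)"
proof -
  interpret finite_measure M by fact
  have C: "0 \<le> C" using bdd norm_ge_zero order_trans by blast
  define K where "K n = midpoint_hull (g ` {n..})" for n
  have K_mono: "h \<in> K n" if "h \<in> K m" "n \<le> m" for h m n
    using that(1) unfolding K_def by (rule midpoint_hull_mono) (use that(2) in auto)
  have K_mid: "(\<lambda>x. (1/2) *\<^sub>R (h x + k x)) \<in> K n" if "h \<in> K n" "k \<in> K n" for h k n
    using that by (auto simp: K_def intro: midpoint_hull.intros)
  have K_meas: "h \<in> borel_measurable M" if "h \<in> K n" for h n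
    using that unfolding K_def by induction (use meas in auto)
  have K_bdd: "norm (h x) \<le> C" if "h \<in> K n" for h n x
    using that unfolding K_def
  proof induction
    case (midpoint h k)
    then show ?case using norm_triangle_ineq[of "h x" "k x"] by auto
  qed (use bdd in auto)
  have gK: "g n \<in> K n" for n by (auto simp: K_def intro: midpoint_hull.intros)
  have sq_int: "integrable M (\<lambda>x. (norm (h x - k x))\<^sup>2)" "integrable M (\<lambda>x. (norm (h x))\<^sup>2)"
    if "h \<in> K n" "k \<in> K m" for h k n m
  proof -
    have [measurable]: "h \<in> borel_measurable M" "k \<in> borel_measurable M" using that K_meas by auto
    have "norm (h x - k x) \<le> 2 * C" for x
      using norm_triangle_ineq4[of "h x" "k x"] K_bdd[OF that(1), of x] K_bdd[OF that(2), of x] by linarith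
    then have "(norm (h x - k x))\<^sup>2 \<le> (2 * C)\<^sup>2" for x by (intro power_mono) auto
    then show "integrable M (\<lambda>x. (norm (h x - k x))\<^sup>2)"
      by (intro integrable_const_bound[where B="(2*C)\<^sup>2"]) auto
    have "(norm (h x))\<^sup>2 \<le> C\<^sup>2" for x using K_bdd[OF that(1), of x] by (intro power_mono) auto
    then show "integrable M (\<lambda>x. (norm (h x))\<^sup>2)"
      by (intro integrable_const_bound[where B="C\<^sup>2"]) auto
  qed
  define N where "N h = (LINT x|M. (norm (h x))\<^sup>2)" for h :: "'a \<Rightarrow> 'b"
  have N_nonneg: "0 \<le> N h" for h by (auto simp: N_def)
  have N_bdd: "N h \<le> C\<^sup>2 * measure M (space M)" if "h \<in> K n" for h n
  proof -
    have "N h \<le> (LINT x|M. C\<^sup>2)" unfolding N_def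
      by (intro integral_mono sq_int[OF that that]) (auto intro!: power_mono K_bdd[OF that])
    then show ?thesis by (simp add: mult.commute)
  qed
  define d where "d n = Inf (N ` K n)" for n
  have bb: "bdd_below (N ` K n)" for n using N_nonneg by (intro bdd_belowI[where m=0]) auto
  have ne: "N ` K n \<noteq> {}" for n using gK by auto
  have d_le: "d n \<le> N h" if "h \<in> K n" for h n unfolding d_def using that bb by (auto intro: cInf_lower)
  have d_inc: "incseq d"
    unfolding d_def incseq_def using bb ne K_mono by (auto intro!: cInf_superset_mono)
  have "d n \<le> C\<^sup>2 * measure M (space M)" for n using d_le[OF gK] N_bdd[OF gK] order_trans by blast
  then obtain l where l: "d \<longlonglongrightarrow> l" "\<And>n. d n \<le> l"
    using incseq_convergent[OF d_inc] by metis
  have "\<forall>n. \<exists>h\<in>K n. N h < d n + 1 / real (Suc n)"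
  proof
    fix n
    have "Inf (N ` K n) < d n + 1 / real (Suc n)" by (simp add: d_def)
    then show "\<exists>h\<in>K n. N h < d n + 1 / real (Suc n)"
      using cInf_less_iff[OF ne bb] by auto
  qed
  then obtain h where h: "\<And>n. h n \<in> K n" "\<And>n. N (h n) < d n + 1 / real (Suc n)" by metis
  \<comment> \<open>Parallelogram identity; the midpoint of \<open>h n\<close> and \<open>h m\<close> lies in \<open>K n\<close>, so its mean square is at least \<open>d n\<close>.\<close>
  have close: "(LINT x|M. (norm (h n x - h m x))\<^sup>2) \<le> 2 * (l - d n) + 4 / real (Suc n)" if "n \<le> m" for n m
  proof -
    have hm: "h m \<in> K n" using K_mono[OF h(1) that] .
    have "(norm (h n x - h m x))\<^sup>2 = 2 * (norm (h n x))\<^sup>2 + 2 * (norm (h m x))\<^sup>2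
        - 4 * (norm ((1/2) *\<^sub>R (h n x + h m x)))\<^sup>2" for x
      by (simp add: power2_norm_eq_inner inner_add inner_diff algebra_simps inner_commute)
    then have "(LINT x|M. (norm (h n x - h m x))\<^sup>2) =
        (LINT x|M. 2 * (norm (h n x))\<^sup>2 + 2 * (norm (h m x))\<^sup>2 - 4 * (norm ((1/2) *\<^sub>R (h n x + h m x)))\<^sup>2)"
      by simp
    also have "\<dots> = 2 * N (h n) + 2 * N (h m) - 4 * N (\<lambda>x. (1/2) *\<^sub>R (h n x + h m x))"
      unfolding N_def using sq_int(2)[OF h(1) h(1)] sq_int(2)[OF K_mid[OF h(1) hm] h(1)]
      by (subst Bochner_Integration.integral_diff) auto
    also have "\<dots> \<le> 2 * (d n + 1 / real (Suc n)) + 2 * (d m + 1 / real (Suc m)) - 4 * d n"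
      by (intro diff_mono add_mono mult_left_mono less_imp_le[OF h(2)] d_le[OF K_mid[OF h(1) hm]]) auto
    also have "\<dots> \<le> 2 * (l - d n) + 4 / real (Suc n)"
    proof -
      have "1 / real (Suc m) \<le> 1 / real (Suc n)" using that by (intro divide_left_mono) auto
      then show ?thesis using l(2)[of m] by (simp add: algebra_simps)
    qed
    finally show ?thesis .
  qed
  \<comment> \<open>Smallness in mean square becomes smallness in mean through \<open>a \<le> t + a\<^sup>2 / t\<close>.\<close>
  have L1: "\<exists>n0. \<forall>n\<ge>n0. \<forall>m\<ge>n0. (LINT x|M. norm (h n x - h m x)) \<le> \<eta>" if \<eta>: "0 < \<eta>" for \<eta>
  proof -
    define t where "t = \<eta> / (2 * (measure M (space M) + 1))"
    have pos: "0 < measure M (space M) + 1" by (simp add: add_nonneg_pos)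
    have t: "0 < t" using \<eta> pos by (simp add: t_def)
    have t2: "t * measure M (space M) \<le> \<eta> / 2" using \<eta> pos by (simp add: t_def field_simps)
    have "(\<lambda>n. 2 * (l - d n) + 4 * (1 / real (Suc n))) \<longlonglongrightarrow> 2 * (l - l) + 4 * 0"
      by (intro tendsto_intros l LIMSEQ_Suc[OF lim_1_over_n])
    then have "(\<lambda>n. 2 * (l - d n) + 4 / real (Suc n)) \<longlonglongrightarrow> 0" by simp
    then have "eventually (\<lambda>n. 2 * (l - d n) + 4 / real (Suc n) < t * \<eta> / 2) sequentially"
      using t \<eta> by (intro order_tendstoD(2)) auto
    then obtain n0 where n0: "\<And>n. n \<ge> n0 \<Longrightarrow> 2 * (l - d n) + 4 / real (Suc n) < t * \<eta> / 2"
      by (auto simp: eventually_sequentially)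
    have *: "(LINT x|M. norm (h n x - h m x)) \<le> \<eta>" if nm: "n0 \<le> n" "n \<le> m" for n m
    proof -
      have "(LINT x|M. norm (h n x - h m x)) \<le> (LINT x|M. t + (norm (h n x - h m x))\<^sup>2 / t)"
      proof (rule integral_mono')
        show "integrable M (\<lambda>x. t + (norm (h n x - h m x))\<^sup>2 / t)" using sq_int(1)[OF h(1) h(1)] by auto
        show "norm (h n x - h m x) \<le> t + (norm (h n x - h m x))\<^sup>2 / t" for x
        proof -
          define a where "a = norm (h n x - h m x)"
          have "0 \<le> (a - t)\<^sup>2 + a * t" using t by (auto simp: a_def)
          then have "a * t \<le> t * t + a\<^sup>2" using t by (simp add: power2_eq_square algebra_simps)
          moreover have "0 \<le> a" by (simp add: a_def)
          ultimately have "a \<le> t + a\<^sup>2 / t" using t by (simp add: field_simps)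
          then show ?thesis by (simp add: a_def)
        qed
      qed (use t in auto)
      also have "\<dots> = t * measure M (space M) + (LINT x|M. (norm (h n x - h m x))\<^sup>2) / t"
        using sq_int(1)[OF h(1) h(1)] by simp
      also have "\<dots> \<le> \<eta> / 2 + (t * \<eta> / 2) / t"
      proof -
        have "n0 \<le> n" using nm by simp
        then have "(LINT x|M. (norm (h n x - h m x))\<^sup>2) \<le> t * \<eta> / 2"
          using close[OF nm(2)] n0[of n] by linarith
        then show ?thesis using t2 t by (intro add_mono divide_right_mono) auto
      qed
      also have "\<dots> = \<eta>" using t by simp
      finally show ?thesis .
    qed
    show ?thesis
    proof (intro exI allI impI)
      fix n m assume "n0 \<le> n" "n0 \<le> m"
      then show "(LINT x|M. norm (h n x - h m x)) \<le> \<eta>"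
        using *[of n m] *[of m n] by (cases "n \<le> m") (auto simp: norm_minus_commute)
    qed
  qed
  have h_meas[measurable]: "h n \<in> borel_measurable M" for n using K_meas h by auto
  have h_int: "integrable M (h n)" for n
    using K_bdd[OF h(1)] by (intro integrable_const_bound[where B=C]) auto
  obtain r where r: "strict_mono r" "AE x in M. Cauchy (\<lambda>i. h (r i) x)"
  proof (rule cauchy_L1_AE_cauchy_subseq[of M h])
    fix e :: real assume e: "0 < e"
    show "\<exists>N. \<forall>i\<ge>N. \<forall>j\<ge>N. (LINT x|M. norm (h i x - h j x)) < e"
      using L1[of "e/2"] e by (smt (verit) field_sum_of_halves)
  qed (use h_int in auto)
  define w where "w x = (if Cauchy (\<lambda>i. h (r i) x) then lim (\<lambda>i. h (r i) x) else 0)" for x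
  have w_meas: "w \<in> borel_measurable M" unfolding w_def by measurable
  have w_lim: "AE x in M. (\<lambda>i. h (r i) x) \<longlonglongrightarrow> w x"
    using r(2) by eventually_elim (auto simp: w_def Cauchy_convergent_iff convergent_LIMSEQ_iff)
  have w_bdd: "norm (w x) \<le> C" for x
  proof (cases "Cauchy (\<lambda>i. h (r i) x)")
    case True
    then have "(\<lambda>i. h (r i) x) \<longlonglongrightarrow> w x" by (auto simp: w_def Cauchy_convergent_iff convergent_LIMSEQ_iff)
    then have "(\<lambda>i. norm (h (r i) x)) \<longlonglongrightarrow> norm (w x)" by (rule tendsto_norm)
    then show ?thesis by (rule LIMSEQ_le_const2) (use K_bdd[OF h(1)] in auto)
  qed (use C in \<open>auto simp: w_def\<close>)
  have "(LINT x|M. F x \<bullet> w x) = L"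
    if F: "integrable M F" and L: "(\<lambda>n. LINT x|M. F x \<bullet> g n x) \<longlonglongrightarrow> L" for F L
  proof -
    have [measurable]: "F \<in> borel_measurable M" using F by auto
    have "(\<lambda>i. LINT x|M. F x \<bullet> h (r i) x) \<longlonglongrightarrow> (LINT x|M. F x \<bullet> w x)"
    proof (rule integral_dominated_convergence)
      show "integrable M (\<lambda>x. C * norm (F x))" using F by auto
      show "AE x in M. (\<lambda>i. F x \<bullet> h (r i) x) \<longlonglongrightarrow> F x \<bullet> w x"
        using w_lim by eventually_elim (intro tendsto_intros)
      show "AE x in M. norm (F x \<bullet> h (r i) x) \<le> C * norm (F x)" for i
      proof (rule AE_I2)
        fix x
        show "norm (F x \<bullet> h (r i) x) \<le> C * norm (F x)"
          using Cauchy_Schwarz_ineq2[of "F x" "h (r i) x"] mult_left_mono[OF K_bdd[OF h(1), of "r i" x] norm_ge_zero[of "F x"]]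
          by (simp add: mult.commute)
      qed
    qed (use w_meas in auto)
    moreover have "(\<lambda>n. LINT x|M. F x \<bullet> h n x) \<longlonglongrightarrow> L"
    proof (rule LIMSEQ_I)
      fix e :: real assume e: "0 < e"
      obtain n0 where n0: "\<And>n. n \<ge> n0 \<Longrightarrow> \<bar>(LINT x|M. F x \<bullet> g n x) - L\<bar> < e"
        using LIMSEQ_D[OF L e] by auto
      have "\<bar>(LINT x|M. F x \<bullet> k x) - L\<bar> < e" if "k \<in> K n0" for k
        using that unfolding K_def
      proof induction
        case (base k) then show ?case using n0 by auto
      next
        case (midpoint k k')
        have i: "integrable M (\<lambda>x. F x \<bullet> k x)" "integrable M (\<lambda>x. F x \<bullet> k' x)"
          using midpoint K_meas[of _ n0] K_bdd[of _ n0]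
          by (auto intro!: integrable_bounded_inner[OF F, where C=C] simp: K_def)
        have "(LINT x|M. F x \<bullet> ((1/2) *\<^sub>R (k x + k' x))) = (LINT x|M. (1/2) * (F x \<bullet> k x) + (1/2) * (F x \<bullet> k' x))"
          by (intro Bochner_Integration.integral_cong refl) (simp only: inner_add inner_scaleR_right distrib_left)
        also have "\<dots> = ((LINT x|M. F x \<bullet> k x) + (LINT x|M. F x \<bullet> k' x)) / 2" using i by simp
        finally have eq: "(LINT x|M. F x \<bullet> ((1/2) *\<^sub>R (k x + k' x))) = ((LINT x|M. F x \<bullet> k x) + (LINT x|M. F x \<bullet> k' x)) / 2" .
        have "\<bar>(a + b) / 2 - L\<bar> < e" if "\<bar>a - L\<bar> < e" "\<bar>b - L\<bar> < e" for a b
          using that by (auto simp: abs_less_iff field_simps)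
        then show ?case unfolding eq using midpoint.IH by blast
      qed
      then show "\<exists>n0. \<forall>n\<ge>n0. norm ((LINT x|M. F x \<bullet> h n x) - L) < e"
        using K_mono[OF h(1)] by auto
    qed
    then have "(\<lambda>i. LINT x|M. F x \<bullet> h (r i) x) \<longlonglongrightarrow> L"
      using LIMSEQ_subseq_LIMSEQ[OF _ r(1)] by (auto simp: o_def)
    ultimately show ?thesis using LIMSEQ_unique by blast
  qed
  then show ?thesis using w_meas w_bdd by blast
qed

section \<open>Smooth functions and mollification\<close>

definition smooth :: "('a::euclidean_space \<Rightarrow> real) \<Rightarrow> bool" where
  "smooth f \<longleftrightarrow> (\<forall>n. C_k n f)"

lemma partial_eqI: "(f has_derivative f') (at x) \<Longrightarrow> partial b f x = f' b"
  unfolding partial_def using frechet_derivative_at by metis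

lemma smooth_continuous: "smooth f \<Longrightarrow> continuous_on UNIV f"
  unfolding smooth_def by (metis C_k.simps(1))

lemma smooth_differentiable: "smooth f \<Longrightarrow> f differentiable (at x)"
  unfolding smooth_def by (metis C_k.simps(2))

lemma smooth_partial: "smooth f \<Longrightarrow> b \<in> Basis \<Longrightarrow> smooth (partial b f)"
  unfolding smooth_def by (metis C_k.simps(2))

lemma smooth_has_derivative:
  assumes "smooth f"
  shows "(f has_derivative (\<lambda>v. \<Sum>b\<in>Basis. (v \<bullet> b) * partial b f x)) (at x)"
proof -
  have D: "(f has_derivative frechet_derivative f (at x)) (at x)"
    using smooth_differentiable[OF assms] frechet_derivative_works by blast
  then have lin: "linear (frechet_derivative f (at x))"
    by (rule has_derivative_linear)
  have "frechet_derivative f (at x) v = (\<Sum>b\<in>Basis. (v \<bullet> b) * partial b f x)" for v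
  proof -
    have "frechet_derivative f (at x) v = frechet_derivative f (at x) (\<Sum>b\<in>Basis. (v \<bullet> b) *\<^sub>R b)"
      by (simp add: euclidean_representation)
    also have "\<dots> = (\<Sum>b\<in>Basis. (v \<bullet> b) * partial b f x)"
      by (simp add: linear_sum[OF lin] linear_cmul[OF lin] partial_def)
    finally show ?thesis .
  qed
  then have "frechet_derivative f (at x) = (\<lambda>v. \<Sum>b\<in>Basis. (v \<bullet> b) * partial b f x)" by blast
  with D show ?thesis by simp
qed

lemma sum_inner_Basis_mult:
  fixes f :: "'a::euclidean_space \<Rightarrow> real"
  assumes "b \<in> Basis"
  shows "(\<Sum>c\<in>Basis. (b \<bullet> c) * f c) = f b"
proof -
  have "(\<Sum>c\<in>Basis. (b \<bullet> c) * f c) = (\<Sum>c\<in>Basis. if c = b then f c else 0)"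
    using assms by (intro sum.cong) (auto simp: inner_Basis)
  then show ?thesis using assms by simp
qed

lemma C_k_add: "C_k n f \<Longrightarrow> C_k n g \<Longrightarrow> C_k n (\<lambda>x. f x + g x)"
proof (induction n arbitrary: f g)
  case (Suc n)
  have "partial b (\<lambda>x. f x + g x) = (\<lambda>x. partial b f x + partial b g x)" for b
  proof
    fix x
    have "((\<lambda>x. f x + g x) has_derivative (\<lambda>v. frechet_derivative f (at x) v + frechet_derivative g (at x) v)) (at x)"
      using Suc.prems by (intro has_derivative_add) (auto simp: frechet_derivative_works)
    then show "partial b (\<lambda>x. f x + g x) x = partial b f x + partial b g x"
      by (simp add: partial_eqI) (simp add: partial_def)
  qed
  with Suc show ?case by auto
qed (auto intro: continuous_intros)

lemma smooth_add: "smooth f \<Longrightarrow> smooth g \<Longrightarrow> smooth (\<lambda>x. f x + g x)"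
  unfolding smooth_def using C_k_add by blast

lemma partial_mult:
  assumes "smooth f" "smooth g"
  shows "partial b (\<lambda>x. f x * g x) = (\<lambda>x. f x * partial b g x + partial b f x * g x)"
proof
  fix x
  have "((\<lambda>x. f x * g x) has_derivative
      (\<lambda>v. f x * frechet_derivative g (at x) v + frechet_derivative f (at x) v * g x)) (at x)"
    using smooth_differentiable[OF assms(1)] smooth_differentiable[OF assms(2)]
    by (intro has_derivative_mult) (auto simp: frechet_derivative_works)
  then show "partial b (\<lambda>x. f x * g x) x = f x * partial b g x + partial b f x * g x"
    by (simp add: partial_eqI) (simp add: partial_def)
qed

lemma smooth_mult:
  assumes "smooth f" "smooth g"
  shows "smooth (\<lambda>x. f x * g x)"
proof -
  have "C_k n (\<lambda>x. f x * g x)" for n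
    using assms
  proof (induction n arbitrary: f g)
    case 0
    then show ?case by (simp add: continuous_on_mult smooth_continuous)
  next
    case (Suc n)
    have "C_k n (partial b (\<lambda>x. f x * g x))" if "b \<in> Basis" for b
      unfolding partial_mult[OF Suc.prems] using Suc that
      by (intro C_k_add) (auto intro: smooth_partial)
    then show ?case
      using smooth_differentiable[OF Suc.prems(1)] smooth_differentiable[OF Suc.prems(2)] by auto
  qed
  then show ?thesis by (simp add: smooth_def)
qed

lemma smooth_const: "smooth (\<lambda>x. c)"
proof -
  have "C_k n (\<lambda>x::'a. c)" for n
  proof (induction n arbitrary: c)
    case (Suc n)
    have "partial b (\<lambda>x::'a. c) = (\<lambda>x. 0)" for b
      by (intro ext partial_eqI) simp
    with Suc show ?case by auto
  qed auto
  then show ?thesis by (simp add: smooth_def)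
qed

lemma smooth_inner: "smooth (\<lambda>x. x \<bullet> c)"
proof -
  have "C_k n (\<lambda>x::'a. x \<bullet> c)" for n
  proof (cases n)
    case (Suc m)
    have "partial b (\<lambda>x::'a. x \<bullet> c) = (\<lambda>x. b \<bullet> c)" for b
      by (intro ext partial_eqI[of _ "\<lambda>v. v \<bullet> c"]) (auto intro!: derivative_eq_intros)
    then show ?thesis using smooth_const Suc by (auto simp: smooth_def)
  qed (auto intro: continuous_intros)
  then show ?thesis by (simp add: smooth_def)
qed

lemma smooth_sum: "(\<And>i. i \<in> I \<Longrightarrow> smooth (f i)) \<Longrightarrow> smooth (\<lambda>x. \<Sum>i\<in>I. f i x)"
  by (induction I rule: infinite_finite_induct) (auto intro: smooth_const smooth_add)

lemma smooth_reflect: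
  assumes "smooth f"
  shows "smooth (\<lambda>y. f (x - y))" and "b \<in> Basis \<Longrightarrow> partial b (\<lambda>y. f (x - y)) = (\<lambda>y. - partial b f (x - y))"
proof -
  have d: "((\<lambda>y. g (x - y)) has_derivative (\<lambda>v. \<Sum>b\<in>Basis. ((- v) \<bullet> b) * partial b g (x - y))) (at y)"
    if "smooth g" for g y
  proof -
    have "((\<lambda>y. x - y) has_derivative (\<lambda>v. - v)) (at y)" by (auto intro!: derivative_eq_intros)
    from has_derivative_compose[OF this smooth_has_derivative[OF that]] show ?thesis .
  qed
  have p: "partial b (\<lambda>y. g (x - y)) = (\<lambda>y. (-1) * partial b g (x - y))" if "smooth g" "b \<in> Basis" for g b
    using that by (intro ext, subst partial_eqI[OF d]) (auto simp: sum_negf sum_inner_Basis_mult)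
  show "b \<in> Basis \<Longrightarrow> partial b (\<lambda>y. f (x - y)) = (\<lambda>y. - partial b f (x - y))"
    using p[OF assms] by simp
  have "C_k n (\<lambda>y. c * f (x - y))" for n c
    using assms
  proof (induction n arbitrary: f c)
    case 0
    have "continuous_on UNIV (\<lambda>y. f (x - y))"
      by (rule continuous_on_compose2[OF smooth_continuous[OF 0]])
        (auto intro: continuous_on_diff continuous_on_const continuous_on_id)
    then show ?case by (simp add: continuous_on_mult continuous_on_const)
  next
    case (Suc n)
    have "partial b (\<lambda>y. c * f (x - y)) = (\<lambda>y. (- c) * partial b f (x - y))" if "b \<in> Basis" for b
    proof
      fix y
      have "((\<lambda>y. c * f (x - y)) has_derivative (\<lambda>v. c * (\<Sum>b\<in>Basis. ((- v) \<bullet> b) * partial b f (x - y)))) (at y)"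
        by (intro has_derivative_mult_right d Suc.prems)
      from partial_eqI[OF this] show "partial b (\<lambda>y. c * f (x - y)) y = (- c) * partial b f (x - y)"
        using that by (simp add: sum_negf sum_inner_Basis_mult)
    qed
    moreover have "(\<lambda>y. c * f (x - y)) differentiable (at y)" for y
      using has_derivative_mult_right[OF d[OF Suc.prems], of c y] differentiable_def by blast
    moreover have "C_k n (\<lambda>y. (- c) * partial b f (x - y))" if "b \<in> Basis" for b
      by (rule Suc.IH[OF smooth_partial[OF Suc.prems that]])
    ultimately show ?case by (simp del: mult_minus_left)
  qed
  from this[of _ 1] show "smooth (\<lambda>y. f (x - y))" by (simp add: smooth_def)
qed

text \<open>The derivatives of \<open>exp (- 1 / t)\<close>, extended by zero to \<open>t \<le> 0\<close>, are linear combinations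
of the members of this family.\<close>

definition flat_exp :: "nat \<Rightarrow> real \<Rightarrow> real" where
  "flat_exp m t = (if 0 < t then exp (- 1 / t) / t ^ m else 0)"

lemma flat_exp_at_right: "(flat_exp m \<longlongrightarrow> 0) (at_right 0)"
proof -
  have "((\<lambda>t. inverse t ^ m / exp (inverse t)) \<longlongrightarrow> 0) (at_right (0::real))"
    by (rule filterlim_compose[OF tendsto_power_div_exp_0 filterlim_inverse_at_top_right])
  moreover have "eventually (\<lambda>t. inverse t ^ m / exp (inverse t) = flat_exp m t) (at_right 0)"
    using eventually_at_right_less
    by eventually_elim (simp add: flat_exp_def exp_minus field_simps power_inverse)
  ultimately show ?thesis by (rule Lim_transform_eventually)
qed

lemma flat_exp_DERIV: "(flat_exp m has_real_derivative flat_exp (m + 2) t - real m * flat_exp (m + 1) t) (at t)"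
proof (cases t "0::real" rule: linorder_cases)
  case less
  have "((\<lambda>_. 0) has_real_derivative 0) (at t)" by simp
  then have "(flat_exp m has_real_derivative 0) (at t)"
    by (rule has_field_derivative_transform_within_open[where S="{..<0}"])
      (use less in \<open>auto simp: flat_exp_def\<close>)
  then show ?thesis using less by (simp add: flat_exp_def)
next
  case equal
  have "((\<lambda>y. (flat_exp m y - flat_exp m 0) / (y - 0)) \<longlongrightarrow> 0) (at 0)"
  proof (rule filterlim_split_at)
    have e: "eventually (\<lambda>y. 0 = (flat_exp m y - flat_exp m 0) / (y - 0)) (at_left (0::real))"
      using eventually_at_left_real[of "-1" 0] by (auto simp: flat_exp_def elim: eventually_mono)
    show "((\<lambda>y. (flat_exp m y - flat_exp m 0) / (y - 0)) \<longlongrightarrow> 0) (at_left 0)"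
      by (rule Lim_transform_eventually[OF tendsto_const e])
    have e: "eventually (\<lambda>y. flat_exp (m + 1) y = (flat_exp m y - flat_exp m 0) / (y - 0)) (at_right (0::real))"
      using eventually_at_right_less by eventually_elim (simp add: flat_exp_def)
    show "((\<lambda>y. (flat_exp m y - flat_exp m 0) / (y - 0)) \<longlongrightarrow> 0) (at_right 0)"
      by (rule Lim_transform_eventually[OF flat_exp_at_right e])
  qed
  then have "(flat_exp m has_real_derivative 0) (at 0)"
    by (simp add: has_field_derivative_iff)
  then show ?thesis using equal by (simp add: flat_exp_def)
next
  case greater
  have "((\<lambda>t. exp (- 1 / t) / t ^ m) has_real_derivative
      exp (- 1 / t) / t ^ (m + 2) - real m * (exp (- 1 / t) / t ^ (m + 1))) (at t)"
  proof (rule DERIV_cong)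
    show "((\<lambda>t. exp (- 1 / t) / t ^ m) has_real_derivative
        (exp (- 1 / t) / t\<^sup>2 * t ^ m - exp (- 1 / t) * (real m * t ^ (m - Suc 0))) / (t ^ m * t ^ m)) (at t)"
      using greater by (intro DERIV_divide DERIV_pow) (auto intro!: derivative_eq_intros simp: power2_eq_square)
    show "(exp (- 1 / t) / t\<^sup>2 * t ^ m - exp (- 1 / t) * (real m * t ^ (m - Suc 0))) / (t ^ m * t ^ m) =
        exp (- 1 / t) / t ^ (m + 2) - real m * (exp (- 1 / t) / t ^ (m + 1))"
      using greater by (cases m) (auto simp: field_simps power2_eq_square)
  qed
  then have "(flat_exp m has_real_derivative
      exp (- 1 / t) / t ^ (m + 2) - real m * (exp (- 1 / t) / t ^ (m + 1))) (at t)"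
    by (rule has_field_derivative_transform_within_open[where S="{0<..}"])
      (use greater in \<open>auto simp: flat_exp_def\<close>)
  then show ?thesis using greater by (simp add: flat_exp_def)
qed

text \<open>The chain rule produces products of members of the family with derivatives of \<open>f\<close>.
The induction on the order of differentiability therefore treats \<open>g x * flat_exp m (f x)\<close> for all smooth \<open>g\<close>
and all \<open>m\<close> at once.\<close>

lemma smooth_flat_exp_compose:
  fixes f :: "'a::euclidean_space \<Rightarrow> real"
  assumes f: "smooth f"
  shows "smooth (\<lambda>x. flat_exp m (f x))"
proof -
  have d: "((\<lambda>x. flat_exp m (f x)) has_derivative
      (\<lambda>v. (\<Sum>b\<in>Basis. (v \<bullet> b) * partial b f x) * (flat_exp (m + 2) (f x) - real m * flat_exp (m + 1) (f x)))) (at x)" for m x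
    using has_derivative_compose[OF smooth_has_derivative[OF f] flat_exp_DERIV[unfolded has_field_derivative_def]]
    by (rule has_derivative_eq_rhs) (auto simp: mult.commute)
  have "\<forall>g m. smooth g \<longrightarrow> C_k n (\<lambda>x. g x * flat_exp m (f x))" for n
  proof (induction n)
    case 0
    have "continuous_on UNIV (\<lambda>x. flat_exp m (f x))" for m
      using d has_derivative_continuous by (force simp: continuous_on_eq_continuous_at)
    then show ?case by (simp add: continuous_on_mult smooth_continuous)
  next
    case (Suc n)
    show ?case
    proof safe
      fix g :: "'a \<Rightarrow> real" and m assume g: "smooth g"
      have D: "((\<lambda>x. g x * flat_exp m (f x)) has_derivative
        (\<lambda>v. g x * ((\<Sum>b\<in>Basis. (v \<bullet> b) * partial b f x) * (flat_exp (m + 2) (f x) - real m * flat_exp (m + 1) (f x)))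
          + (\<Sum>b\<in>Basis. (v \<bullet> b) * partial b g x) * flat_exp m (f x))) (at x)" for x
        by (intro has_derivative_mult smooth_has_derivative g d)
      have "C_k n (partial b (\<lambda>x. g x * flat_exp m (f x)))" if b: "b \<in> Basis" for b
      proof -
        have "partial b (\<lambda>x. g x * flat_exp m (f x)) = (\<lambda>x. (g x * partial b f x) * flat_exp (m + 2) (f x)
            + ((- real m) * (g x * partial b f x) * flat_exp (m + 1) (f x) + partial b g x * flat_exp m (f x)))"
        proof
          fix x
          have "partial b (\<lambda>x. g x * flat_exp m (f x)) x = g x * (partial b f x * (flat_exp (m + 2) (f x) - real m * flat_exp (m + 1) (f x)))
          + partial b g x * flat_exp m (f x)"
            using b by (subst partial_eqI[OF D]) (simp add: sum_inner_Basis_mult)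
          then show "partial b (\<lambda>x. g x * flat_exp m (f x)) x = (g x * partial b f x) * flat_exp (m + 2) (f x)
            + ((- real m) * (g x * partial b f x) * flat_exp (m + 1) (f x) + partial b g x * flat_exp m (f x))"
            by (simp add: algebra_simps)
        qed
        moreover have "smooth (\<lambda>x. g x * partial b f x)" "smooth (\<lambda>x. (- real m) * (g x * partial b f x))"
          by (intro smooth_mult smooth_partial smooth_const g f b)+
        ultimately show ?thesis
          using Suc smooth_partial[OF g b] by (simp only: C_k_add)
      qed
      then show "C_k (Suc n) (\<lambda>x. g x * flat_exp m (f x))"
        using D by (auto simp: differentiable_def)
    qed
  qed
  then have "C_k n (\<lambda>x. 1 * flat_exp m (f x))" for n using smooth_const by blast
  then show ?thesis by (simp add: smooth_def)
qed

lemma uniformly_continuous_bounded_support: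
  fixes f :: "'a::euclidean_space \<Rightarrow> real"
  assumes f: "continuous_on UNIV f" and supp: "\<And>x. r < norm x \<Longrightarrow> f x = 0" and \<eta>: "0 < \<eta>"
  shows "\<exists>\<delta>>0. \<forall>x y. norm (x - y) < \<delta> \<longrightarrow> \<bar>f x - f y\<bar> < \<eta>"
proof -
  have "uniformly_continuous_on (cball 0 (r + 1)) f"
    by (intro compact_uniformly_continuous continuous_on_subset[OF f]) auto
  then obtain \<delta> where \<delta>: "0 < \<delta>" "\<And>x y. x \<in> cball 0 (r + 1) \<Longrightarrow> y \<in> cball 0 (r + 1) \<Longrightarrow> dist y x < \<delta> \<Longrightarrow> dist (f y) (f x) < \<eta>"
    unfolding uniformly_continuous_on_def using \<eta> by meson
  show ?thesis
  proof (intro exI conjI allI impI)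
    show "0 < min \<delta> 1" using \<delta> by simp
    fix x y :: 'a assume xy: "norm (x - y) < min \<delta> 1"
    have n: "norm x \<le> norm y + norm (x - y)" "norm y \<le> norm x + norm (x - y)"
      using norm_triangle_sub[of x y] norm_triangle_sub[of y x] by (auto simp: norm_minus_commute)
    show "\<bar>f x - f y\<bar> < \<eta>"
    proof (cases "norm x \<le> r + 1 \<and> norm y \<le> r + 1")
      case True
      then show ?thesis using \<delta>(2)[of y x] xy by (auto simp: dist_norm norm_minus_commute)
    next
      case False
      then have "r < norm x \<and> r < norm y" using n xy by auto
      then show ?thesis using supp \<eta> by simp
    qed
  qed
qed

lemma bounded_of_bounded_support:
  fixes f :: "'a::euclidean_space \<Rightarrow> real"
  assumes f: "continuous_on UNIV f" and supp: "\<And>x. r < norm x \<Longrightarrow> f x = 0"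
  shows "\<exists>C. \<forall>x. \<bar>f x\<bar> \<le> C"
proof -
  have "bounded (f ` cball 0 r)"
    by (intro compact_imp_bounded compact_continuous_image continuous_on_subset[OF f]) auto
  then obtain C where "\<forall>y\<in>f ` cball 0 r. norm y \<le> C" unfolding bounded_iff by blast
  then have C: "\<bar>f x\<bar> \<le> C" if "norm x \<le> r" for x using that by auto
  have "\<bar>f x\<bar> \<le> max C 0" for x using C[of x] supp[of x] by (cases "norm x \<le> r") auto
  then show ?thesis by blast
qed

lemma integrable_of_bounded_support:
  fixes f :: "'a::euclidean_space \<Rightarrow> real"
  assumes f: "continuous_on UNIV f" and supp: "\<And>x. r < norm x \<Longrightarrow> f x = 0"
  shows "integrable lborel f"
proof -
  have [measurable]: "f \<in> borel_measurable borel" using f by (rule borel_measurable_continuous_onI)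
  obtain C where C: "\<And>x. \<bar>f x\<bar> \<le> C" using bounded_of_bounded_support[OF f supp] by blast
  show ?thesis
  proof (rule integrableI_bounded_set[where A="cball 0 r" and B=C])
    show "emeasure lborel (cball (0::'a) r) < \<infinity>"
      by (intro emeasure_bounded_finite) auto
    show "AE x in lborel. x \<notin> cball 0 r \<longrightarrow> f x = 0" using supp by auto
  qed (use C in auto)
qed

lemma partial_bounded_support:
  assumes "\<And>x. r < norm x \<Longrightarrow> f x = 0" "r < norm x"
  shows "partial b f x = 0"
proof -
  have "((\<lambda>_. 0) has_derivative (\<lambda>_. 0)) (at x)" by simp
  moreover have "open (- cball (0::'a) r)" by auto
  ultimately have "(f has_derivative (\<lambda>_. 0)) (at x)"
    by (rule has_derivative_transform_within_open) (use assms in auto)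
  then show ?thesis by (rule partial_eqI)
qed

definition mollifier :: "real \<Rightarrow> ('a::euclidean_space \<Rightarrow> real) \<Rightarrow> bool" where
  "mollifier r \<rho> \<longleftrightarrow> smooth \<rho> \<and> (\<forall>x. 0 \<le> \<rho> x) \<and> (\<forall>x. r < norm x \<longrightarrow> \<rho> x = 0) \<and> (LINT x|lborel. \<rho> x) = 1"

text \<open>The smooth bump \<open>exp (- 1 / (r\<^sup>2 - |x|\<^sup>2))\<close>, divided by its integral.\<close>

lemma mollifier_exists:
  assumes r: "0 < r"
  shows "\<exists>\<rho>::'a::euclidean_space \<Rightarrow> real. mollifier r \<rho>"
proof -
  define \<beta> :: "'a \<Rightarrow> real" where "\<beta> x = flat_exp 0 (r\<^sup>2 + (-1) * (\<Sum>b\<in>Basis. (x \<bullet> b) * (x \<bullet> b)))" for x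
  have sm: "smooth \<beta>" unfolding \<beta>_def
    by (intro smooth_flat_exp_compose smooth_add smooth_const smooth_mult smooth_sum smooth_inner)
  have eq: "\<beta> x = flat_exp 0 (r\<^sup>2 - (norm x)\<^sup>2)" for x
    unfolding \<beta>_def by (simp add: power2_norm_eq_inner euclidean_inner[of x x])
  have nn: "0 \<le> \<beta> x" for x by (simp add: eq flat_exp_def)
  have pos: "0 < \<beta> x" if "norm x < r" for x
    using that r by (auto simp: eq flat_exp_def power_strict_mono)
  have supp: "\<beta> x = 0" if "r < norm x" for x
    using that r by (auto simp: eq flat_exp_def power_mono not_less)
  have int: "integrable lborel \<beta>"
    by (rule integrable_of_bounded_support[OF smooth_continuous[OF sm] supp])
  define c where "c = (LINT x|lborel. \<beta> x)"
  have "c \<noteq> 0"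
  proof
    assume "c = 0"
    then have "AE x in lborel. \<beta> x = 0"
      using integral_nonneg_eq_0_iff_AE[OF int] nn by (auto simp: c_def)
    then have "AE x in lborel. x \<notin> ball (0::'a) r"
      by (rule eventually_mono) (use pos in \<open>force simp: less_le\<close>)
    then have "AE x in lebesgue. x \<notin> ball (0::'a) r" by (rule AE_completion)
    then have "negligible (ball (0::'a) r)"
      by (simp add: negligible_iff_null_sets AE_iff_null_sets)
    then show False using open_not_negligible[of "ball (0::'a) r"] r by auto
  qed
  moreover have "0 \<le> c" unfolding c_def using nn by (auto intro: integral_nonneg_AE)
  ultimately have c: "0 < c" by simp
  have "smooth (\<lambda>x. (1 / c) * \<beta> x)" by (intro smooth_mult smooth_const sm)
  then show ?thesis
    using c nn supp int by (intro exI[of _ "\<lambda>x. (1/c) * \<beta> x"]) (auto simp: c_def mollifier_def)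
qed

definition conv :: "('a::euclidean_space \<Rightarrow> real) \<Rightarrow> ('a \<Rightarrow> real) \<Rightarrow> 'a \<Rightarrow> real" where
  "conv \<rho> Z x = (LINT y|lborel. \<rho> (x - y) * Z y)"

lemma conv_integrand_integrable:
  fixes \<rho> :: "'a::euclidean_space \<Rightarrow> real"
  assumes \<rho>: "continuous_on UNIV \<rho>" "\<And>x. r < norm x \<Longrightarrow> \<rho> x = 0" and Z: "integrable lborel Z"
  shows "integrable lborel (\<lambda>y. \<rho> (x - y) * Z y)"
proof -
  obtain C where C: "\<And>x. \<bar>\<rho> x\<bar> \<le> C" using bounded_of_bounded_support[OF \<rho>] by blast
  have [measurable]: "\<rho> \<in> borel_measurable borel" using \<rho>(1) by (rule borel_measurable_continuous_onI)
  have [measurable]: "Z \<in> borel_measurable borel" using borel_measurable_integrable[OF Z] by simp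
  show ?thesis
  proof (rule Bochner_Integration.integrable_bound)
    show "integrable lborel (\<lambda>y. C * Z y)" using Z by auto
    have "0 \<le> C" using C[of 0] by linarith
    then show "AE y in lborel. norm (\<rho> (x - y) * Z y) \<le> norm (C * Z y)"
      using C by (intro AE_I2) (auto simp: abs_mult intro!: mult_right_mono)
  qed measurable
qed

text \<open>The partial derivatives of \<open>\<rho>\<close> are uniformly continuous, so the error in the
mean value theorem is uniform in \<open>w\<close>. It is this uniformity that allows differentiation under the integral sign
against an integrable function.\<close>

lemma uniformly_differentiable:
  assumes \<rho>: "smooth \<rho>" "\<And>x. r < norm x \<Longrightarrow> \<rho> x = 0" and \<eta>: "0 < \<eta>"
  shows "\<exists>\<delta>>0. \<forall>w v. norm v < \<delta> \<longrightarrow>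
    \<bar>\<rho> (w + v) - \<rho> w - (\<Sum>b\<in>Basis. (v \<bullet> b) * partial b \<rho> w)\<bar> \<le> \<eta> * norm v"
proof -
  define e where "e = \<eta> / real DIM('a)"
  have e: "0 < e" using \<eta> by (simp add: e_def)
  have "\<forall>b\<in>Basis. \<exists>\<delta>>0. \<forall>x y. norm (x - y) < \<delta> \<longrightarrow> \<bar>partial b \<rho> x - partial b \<rho> y\<bar> < e"
    using e by (intro ballI uniformly_continuous_bounded_support[OF smooth_continuous[OF smooth_partial[OF \<rho>(1)]] partial_bounded_support[OF \<rho>(2)]])
  then obtain \<delta> where \<delta>: "\<And>b. b \<in> Basis \<Longrightarrow> 0 < \<delta> b"
    "\<And>b x y. b \<in> Basis \<Longrightarrow> norm (x - y) < \<delta> b \<Longrightarrow> \<bar>partial b \<rho> x - partial b \<rho> y\<bar> < e"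
    by metis
  define d where "d = Min (\<delta> ` Basis)"
  have d: "0 < d" "\<And>b. b \<in> Basis \<Longrightarrow> d \<le> \<delta> b" using \<delta>(1) by (auto simp: d_def)
  have "\<bar>\<rho> (w + v) - \<rho> w - (\<Sum>b\<in>Basis. (v \<bullet> b) * partial b \<rho> w)\<bar> \<le> \<eta> * norm v" if v: "norm v < d" for w v
  proof -
    define g where "g y = \<rho> y - (\<Sum>b\<in>Basis. (y \<bullet> b) * partial b \<rho> w)" for y
    define g' where "g' y = (\<lambda>u. (\<Sum>b\<in>Basis. (u \<bullet> b) * partial b \<rho> y) - (\<Sum>b\<in>Basis. (u \<bullet> b) * partial b \<rho> w))" for y
    have D: "(g has_derivative g' y) (at y within ball w d)" for y
      unfolding g_def g'_def
      by (intro has_derivative_diff has_derivative_at_withinI[OF smooth_has_derivative[OF \<rho>(1)]] has_derivative_sum has_derivative_mult_left has_derivative_inner_left has_derivative_ident)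
    have B: "onorm (g' y) \<le> \<eta>" if "y \<in> ball w d" for y
    proof (rule onorm_le)
      fix u
      have "\<bar>g' y u\<bar> = \<bar>\<Sum>b\<in>Basis. (u \<bullet> b) * (partial b \<rho> y - partial b \<rho> w)\<bar>"
        by (simp add: g'_def sum_subtractf[symmetric] algebra_simps)
      also have "\<dots> \<le> (\<Sum>b\<in>Basis. \<bar>(u \<bullet> b) * (partial b \<rho> y - partial b \<rho> w)\<bar>)" by (rule sum_abs)
      also have "\<dots> \<le> (\<Sum>b\<in>(Basis::'a set). norm u * e)"
      proof (rule sum_mono)
        fix b :: 'a assume b: "b \<in> Basis"
        have "norm (y - w) < \<delta> b" using that d(2)[OF b] by (auto simp: dist_norm norm_minus_commute)
        then show "\<bar>(u \<bullet> b) * (partial b \<rho> y - partial b \<rho> w)\<bar> \<le> norm u * e"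
          unfolding abs_mult using \<delta>(2)[OF b] Basis_le_norm[OF b, of u] by (intro mult_mono) (auto simp: less_imp_le)
      qed
      also have "\<dots> = \<eta> * norm u" by (simp add: e_def)
      finally show "norm (g' y u) \<le> \<eta> * norm u" by simp
    qed
    have "norm (g (w + v) - g w) \<le> \<eta> * norm (w + v - w)"
      by (rule differentiable_bound[OF convex_ball D B]) (use v d in \<open>auto simp: dist_norm\<close>)
    then show ?thesis by (simp add: g_def inner_add_left algebra_simps sum.distrib)
  qed
  then show ?thesis using d(1) by blast
qed

lemma conv_has_derivative:
  assumes \<rho>: "smooth \<rho>" "\<And>x. r < norm x \<Longrightarrow> \<rho> x = 0" and Z: "integrable lborel Z"
  shows "(conv \<rho> Z has_derivative (\<lambda>v. \<Sum>b\<in>Basis. (v \<bullet> b) * conv (partial b \<rho>) Z x)) (at x)"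
  unfolding has_derivative_at_alt
proof (intro conjI allI impI)
  show "bounded_linear (\<lambda>v. \<Sum>b\<in>Basis. (v \<bullet> b) * conv (partial b \<rho>) Z x)"
    by (intro bounded_linear_sum bounded_linear_mult_const bounded_linear_inner_left)
  fix \<epsilon> :: real assume \<epsilon>: "0 < \<epsilon>"
  define I where "I = (LINT y|lborel. \<bar>Z y\<bar>)"
  have I: "0 \<le> I" by (auto simp: I_def)
  define \<eta> where "\<eta> = \<epsilon> / (I + 1)"
  have \<eta>: "0 < \<eta>" "\<eta> * I \<le> \<epsilon>" using \<epsilon> I by (auto simp: \<eta>_def field_simps)
  obtain \<delta> where \<delta>: "0 < \<delta>" "\<And>w v. norm v < \<delta> \<Longrightarrow>
    \<bar>\<rho> (w + v) - \<rho> w - (\<Sum>b\<in>Basis. (v \<bullet> b) * partial b \<rho> w)\<bar> \<le> \<eta> * norm v"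
    using uniformly_differentiable[OF \<rho> \<eta>(1)] by blast
  have i0: "integrable lborel (\<lambda>y. \<rho> (x - y) * Z y)" for x
    by (rule conv_integrand_integrable[OF smooth_continuous[OF \<rho>(1)] \<rho>(2) Z])
  have ib: "integrable lborel (\<lambda>y. partial b \<rho> (x - y) * Z y)" if "b \<in> Basis" for b
    by (rule conv_integrand_integrable[OF smooth_continuous[OF smooth_partial[OF \<rho>(1) that]] partial_bounded_support[OF \<rho>(2)] Z])
  show "\<exists>d>0. \<forall>y. norm (y - x) < d \<longrightarrow>
      norm (conv \<rho> Z y - conv \<rho> Z x - (\<Sum>b\<in>Basis. ((y - x) \<bullet> b) * conv (partial b \<rho>) Z x)) \<le> \<epsilon> * norm (y - x)"
  proof (intro exI conjI allI impI)
    fix y assume y: "norm (y - x) < \<delta>"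
    define v where "v = y - x"
    have "conv \<rho> Z y - conv \<rho> Z x - (\<Sum>b\<in>Basis. (v \<bullet> b) * conv (partial b \<rho>) Z x) =
       (LINT t|lborel. \<rho> (y - t) * Z t - \<rho> (x - t) * Z t - (\<Sum>b\<in>Basis. (v \<bullet> b) * (partial b \<rho> (x - t) * Z t)))"
      unfolding conv_def using i0 ib by (simp add: integrable_sum)
    also have "\<dots> = (LINT t|lborel. (\<rho> ((x - t) + v) - \<rho> (x - t) - (\<Sum>b\<in>Basis. (v \<bullet> b) * partial b \<rho> (x - t))) * Z t)"
      by (intro Bochner_Integration.integral_cong refl) (simp add: v_def algebra_simps sum_distrib_left)
    finally have eq: "conv \<rho> Z y - conv \<rho> Z x - (\<Sum>b\<in>Basis. (v \<bullet> b) * conv (partial b \<rho>) Z x) =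
      (LINT t|lborel. (\<rho> ((x - t) + v) - \<rho> (x - t) - (\<Sum>b\<in>Basis. (v \<bullet> b) * partial b \<rho> (x - t))) * Z t)" .
    have "norm \<dots> \<le> (LINT t|lborel. norm ((\<rho> ((x - t) + v) - \<rho> (x - t) - (\<Sum>b\<in>Basis. (v \<bullet> b) * partial b \<rho> (x - t))) * Z t))"
      by (rule integral_norm_bound)
    also have "\<dots> \<le> (LINT t|lborel. (\<eta> * norm v) * \<bar>Z t\<bar>)"
    proof (rule integral_mono')
      show "integrable lborel (\<lambda>t. (\<eta> * norm v) * \<bar>Z t\<bar>)" using Z by auto
      show "norm ((\<rho> ((x - t) + v) - \<rho> (x - t) - (\<Sum>b\<in>Basis. (v \<bullet> b) * partial b \<rho> (x - t))) * Z t) \<le> (\<eta> * norm v) * \<bar>Z t\<bar>" for t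
        using \<delta>(2)[of v "x - t"] y unfolding real_norm_def abs_mult by (intro mult_right_mono) (auto simp: v_def)
    qed (use \<eta> in auto)
    also have "\<dots> = (\<eta> * I) * norm v" by (simp add: I_def)
    also have "\<dots> \<le> \<epsilon> * norm v" using \<eta>(2) by (rule mult_right_mono) simp
    finally show "norm (conv \<rho> Z y - conv \<rho> Z x - (\<Sum>b\<in>Basis. ((y - x) \<bullet> b) * conv (partial b \<rho>) Z x)) \<le> \<epsilon> * norm (y - x)"
      using eq by (simp add: v_def)
  qed (use \<delta> in auto)
qed

lemma partial_conv:
  assumes \<rho>: "smooth \<rho>" "\<And>x. r < norm x \<Longrightarrow> \<rho> x = 0" and Z: "integrable lborel Z" and b: "b \<in> Basis"
  shows "partial b (conv \<rho> Z) = conv (partial b \<rho>) Z"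
proof
  fix x
  have "partial b (conv \<rho> Z) x = (\<Sum>c\<in>Basis. (b \<bullet> c) * conv (partial c \<rho>) Z x)"
    by (rule partial_eqI[OF conv_has_derivative]) (use assms in auto)
  also have "\<dots> = conv (partial b \<rho>) Z x"
    by (rule sum_inner_Basis_mult[OF b])
  finally show "partial b (conv \<rho> Z) x = conv (partial b \<rho>) Z x" .
qed

lemma smooth_conv:
  assumes \<rho>: "smooth \<rho>" "\<And>x. r < norm x \<Longrightarrow> \<rho> x = 0" and Z: "integrable lborel Z"
  shows "smooth (conv \<rho> Z)"
proof -
  have "C_k n (conv \<rho> Z)" for n
    using \<rho>
  proof (induction n arbitrary: \<rho>)
    case 0
    show ?case
      using has_derivative_continuous[OF conv_has_derivative[OF 0 Z]]
      by (simp add: continuous_on_eq_continuous_at)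
  next
    case (Suc n)
    have "C_k n (partial b (conv \<rho> Z))" if "b \<in> Basis" for b
    proof -
      have "C_k n (conv (partial b \<rho>) Z)"
        by (intro Suc.IH smooth_partial that) (use Suc.prems partial_bounded_support[OF Suc.prems(2)] in auto)
      then show ?thesis using partial_conv[of \<rho> r Z b] Suc.prems Z that by simp
    qed
    then show ?case
      using conv_has_derivative[OF Suc.prems Z] by (auto simp: differentiable_def)
  qed
  then show ?thesis by (simp add: smooth_def)
qed

section \<open>Convergence of mollified pairings\<close>

lemma lborel_distr_reflect: "distr lborel borel (\<lambda>y. x - y) = (lborel :: 'a::euclidean_space measure)"
  by (subst (2) lborel_affine[of "-1" x]) (auto simp: density_1)

lemma lborel_distr_translate: "distr lborel borel (\<lambda>x. x - y) = (lborel :: 'a::euclidean_space measure)"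
  by (subst (2) lborel_affine[of 1 "- y"]) (auto simp: density_1)

lemma mollifierD:
  assumes "mollifier r \<rho>"
  shows "smooth \<rho>" "0 \<le> \<rho> x" "r < norm x \<Longrightarrow> \<rho> x = 0" "(LINT x|lborel. \<rho> x) = 1"
    "integrable lborel \<rho>" "\<rho> \<in> borel_measurable borel"
    "(LINT y|lborel. \<rho> (x - y)) = 1" "integrable lborel (\<lambda>y. \<rho> (x - y))"
    "(\<integral>\<^sup>+x. ennreal (\<rho> (x - y)) \<partial>lborel) = 1"
proof -
  show s: "smooth \<rho>" and n: "\<And>x. 0 \<le> \<rho> x" and z: "\<And>x. r < norm x \<Longrightarrow> \<rho> x = 0" and i: "(LINT x|lborel. \<rho> x) = 1"
    using assms by (auto simp: mollifier_def)
  show int: "integrable lborel \<rho>"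
    by (rule integrable_of_bounded_support[OF smooth_continuous[OF s] z])
  show m[measurable]: "\<rho> \<in> borel_measurable borel"
    using smooth_continuous[OF s] by (rule borel_measurable_continuous_onI)
  have "(LINT y|distr lborel borel (\<lambda>y. x - y). \<rho> y) = (LINT y|lborel. \<rho> (x - y))"
    by (rule integral_distr) measurable
  then show "(LINT y|lborel. \<rho> (x - y)) = 1" by (simp add: lborel_distr_reflect i)
  have "integrable (distr lborel borel (\<lambda>y. x - y)) \<rho> \<longleftrightarrow> integrable lborel (\<lambda>y. \<rho> (x - y))"
    by (rule integrable_distr_eq) measurable
  then show "integrable lborel (\<lambda>y. \<rho> (x - y))" by (simp add: lborel_distr_reflect int)
  have "(\<integral>\<^sup>+x. ennreal (\<rho> x) \<partial>distr lborel borel (\<lambda>x. x - y)) = (\<integral>\<^sup>+x. ennreal (\<rho> (x - y)) \<partial>lborel)"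
    by (rule nn_integral_distr) measurable
  moreover have "(\<integral>\<^sup>+x. ennreal (\<rho> x) \<partial>lborel) = 1"
    using nn_integral_eq_integral[OF int] n i by simp
  ultimately show "(\<integral>\<^sup>+x. ennreal (\<rho> (x - y)) \<partial>lborel) = 1" by (simp add: lborel_distr_translate)
qed

lemma conv_integrable_mollifier:
  assumes "mollifier r \<rho>" "integrable lborel Z"
  shows "integrable lborel (\<lambda>y. \<rho> (x - y) * Z y)"
  by (rule conv_integrand_integrable[of \<rho> r])
    (use assms mollifierD[OF assms(1)] smooth_continuous in auto)

lemma conv_measurable:
  assumes "mollifier r \<rho>" "integrable lborel Z"
  shows "conv \<rho> Z \<in> borel_measurable borel"
  using smooth_continuous[OF smooth_conv[of \<rho> r Z]] assms mollifierD[OF assms(1)]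
  by (auto intro: borel_measurable_continuous_onI)

text \<open>Tonelli's theorem and the translation invariance of Lebesgue measure.\<close>

lemma conv_nonneg_integral:
  assumes \<rho>: "mollifier r \<rho>" and Z: "integrable lborel Z" and nn: "\<And>x. 0 \<le> Z x"
  shows "integrable lborel (conv \<rho> Z)" "(LINT x|lborel. conv \<rho> Z x) = (LINT x|lborel. Z x)"
proof -
  note [measurable] = mollifierD(6)[OF \<rho>] conv_measurable[OF \<rho> Z]
  have [measurable]: "Z \<in> borel_measurable borel" using borel_measurable_integrable[OF Z] by simp
  have pos: "\<And>x. 0 \<le> conv \<rho> Z x"
    unfolding conv_def using mollifierD(2)[OF \<rho>] nn by (intro integral_nonneg_AE) auto
  have "(\<integral>\<^sup>+x. ennreal (conv \<rho> Z x) \<partial>lborel) = (\<integral>\<^sup>+x. \<integral>\<^sup>+y. ennreal (\<rho> (x - y) * Z y) \<partial>lborel \<partial>lborel)"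
    unfolding conv_def using mollifierD(2)[OF \<rho>] nn
    by (intro nn_integral_cong nn_integral_eq_integral[symmetric] conv_integrable_mollifier[OF \<rho> Z]) auto
  also have "\<dots> = (\<integral>\<^sup>+y. \<integral>\<^sup>+x. ennreal (\<rho> (x - y) * Z y) \<partial>lborel \<partial>lborel)"
    by (rule lborel_pair.Fubini'[symmetric]) (measurable)
  also have "\<dots> = (\<integral>\<^sup>+y. ennreal (Z y) * (\<integral>\<^sup>+x. ennreal (\<rho> (x - y)) \<partial>lborel) \<partial>lborel)"
    using mollifierD(2)[OF \<rho>] nn
    by (intro nn_integral_cong) (simp add: nn_integral_cmult[symmetric] ennreal_mult mult.commute)
  also have "\<dots> = (\<integral>\<^sup>+y. ennreal (Z y) \<partial>lborel)" by (simp add: mollifierD(9)[OF \<rho>])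
  also have "\<dots> = ennreal (LINT x|lborel. Z x)"
    using nn by (intro nn_integral_eq_integral Z) auto
  finally have eq: "(\<integral>\<^sup>+x. ennreal (conv \<rho> Z x) \<partial>lborel) = ennreal (LINT x|lborel. Z x)" .
  show int: "integrable lborel (conv \<rho> Z)"
    using eq pos by (intro integrableI_nonneg) auto
  have "ennreal (LINT x|lborel. conv \<rho> Z x) = ennreal (LINT x|lborel. Z x)"
    using nn_integral_eq_integral[OF int] pos eq by simp
  moreover have "0 \<le> (LINT x|lborel. conv \<rho> Z x)" "0 \<le> (LINT x|lborel. Z x)"
    using pos nn by (auto intro: integral_nonneg_AE)
  ultimately show "(LINT x|lborel. conv \<rho> Z x) = (LINT x|lborel. Z x)" by simp
qed

text \<open>A majorant in which \<open>x\<close> and \<open>y\<close> are separated takes the place of the inequalities of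
Hoelder and Young: in the double integral of \<open>\<rho> (x - y) * F x * G y\<close> each of the two terms can be integrated
first in the variable on which it does not depend, where the kernel has integral one.\<close>

lemma conv_pairing_bound:
  assumes \<rho>: "mollifier r \<rho>" and F: "F \<in> borel_measurable borel" and G: "integrable lborel G"
    and \<Phi>: "integrable lborel \<Phi>" and \<Psi>: "integrable lborel \<Psi>" "\<And>y. 0 \<le> \<Psi> y"
    and bound: "\<And>x y. \<bar>F x\<bar> * \<bar>G y\<bar> \<le> \<Phi> x + \<Psi> y"
  shows "integrable lborel (\<lambda>x. F x * conv \<rho> G x)"
    and "\<bar>LINT x|lborel. F x * conv \<rho> G x\<bar> \<le> (LINT x|lborel. \<Phi> x) + (LINT x|lborel. \<Psi> x)"
proof -
  note [measurable] = F conv_measurable[OF \<rho> G]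
  have pt: "norm (F x * conv \<rho> G x) \<le> \<Phi> x + conv \<rho> \<Psi> x" for x
  proof -
    have "norm (F x * conv \<rho> G x) = norm (LINT y|lborel. F x * (\<rho> (x - y) * G y))"
      by (simp add: conv_def)
    also have "\<dots> \<le> (LINT y|lborel. norm (F x * (\<rho> (x - y) * G y)))" by (rule integral_norm_bound)
    also have "\<dots> \<le> (LINT y|lborel. \<rho> (x - y) * \<Phi> x + \<rho> (x - y) * \<Psi> y)"
    proof (rule integral_mono)
      show "integrable lborel (\<lambda>y. norm (F x * (\<rho> (x - y) * G y)))"
        using conv_integrable_mollifier[OF \<rho> G] by auto
      show "integrable lborel (\<lambda>y. \<rho> (x - y) * \<Phi> x + \<rho> (x - y) * \<Psi> y)"
        using conv_integrable_mollifier[OF \<rho> \<Psi>(1)] mollifierD(8)[OF \<rho>] by auto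
      show "norm (F x * (\<rho> (x - y) * G y)) \<le> \<rho> (x - y) * \<Phi> x + \<rho> (x - y) * \<Psi> y" for y
        using mult_left_mono[OF bound[of x y] mollifierD(2)[OF \<rho>, of "x - y"]] mollifierD(2)[OF \<rho>, of "x - y"]
        by (simp add: abs_mult algebra_simps)
    qed
    also have "\<dots> = \<Phi> x + conv \<rho> \<Psi> x"
      using conv_integrable_mollifier[OF \<rho> \<Psi>(1)] mollifierD(8)[OF \<rho>]
      by (simp add: mollifierD(7)[OF \<rho>] conv_def)
    finally show ?thesis .
  qed
  note c = conv_nonneg_integral[OF \<rho> \<Psi>]
  show int: "integrable lborel (\<lambda>x. F x * conv \<rho> G x)"
    by (rule Bochner_Integration.integrable_bound[of _ "\<lambda>x. \<Phi> x + conv \<rho> \<Psi> x"])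
      (use \<Phi> c(1) order_trans[OF pt abs_ge_self] in auto)
  have "\<bar>LINT x|lborel. F x * conv \<rho> G x\<bar> \<le> (LINT x|lborel. \<bar>F x * conv \<rho> G x\<bar>)"
    by (rule integral_abs_bound)
  also have "\<dots> \<le> (LINT x|lborel. \<Phi> x + conv \<rho> \<Psi> x)"
    using int \<Phi> c(1) pt by (intro integral_mono) auto
  also have "\<dots> = (LINT x|lborel. \<Phi> x) + (LINT x|lborel. \<Psi> x)" using \<Phi> c by simp
  finally show "\<bar>LINT x|lborel. F x * conv \<rho> G x\<bar> \<le> (LINT x|lborel. \<Phi> x) + (LINT x|lborel. \<Psi> x)" .
qed

text \<open>For an open set \<open>U\<close> slightly larger than \<open>A\<close>, the Lipschitz
functions \<open>min 1 (n * dist(x, - U))\<close> increase to the indicator of \<open>U\<close>.\<close>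

lemma indicator_uniformly_continuous_approx:
  fixes A :: "'a::euclidean_space set"
  assumes A: "A \<in> sets borel" "emeasure lborel A < \<infinity>" and \<eta>: "0 < \<eta>"
  shows "\<exists>g::'a \<Rightarrow> real. uniformly_continuous_on UNIV g \<and> integrable lborel g \<and>
    (LINT x|lborel. \<bar>indicator A x - g x\<bar>) \<le> \<eta>"
proof -
  obtain U where U: "open U" "A \<subseteq> U" "emeasure lborel (U - A) < ennreal (\<eta> / 2)"
    using outer_regular_lborel[of A "\<eta>/2"] A \<eta> by auto
  have [measurable]: "U \<in> sets borel" "A \<in> sets borel" using U A by auto
  have "emeasure lborel U = emeasure lborel (A \<union> (U - A))" using U by (simp add: Un_absorb1)
  also have "\<dots> \<le> emeasure lborel A + emeasure lborel (U - A)" by (rule emeasure_subadditive) auto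
  also have "\<dots> < \<infinity>" using A order.strict_trans[OF U(3) ennreal_less_top] by simp
  finally have Ufin: "emeasure lborel U < \<infinity>" .
  have ne: "- U \<noteq> {}"
  proof
    assume "- U = {}"
    then have "U = UNIV" by auto
    then show False using Ufin by simp
  qed
  define g where "g n x = min 1 (real n * infdist x (- U))" for n :: nat and x :: 'a
  have g01: "0 \<le> g n x" "g n x \<le> indicator U x" for n x
    using infdist_nonneg[of x "- U"] by (auto simp: g_def indicator_def)
  have lip: "\<bar>g n x - g n y\<bar> \<le> real n * dist x y" for n x y
  proof -
    have "\<bar>g n x - g n y\<bar> \<le> \<bar>real n * infdist x (- U) - real n * infdist y (- U)\<bar>"
      unfolding g_def by (auto simp: min_def)
    also have "\<dots> = real n * \<bar>infdist x (- U) - infdist y (- U)\<bar>"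
      by (simp add: right_diff_distrib[symmetric] abs_mult)
    also have "\<dots> \<le> real n * dist x y" by (intro mult_left_mono infdist_triangle_abs) auto
    finally show ?thesis .
  qed
  have uc: "uniformly_continuous_on UNIV (g n)" for n
    unfolding uniformly_continuous_on_def
  proof (intro allI impI)
    fix e :: real assume e: "0 < e"
    show "\<exists>d>0. \<forall>x\<in>UNIV. \<forall>x'\<in>UNIV. dist x' x < d \<longrightarrow> dist (g n x') (g n x) < e"
    proof (intro exI conjI ballI impI)
      show "0 < e / (real n + 1)" using e by simp
      fix x x' :: 'a assume "dist x' x < e / (real n + 1)"
      then have "dist x' x * (real n + 1) < e" by (simp add: field_simps)
      moreover have "real n * dist x' x \<le> dist x' x * (real n + 1)" by (simp add: algebra_simps)
      ultimately show "dist (g n x') (g n x) < e" using lip[of n x' x] by (simp add: dist_real_def)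
    qed
  qed
  have [measurable]: "g n \<in> borel_measurable borel" for n
    by (intro borel_measurable_continuous_onI uniformly_continuous_imp_continuous uc)
  have Ui: "integrable lborel (indicator U :: 'a \<Rightarrow> real)" and Ai: "integrable lborel (indicator A :: 'a \<Rightarrow> real)"
    using Ufin A by (auto simp: less_top[symmetric])
  have gi: "integrable lborel (g n)" for n
    by (rule Bochner_Integration.integrable_bound[OF Ui]) (use g01 in auto)
  have "(\<lambda>n. LINT x|lborel. indicator U x - g n x) \<longlonglongrightarrow> (LINT x::'a|lborel. 0)"
  proof (rule integral_dominated_convergence)
    show "integrable lborel (indicator U :: 'a \<Rightarrow> real)" by fact
    show "AE x in lborel. (\<lambda>n. indicator U x - g n x) \<longlonglongrightarrow> 0"
    proof (rule AE_I2)
      fix x :: 'a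
      show "(\<lambda>n. indicator U x - g n x) \<longlonglongrightarrow> 0"
      proof (cases "x \<in> U")
        case True
        then have "infdist x (- U) \<noteq> 0"
          using in_closed_iff_infdist_zero[of "- U" x] U(1) ne by auto
        then have p: "0 < infdist x (- U)" using infdist_nonneg[of x "- U"] by simp
        have "eventually (\<lambda>n. 1 / infdist x (- U) \<le> real n) sequentially"
          using filterlim_real_sequentially unfolding filterlim_at_top by blast
        then have "eventually (\<lambda>n. indicator U x - g n x = 0) sequentially"
          by eventually_elim (use True p in \<open>auto simp: g_def field_simps min_def\<close>)
        then show ?thesis by (rule tendsto_eventually)
      next
        case False
        then have "indicator U x - g n x = 0" for n using g01[of n x] by simp
        then show ?thesis by simp
      qed
    qed
    show "AE x in lborel. norm (indicator U x - g n x) \<le> indicator U x" for n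
    proof (rule AE_I2)
      fix x show "norm (indicator U x - g n x) \<le> indicator U x" using g01[of n x] by simp
    qed
  qed auto
  then have "eventually (\<lambda>n. (LINT x|lborel. indicator U x - g n x) < \<eta> / 2) sequentially"
    using \<eta> by (intro order_tendstoD(2)) auto
  then obtain n where n: "(LINT x|lborel. indicator U x - g n x) < \<eta> / 2"
    by (auto simp: eventually_sequentially)
  have UA: "(LINT x|lborel. indicator U x - indicator A x) \<le> \<eta> / 2"
  proof -
    have "(LINT x|lborel. indicator U x - indicator A x) = (LINT x|lborel. indicator (U - A) x)"
      using U by (intro Bochner_Integration.integral_cong) (auto simp: indicator_def)
    also have "\<dots> = measure lborel (U - A)" by simp
    also have "\<dots> \<le> \<eta> / 2" using U(3) \<eta> unfolding measure_def
      by (intro enn2real_leI) auto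
    finally show ?thesis .
  qed
  have "(LINT x|lborel. \<bar>indicator A x - g n x\<bar>) \<le> (LINT x|lborel. (indicator U x - indicator A x) + (indicator U x - g n x))"
  proof (rule integral_mono)
    show "\<bar>indicator A x - g n x\<bar> \<le> (indicator U x - indicator A x) + (indicator U x - g n x)" for x
      using g01[of n x] U(2) by (auto simp: indicator_def)
  qed (use Ui Ai gi in auto)
  also have "\<dots> = (LINT x|lborel. indicator U x - indicator A x) + (LINT x|lborel. indicator U x - g n x)"
    using Ui Ai gi by simp
  also have "\<dots> \<le> \<eta>" using UA n by simp
  finally show ?thesis using uc gi by blast
qed

lemma integrable_uniformly_continuous_approx:
  fixes G :: "'a::euclidean_space \<Rightarrow> real"
  assumes "integrable lborel G" "0 < \<eta>"
  shows "\<exists>g. uniformly_continuous_on UNIV g \<and> integrable lborel g \<and> (LINT x|lborel. \<bar>G x - g x\<bar>) \<le> \<eta>"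
  using assms
proof (induction arbitrary: \<eta> rule: integrable_induct)
  case (base A c)
  define e where "e = \<eta> / (\<bar>c\<bar> + 1)"
  have e: "0 < e" "\<bar>c\<bar> * e \<le> \<eta>" using base by (auto simp: e_def field_simps)
  obtain g where g: "uniformly_continuous_on UNIV g" "integrable lborel g"
    "(LINT x|lborel. \<bar>indicator A x - g x\<bar>) \<le> e"
    using indicator_uniformly_continuous_approx[of A e] base e by auto
  have "(LINT x|lborel. \<bar>indicator A x *\<^sub>R c - c * g x\<bar>) = (LINT x|lborel. \<bar>c\<bar> * \<bar>indicator A x - g x\<bar>)"
    by (intro Bochner_Integration.integral_cong) (auto simp: abs_mult[symmetric] algebra_simps)
  also have "\<dots> \<le> \<bar>c\<bar> * e" using g(3) by (simp add: mult_left_mono)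
  finally show ?case
    using g e by (intro exI[of _ "\<lambda>x. c * g x"]) (auto intro: uniformly_continuous_on_cmul_left)
next
  case (add f g)
  obtain f' where f': "uniformly_continuous_on UNIV f'" "integrable lborel f'" "(LINT x|lborel. \<bar>f x - f' x\<bar>) \<le> \<eta>/2"
    using add.IH(1)[of "\<eta>/2"] add.prems by auto
  obtain g' where g': "uniformly_continuous_on UNIV g'" "integrable lborel g'" "(LINT x|lborel. \<bar>g x - g' x\<bar>) \<le> \<eta>/2"
    using add.IH(2)[of "\<eta>/2"] add.prems by auto
  have "(LINT x|lborel. \<bar>(f x + g x) - (f' x + g' x)\<bar>) \<le> (LINT x|lborel. \<bar>f x - f' x\<bar> + \<bar>g x - g' x\<bar>)"
    using add f' g' by (intro integral_mono) auto
  also have "\<dots> \<le> \<eta>" using add f' g' by simp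
  finally show ?case
    using f' g' by (intro exI[of _ "\<lambda>x. f' x + g' x"]) (auto intro: uniformly_continuous_on_add)
next
  case (lim f s)
  have "(\<lambda>i. LINT x|lborel. \<bar>f x - s i x\<bar>) \<longlonglongrightarrow> (LINT x::'a|lborel. 0)"
  proof (rule integral_dominated_convergence)
    show "integrable lborel (\<lambda>x. 3 * norm (f x))" using lim by auto
    show "AE x in lborel. (\<lambda>i. \<bar>f x - s i x\<bar>) \<longlonglongrightarrow> 0"
    proof (rule AE_I2)
      fix x
      have "(\<lambda>i. \<bar>f x - s i x\<bar>) \<longlonglongrightarrow> \<bar>f x - f x\<bar>" using lim by (intro tendsto_intros) auto
      then show "(\<lambda>i. \<bar>f x - s i x\<bar>) \<longlonglongrightarrow> 0" by simp
    qed
    show "AE x in lborel. norm \<bar>f x - s i x\<bar> \<le> 3 * norm (f x)" for i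
    proof (rule AE_I2)
      fix x show "norm \<bar>f x - s i x\<bar> \<le> 3 * norm (f x)" using lim(3)[of x i] by simp
    qed
  qed (use lim in auto)
  then have "eventually (\<lambda>i. (LINT x|lborel. \<bar>f x - s i x\<bar>) < \<eta>/2) sequentially"
    using lim.prems by (intro order_tendstoD(2)) auto
  then obtain i where i: "(LINT x|lborel. \<bar>f x - s i x\<bar>) < \<eta>/2" by (auto simp: eventually_sequentially)
  obtain g where g: "uniformly_continuous_on UNIV g" "integrable lborel g" "(LINT x|lborel. \<bar>s i x - g x\<bar>) \<le> \<eta>/2"
    using lim.IH[of "\<eta>/2" i] lim.prems by auto
  have si: "integrable lborel (s i)" using lim by simp
  have "(LINT x|lborel. \<bar>f x - g x\<bar>) \<le> (LINT x|lborel. \<bar>f x - s i x\<bar> + \<bar>s i x - g x\<bar>)"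
    using lim(4) si g by (intro integral_mono) auto
  also have "\<dots> \<le> \<eta>" using lim(4) si g i by simp
  finally show ?case using g by blast
qed

text \<open>Replace \<open>G\<close> by a uniformly continuous function \<open>g\<close>. The error is small in
\<open>L\<^sup>1\<close> and is paired with a bounded function, before and after mollification; and \<open>conv (\<rho> n) g\<close> converges
uniformly to \<open>g\<close>.\<close>

lemma tendsto_conv_pairing_bounded:
  fixes F G :: "'a::euclidean_space \<Rightarrow> real"
  assumes \<rho>: "\<And>n. mollifier (r n) (\<rho> n)" and r: "r \<longlonglongrightarrow> 0"
    and F: "integrable lborel F" "\<And>x. \<bar>F x\<bar> \<le> M" and G: "integrable lborel G"
  shows "(\<lambda>n. LINT x|lborel. F x * conv (\<rho> n) G x) \<longlonglongrightarrow> (LINT x|lborel. F x * G x)"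
proof (rule LIMSEQ_I)
  fix \<epsilon> :: real assume \<epsilon>: "0 < \<epsilon>"
  have M: "0 \<le> M" using F(2)[of 0] by linarith
  have Fm[measurable]: "F \<in> borel_measurable borel" using borel_measurable_integrable[OF F(1)] by simp
  have intFH: "integrable lborel (\<lambda>x. F x * H x)" "\<bar>LINT x|lborel. F x * H x\<bar> \<le> M * (LINT x|lborel. \<bar>H x\<bar>)"
    if H: "integrable lborel H" for H
  proof -
    have [measurable]: "H \<in> borel_measurable borel" using borel_measurable_integrable[OF H] by simp
    have le: "norm (F x * H x) \<le> M * \<bar>H x\<bar>" for x
      using F(2)[of x] by (auto simp: abs_mult intro!: mult_right_mono)
    show i: "integrable lborel (\<lambda>x. F x * H x)"
      by (rule Bochner_Integration.integrable_bound[of _ "\<lambda>x. M * \<bar>H x\<bar>"]) (use H M le in auto)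
    have "\<bar>LINT x|lborel. F x * H x\<bar> \<le> (LINT x|lborel. \<bar>F x * H x\<bar>)"
      by (rule integral_abs_bound)
    also have "\<dots> \<le> (LINT x|lborel. M * \<bar>H x\<bar>)" using i H le by (intro integral_mono) auto
    finally show "\<bar>LINT x|lborel. F x * H x\<bar> \<le> M * (LINT x|lborel. \<bar>H x\<bar>)" by simp
  qed
  define \<eta> where "\<eta> = \<epsilon> / (4 * (M + 1))"
  have \<eta>: "0 < \<eta>" "M * \<eta> \<le> \<epsilon> / 4" using \<epsilon> M by (auto simp: \<eta>_def field_simps)
  obtain g where g: "uniformly_continuous_on UNIV g" "integrable lborel g" "(LINT x|lborel. \<bar>G x - g x\<bar>) \<le> \<eta>"
    using integrable_uniformly_continuous_approx[OF G \<eta>(1)] by blast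
  define I where "I = (LINT x|lborel. \<bar>F x\<bar>)"
  have I: "0 \<le> I" by (auto simp: I_def)
  define e where "e = \<epsilon> / (4 * (I + 1))"
  have e: "0 < e" "I * e \<le> \<epsilon> / 4" using \<epsilon> I by (auto simp: e_def field_simps)
  obtain \<delta> where \<delta>: "0 < \<delta>" "\<And>x y. dist y x < \<delta> \<Longrightarrow> \<bar>g y - g x\<bar> < e"
    using g(1) e(1) unfolding uniformly_continuous_on_def dist_real_def by (metis UNIV_I)
  obtain N where N: "\<And>n. n \<ge> N \<Longrightarrow> r n < \<delta>"
    using order_tendstoD(2)[OF r \<delta>(1)] by (auto simp: eventually_sequentially)
  show "\<exists>N. \<forall>n\<ge>N. norm ((LINT x|lborel. F x * conv (\<rho> n) G x) - (LINT x|lborel. F x * G x)) < \<epsilon>"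
  proof (intro exI allI impI)
    fix n assume "N \<le> n"
    then have rn: "r n < \<delta>" using N by simp
    note rho = mollifierD[OF \<rho>[of n]]
    have Gg: "integrable lborel (\<lambda>x. G x - g x)" using G g by auto
    have close: "\<bar>conv (\<rho> n) g x - g x\<bar> \<le> e" for x
    proof -
      have "conv (\<rho> n) g x - g x = (LINT y|lborel. \<rho> n (x - y) * g y) - (LINT y|lborel. \<rho> n (x - y) * g x)"
        using rho(7)[of x] rho(8)[of x] by (simp add: conv_def)
      also have "\<dots> = (LINT y|lborel. \<rho> n (x - y) * g y - \<rho> n (x - y) * g x)"
        using conv_integrable_mollifier[OF \<rho> g(2), of n x] rho(8)[of x] by simp
      finally have "\<bar>conv (\<rho> n) g x - g x\<bar> \<le> (LINT y|lborel. norm (\<rho> n (x - y) * g y - \<rho> n (x - y) * g x))"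
        using integral_norm_bound[of lborel "\<lambda>y. \<rho> n (x - y) * g y - \<rho> n (x - y) * g x"] by simp
      also have "\<dots> \<le> (LINT y|lborel. \<rho> n (x - y) * e)"
      proof (rule integral_mono)
        show "integrable lborel (\<lambda>y. norm (\<rho> n (x - y) * g y - \<rho> n (x - y) * g x))"
          using conv_integrable_mollifier[OF \<rho> g(2), of n x] rho(8)[of x] by auto
        show "integrable lborel (\<lambda>y. \<rho> n (x - y) * e)" using rho(8)[of x] by auto
        show "norm (\<rho> n (x - y) * g y - \<rho> n (x - y) * g x) \<le> \<rho> n (x - y) * e" for y
        proof (cases "r n < norm (x - y)")
          case False
          then have "\<bar>g y - g x\<bar> < e" using rn by (intro \<delta>(2)) (simp add: dist_norm norm_minus_commute)
          then have "\<rho> n (x - y) * \<bar>g y - g x\<bar> \<le> \<rho> n (x - y) * e" using rho(2)[of "x - y"] by (intro mult_left_mono) auto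
          then show ?thesis using rho(2)[of "x - y"] by (simp add: right_diff_distrib[symmetric] abs_mult)
        qed (use rho(3)[of "x - y"] in auto)
      qed
      also have "\<dots> = e" using rho(7)[of x] by simp
      finally show ?thesis .
    qed
    have cG: "conv (\<rho> n) G x = conv (\<rho> n) (\<lambda>x. G x - g x) x + (conv (\<rho> n) g x - g x) + g x" for x
      using conv_integrable_mollifier[OF \<rho> g(2), of n x] conv_integrable_mollifier[OF \<rho> G, of n x]
      by (simp add: conv_def right_diff_distrib)
    have b: "\<bar>F x\<bar> * \<bar>G y - g y\<bar> \<le> 0 + M * \<bar>G y - g y\<bar>" for x y
      using F(2)[of x] by (simp add: mult_right_mono)
    have cp: "integrable lborel (\<lambda>x. F x * conv (\<rho> n) (\<lambda>x. G x - g x) x)"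
      "\<bar>LINT x|lborel. F x * conv (\<rho> n) (\<lambda>x. G x - g x) x\<bar> \<le> M * (LINT x|lborel. \<bar>G x - g x\<bar>)"
      using conv_pairing_bound[OF \<rho> Fm Gg, of "\<lambda>x. 0" "\<lambda>y. M * \<bar>G y - g y\<bar>" n] Gg M b by auto
    have [measurable]: "conv (\<rho> n) g \<in> borel_measurable borel" "g \<in> borel_measurable borel"
      using conv_measurable[OF \<rho> g(2)] borel_measurable_integrable[OF g(2)] by auto
    have le2: "norm (F x * (conv (\<rho> n) g x - g x)) \<le> e * \<bar>F x\<bar>" for x
      using mult_left_mono[OF close[of x] abs_ge_zero[of "F x"]] by (simp add: abs_mult mult.commute)
    have i2: "integrable lborel (\<lambda>x. F x * (conv (\<rho> n) g x - g x))"
      by (rule Bochner_Integration.integrable_bound[of _ "\<lambda>x. e * \<bar>F x\<bar>"]) (use F e le2 in auto)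
    have "\<bar>LINT x|lborel. F x * (conv (\<rho> n) g x - g x)\<bar> \<le> (LINT x|lborel. \<bar>F x * (conv (\<rho> n) g x - g x)\<bar>)"
      by (rule integral_abs_bound)
    also have "\<dots> \<le> (LINT x|lborel. e * \<bar>F x\<bar>)" using i2 F le2 by (intro integral_mono) auto
    also have "\<dots> = I * e" by (simp add: I_def)
    finally have b2: "\<bar>LINT x|lborel. F x * (conv (\<rho> n) g x - g x)\<bar> \<le> \<epsilon> / 4" using e by simp
    have split: "(LINT x|lborel. F x * conv (\<rho> n) G x) - (LINT x|lborel. F x * G x) =
      (LINT x|lborel. F x * conv (\<rho> n) (\<lambda>x. G x - g x) x) + (LINT x|lborel. F x * (conv (\<rho> n) g x - g x))
      - (LINT x|lborel. F x * (G x - g x))"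
    proof -
      have "(LINT x|lborel. F x * conv (\<rho> n) G x) =
        (LINT x|lborel. F x * conv (\<rho> n) (\<lambda>x. G x - g x) x + F x * (conv (\<rho> n) g x - g x) + F x * g x)"
        by (intro Bochner_Integration.integral_cong refl) (simp add: cG algebra_simps)
      also have "\<dots> = (LINT x|lborel. F x * conv (\<rho> n) (\<lambda>x. G x - g x) x)
          + (LINT x|lborel. F x * (conv (\<rho> n) g x - g x)) + (LINT x|lborel. F x * g x)"
        using cp(1) i2 intFH(1)[OF g(2)] by simp
      moreover have "(LINT x|lborel. F x * (G x - g x)) = (LINT x|lborel. F x * G x) - (LINT x|lborel. F x * g x)"
        using intFH(1)[OF g(2)] intFH(1)[OF G] by (simp add: right_diff_distrib)
      ultimately show ?thesis by simp
    qed
    have "M * (LINT x|lborel. \<bar>G x - g x\<bar>) \<le> \<epsilon> / 4"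
      using mult_left_mono[OF g(3) M] \<eta>(2) by linarith
    then show "norm ((LINT x|lborel. F x * conv (\<rho> n) G x) - (LINT x|lborel. F x * G x)) < \<epsilon>"
      unfolding split using cp(2) b2 intFH(2)[OF Gg] \<epsilon> by (simp add: abs_le_iff abs_less_iff) linarith
  qed
qed

text \<open>\<open>F\<close> has a bounded approximation \<open>F'\<close>, and the product of the error with \<open>G\<close> has a
majorant in separated variables with integral at most \<open>\<eta>\<close>, as \<open>conv_pairing_bound\<close> requires.\<close>

definition separated_error :: "real \<Rightarrow> ('a::euclidean_space \<Rightarrow> real) \<Rightarrow> ('a \<Rightarrow> real) \<Rightarrow> bool" where
  "separated_error \<eta> F G \<longleftrightarrow> (\<exists>F' M \<Phi> \<Psi>. integrable lborel F' \<and> (\<forall>x. \<bar>F' x\<bar> \<le> M) \<and>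
     integrable lborel \<Phi> \<and> integrable lborel \<Psi> \<and> (\<forall>x. 0 \<le> \<Phi> x) \<and> (\<forall>y. 0 \<le> \<Psi> y) \<and>
     (\<forall>x y. \<bar>F x - F' x\<bar> * \<bar>G y\<bar> \<le> \<Phi> x + \<Psi> y) \<and>
     (LINT x|lborel. \<Phi> x) + (LINT y|lborel. \<Psi> y) \<le> \<eta>)"

text \<open>One notion for all pairs of dual exponents, including one and infinity.\<close>

definition pairable :: "('a::euclidean_space \<Rightarrow> real) \<Rightarrow> ('a \<Rightarrow> real) \<Rightarrow> bool" where
  "pairable F G \<longleftrightarrow> integrable lborel F \<and> integrable lborel G \<and> (\<forall>\<eta>>0. separated_error \<eta> F G)"

lemma pairableE:
  assumes "pairable F G" "0 < \<eta>"
  obtains F' M \<Phi> \<Psi> where "integrable lborel F'" "\<And>x. \<bar>F' x\<bar> \<le> M"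
    "integrable lborel \<Phi>" "integrable lborel \<Psi>" "\<And>x. 0 \<le> \<Phi> x" "\<And>y. 0 \<le> \<Psi> y"
    "\<And>x y. \<bar>F x - F' x\<bar> * \<bar>G y\<bar> \<le> \<Phi> x + \<Psi> y" "(LINT x|lborel. \<Phi> x) + (LINT y|lborel. \<Psi> y) \<le> \<eta>"
  using assms unfolding pairable_def separated_error_def by metis

lemma integrable_bounded_mult:
  fixes F H :: "'a \<Rightarrow> real"
  assumes F: "F \<in> borel_measurable M" "\<And>x. \<bar>F x\<bar> \<le> C" and H: "integrable M H"
  shows "integrable M (\<lambda>x. F x * H x)"
proof (rule Bochner_Integration.integrable_bound[of _ "\<lambda>x. C * H x"])
  have "0 \<le> C" using F(2)[of undefined] by linarith
  then show "AE x in M. norm (F x * H x) \<le> norm (C * H x)"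
    using F(2) by (intro AE_I2) (auto simp: abs_mult intro!: mult_right_mono)
qed (use F H in auto)

lemma pairable_remainder_integrable:
  fixes F G :: "'a::euclidean_space \<Rightarrow> real"
  assumes F: "F \<in> borel_measurable borel" and G: "G \<in> borel_measurable borel"
    and P: "integrable lborel \<Phi>" "integrable lborel \<Psi>" "\<And>x y. \<bar>F x\<bar> * \<bar>G y\<bar> \<le> \<Phi> x + \<Psi> y"
  shows "integrable lborel (\<lambda>x. F x * G x)"
    and "\<bar>LINT x|lborel. F x * G x\<bar> \<le> (LINT x|lborel. \<Phi> x) + (LINT x|lborel. \<Psi> x)"
proof -
  note [measurable] = F G
  have le: "norm (F x * G x) \<le> \<Phi> x + \<Psi> x" for x using P(3)[of x x] by (simp add: abs_mult)
  show i: "integrable lborel (\<lambda>x. F x * G x)"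
    by (rule Bochner_Integration.integrable_bound[of _ "\<lambda>x. \<Phi> x + \<Psi> x"]) (use P order_trans[OF le abs_ge_self] in auto)
  have "\<bar>LINT x|lborel. F x * G x\<bar> \<le> (LINT x|lborel. \<bar>F x * G x\<bar>)"
    by (rule integral_abs_bound)
  also have "\<dots> \<le> (LINT x|lborel. \<Phi> x + \<Psi> x)" using i P le by (intro integral_mono) auto
  finally show "\<bar>LINT x|lborel. F x * G x\<bar> \<le> (LINT x|lborel. \<Phi> x) + (LINT x|lborel. \<Psi> x)" using P by simp
qed

lemma pairable_integrable_mult:
  assumes "pairable F G"
  shows "integrable lborel (\<lambda>x. F x * G x)"
proof -
  have i: "integrable lborel F" "integrable lborel G" using assms by (auto simp: pairable_def)
  obtain F' M \<Phi> \<Psi> where *: "integrable lborel F'" "\<And>x. \<bar>F' x\<bar> \<le> M"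
    "integrable lborel \<Phi>" "integrable lborel \<Psi>" "\<And>x y. \<bar>F x - F' x\<bar> * \<bar>G y\<bar> \<le> \<Phi> x + \<Psi> y"
    using pairableE[OF assms, of 1] by (metis zero_less_one)
  have "integrable lborel (\<lambda>x. F' x * G x)" using * i by (intro integrable_bounded_mult[of F' _ M]) auto
  moreover have "integrable lborel (\<lambda>x. (F x - F' x) * G x)"
    by (rule pairable_remainder_integrable(1)[OF _ _ *(3,4,5)]) (use i * in auto)
  ultimately have "integrable lborel (\<lambda>x. F' x * G x + (F x - F' x) * G x)" by auto
  then show ?thesis by (simp add: algebra_simps)
qed

lemma pairable_bounded_mult:
  assumes P: "pairable F G" and \<phi>: "\<phi> \<in> borel_measurable borel" "\<And>x. \<bar>\<phi> x\<bar> \<le> C"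
  shows "pairable (\<lambda>x. \<phi> x * F x) G"
  unfolding pairable_def
proof (intro conjI allI impI)
  have i: "integrable lborel F" "integrable lborel G" using P by (auto simp: pairable_def)
  show "integrable lborel (\<lambda>x. \<phi> x * F x)" using \<phi> i by (intro integrable_bounded_mult[of \<phi> _ C]) auto
  show "integrable lborel G" by fact
  fix \<eta> :: real assume \<eta>: "0 < \<eta>"
  have C: "0 \<le> C" using \<phi>(2)[of undefined] by linarith
  obtain F' M \<Phi> \<Psi> where *: "integrable lborel F'" "\<And>x. \<bar>F' x\<bar> \<le> M"
    "integrable lborel \<Phi>" "integrable lborel \<Psi>" "\<And>x. 0 \<le> \<Phi> x" "\<And>y. 0 \<le> \<Psi> y" "\<And>x y. \<bar>F x - F' x\<bar> * \<bar>G y\<bar> \<le> \<Phi> x + \<Psi> y"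
    "(LINT x|lborel. \<Phi> x) + (LINT y|lborel. \<Psi> y) \<le> \<eta> / (C + 1)"
    using pairableE[OF P, of "\<eta> / (C + 1)"] \<eta> C by (metis add_nonneg_pos divide_pos_pos zero_less_one)
  show "separated_error \<eta> (\<lambda>x. \<phi> x * F x) G"
    unfolding separated_error_def
  proof (rule exI[of _ "\<lambda>x. \<phi> x * F' x"], rule exI[of _ "C * M"], rule exI[of _ "\<lambda>x. C * \<Phi> x"],
      rule exI[of _ "\<lambda>x. C * \<Psi> x"], intro conjI allI)
    show "integrable lborel (\<lambda>x. \<phi> x * F' x)" using \<phi> * by (intro integrable_bounded_mult[of \<phi> _ C]) auto
    show "\<bar>\<phi> x * F' x\<bar> \<le> C * M" for x using \<phi>(2)[of x] *(2)[of x] C by (auto simp: abs_mult intro!: mult_mono)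
    show "\<bar>\<phi> x * F x - \<phi> x * F' x\<bar> * \<bar>G y\<bar> \<le> C * \<Phi> x + C * \<Psi> y" for x y
    proof -
      have "\<bar>\<phi> x * F x - \<phi> x * F' x\<bar> * \<bar>G y\<bar> = \<bar>\<phi> x\<bar> * (\<bar>F x - F' x\<bar> * \<bar>G y\<bar>)"
        by (simp add: right_diff_distrib[symmetric] abs_mult)
      also have "\<dots> \<le> C * (\<Phi> x + \<Psi> y)" using \<phi>(2)[of x] *(7)[of x y] C by (intro mult_mono) auto
      finally show ?thesis by (simp add: distrib_left)
    qed
    have "(LINT x|lborel. C * \<Phi> x) + (LINT y|lborel. C * \<Psi> y) = C * ((LINT x|lborel. \<Phi> x) + (LINT y|lborel. \<Psi> y))"
      by (simp add: distrib_left)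
    also have "\<dots> \<le> C * (\<eta> / (C + 1))" using *(8) C by (rule mult_left_mono)
    also have "\<dots> \<le> \<eta>" using C \<eta> by (simp add: field_simps)
    finally show "(LINT x|lborel. C * \<Phi> x) + (LINT y|lborel. C * \<Psi> y) \<le> \<eta>" .
  qed (use * C in auto)
qed

lemma pairable_conv_integrable:
  assumes \<rho>: "mollifier r \<rho>" and P: "pairable F G"
  shows "integrable lborel (\<lambda>x. F x * conv \<rho> G x)"
proof -
  have i: "integrable lborel F" "integrable lborel G" using P by (auto simp: pairable_def)
  obtain F' M \<Phi> \<Psi> where *: "integrable lborel F'" "\<And>x. \<bar>F' x\<bar> \<le> M"
    "integrable lborel \<Phi>" "integrable lborel \<Psi>" "\<And>y. 0 \<le> \<Psi> y" "\<And>x y. \<bar>F x - F' x\<bar> * \<bar>G y\<bar> \<le> \<Phi> x + \<Psi> y"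
    using pairableE[OF P, of 1] by (metis zero_less_one)
  have M: "0 \<le> M" using *(2)[of 0] by linarith
  have "integrable lborel (\<lambda>x. (F x - F' x) * conv \<rho> G x)"
    by (rule conv_pairing_bound(1)[OF \<rho> _ i(2) *(3,4,5,6)]) (use i * in auto)
  moreover have "integrable lborel (\<lambda>x. F' x * conv \<rho> G x)"
    by (rule conv_pairing_bound(1)[OF \<rho> _ i(2), of _ "\<lambda>x. 0" "\<lambda>y. M * \<bar>G y\<bar>"]) (use i * M in \<open>auto intro: mult_right_mono\<close>)
  ultimately have "integrable lborel (\<lambda>x. F' x * conv \<rho> G x + (F x - F' x) * conv \<rho> G x)" by auto
  then show ?thesis by (simp add: algebra_simps)
qed

text \<open>The bounded case, applied to \<open>F'\<close>; the separated majorant controls the error uniformly in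
the mollifier.\<close>

lemma tendsto_conv_pairing:
  fixes F G :: "'a::euclidean_space \<Rightarrow> real"
  assumes \<rho>: "\<And>n. mollifier (r n) (\<rho> n)" and r: "r \<longlonglongrightarrow> 0" and P: "pairable F G"
  shows "(\<lambda>n. LINT x|lborel. F x * conv (\<rho> n) G x) \<longlonglongrightarrow> (LINT x|lborel. F x * G x)"
proof (rule LIMSEQ_I)
  fix \<epsilon> :: real assume \<epsilon>: "0 < \<epsilon>"
  have i: "integrable lborel F" "integrable lborel G" using P by (auto simp: pairable_def)
  obtain F' M \<Phi> \<Psi> where *: "integrable lborel F'" "\<And>x. \<bar>F' x\<bar> \<le> M"
    "integrable lborel \<Phi>" "integrable lborel \<Psi>" "\<And>x. 0 \<le> \<Phi> x" "\<And>y. 0 \<le> \<Psi> y" "\<And>x y. \<bar>F x - F' x\<bar> * \<bar>G y\<bar> \<le> \<Phi> x + \<Psi> y"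
    "(LINT x|lborel. \<Phi> x) + (LINT y|lborel. \<Psi> y) \<le> \<epsilon> / 4"
    using pairableE[OF P, of "\<epsilon> / 4"] \<epsilon> by (metis divide_pos_pos zero_less_numeral)
  have P': "pairable F' G" unfolding pairable_def
  proof (intro conjI allI impI *(1) i(2))
    fix \<eta> :: real assume "0 < \<eta>"
    with *(1,2) show "separated_error \<eta> F' G"
      unfolding separated_error_def
      by (intro exI[of _ F'], intro exI[of _ M] exI[of _ "\<lambda>_. 0"]) auto
  qed
  have rm: "(\<lambda>x. F x - F' x) \<in> borel_measurable borel" "G \<in> borel_measurable borel" using i * by auto
  note rem = pairable_remainder_integrable[OF rm *(3,4,7)]
  note remc = conv_pairing_bound[OF \<rho> rm(1) i(2) *(3,4,6,7)]
  obtain N where N: "\<And>n. n \<ge> N \<Longrightarrow> \<bar>(LINT x|lborel. F' x * conv (\<rho> n) G x) - (LINT x|lborel. F' x * G x)\<bar> < \<epsilon> / 4"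
    using LIMSEQ_D[OF tendsto_conv_pairing_bounded[OF \<rho> r *(1,2) i(2)], of "\<epsilon> / 4"] \<epsilon> by auto
  show "\<exists>N. \<forall>n\<ge>N. norm ((LINT x|lborel. F x * conv (\<rho> n) G x) - (LINT x|lborel. F x * G x)) < \<epsilon>"
  proof (intro exI allI impI)
    fix n assume n: "N \<le> n"
    have "(LINT x|lborel. F x * conv (\<rho> n) G x) = (LINT x|lborel. F' x * conv (\<rho> n) G x + (F x - F' x) * conv (\<rho> n) G x)"
      by (simp add: algebra_simps)
    also have "\<dots> = (LINT x|lborel. F' x * conv (\<rho> n) G x) + (LINT x|lborel. (F x - F' x) * conv (\<rho> n) G x)"
      by (rule Bochner_Integration.integral_add[OF pairable_conv_integrable[OF \<rho> P'] remc(1)])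
    finally have 1: "(LINT x|lborel. F x * conv (\<rho> n) G x) = \<dots>" .
    have "(LINT x|lborel. F x * G x) = (LINT x|lborel. F' x * G x + (F x - F' x) * G x)"
      by (simp add: algebra_simps)
    also have "\<dots> = (LINT x|lborel. F' x * G x) + (LINT x|lborel. (F x - F' x) * G x)"
      by (rule Bochner_Integration.integral_add[OF pairable_integrable_mult[OF P'] rem(1)])
    finally have 2: "(LINT x|lborel. F x * G x) = \<dots>" .
    have arith: "\<bar>(a + b) - (c + d)\<bar> < \<epsilon>" if "\<bar>a - c\<bar> < \<epsilon> / 4" "\<bar>b\<bar> \<le> \<epsilon> / 4" "\<bar>d\<bar> \<le> \<epsilon> / 4" for a b c d
      using that \<epsilon> by linarith
    show "norm ((LINT x|lborel. F x * conv (\<rho> n) G x) - (LINT x|lborel. F x * G x)) < \<epsilon>"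
      unfolding 1 2 real_norm_def
      by (rule arith[OF N[OF n] order_trans[OF remc(2) *(8)] order_trans[OF rem(2) *(8)]])
  qed
qed

section \<open>Conjugate Lebesgue spaces and Borel representatives\<close>

lemma dual_exp_top: "dual_exp \<infinity> = 1"
  by (simp add: dual_exp_def)

lemma dual_exp_one: "dual_exp 1 = \<infinity>"
  by (simp add: dual_exp_def)

lemma dual_exp_real:
  assumes "1 < s"
  shows "dual_exp (ennreal s) = ennreal (s / (s - 1))"
proof -
  have "1 - inverse (ennreal s) = ennreal 1 - ennreal (inverse s)" using assms by (simp add: inverse_ennreal)
  also have "\<dots> = ennreal (1 - inverse s)" using assms by (subst ennreal_minus) auto
  finally have "dual_exp (ennreal s) = inverse (ennreal (1 - inverse s))" by (simp add: dual_exp_def)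
  also have "\<dots> = ennreal (inverse (1 - inverse s))" using assms by (intro inverse_ennreal) (simp add: field_simps)
  also have "inverse (1 - inverse s) = s / (s - 1)" using assms by (simp add: field_simps)
  finally show ?thesis .
qed

lemma ennreal_exponent_cases:
  assumes "1 \<le> (r::ennreal)"
  obtains "r = 1" | "r = \<infinity>" | s where "1 < s" "r = ennreal s"
proof (cases r)
  case (real s)
  have "1 \<le> s" using assms real by (simp add: ennreal_1[symmetric] del: ennreal_1)
  then show ?thesis using real that by (cases "s = 1") auto
qed (use that in auto)

lemma one_le_dual_exp:
  assumes "1 \<le> r"
  shows "1 \<le> dual_exp r"
  using assms
proof (cases rule: ennreal_exponent_cases)
  case (3 s)
  then show ?thesis by (simp add: dual_exp_real ennreal_1[symmetric] del: ennreal_1)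
qed (auto simp: dual_exp_one dual_exp_top[simplified])

lemma truncation_small:
  fixes h F :: "'a \<Rightarrow> real"
  assumes h: "integrable M h" and F: "F \<in> borel_measurable M" and \<eta>: "0 < \<eta>"
  shows "\<exists>m\<ge>0. (LINT x|M. \<bar>h x\<bar> * indicator {x. m < \<bar>F x\<bar>} x) \<le> \<eta>"
proof -
  note [measurable] = F
  have [measurable]: "h \<in> borel_measurable M" using h by auto
  have "(\<lambda>n. LINT x|M. \<bar>h x\<bar> * indicator {x. real n < \<bar>F x\<bar>} x) \<longlonglongrightarrow> (LINT x|M. 0)"
  proof (rule integral_dominated_convergence)
    show "integrable M (\<lambda>x. \<bar>h x\<bar>)" using h by auto
    show "AE x in M. (\<lambda>n. \<bar>h x\<bar> * indicator {x. real n < \<bar>F x\<bar>} x) \<longlonglongrightarrow> 0"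
    proof (rule AE_I2)
      fix x
      have "eventually (\<lambda>n. \<bar>F x\<bar> \<le> real n) sequentially"
        using filterlim_real_sequentially unfolding filterlim_at_top by blast
      then have "eventually (\<lambda>n. \<bar>h x\<bar> * indicator {x. real n < \<bar>F x\<bar>} x = 0) sequentially"
        by eventually_elim auto
      then show "(\<lambda>n. \<bar>h x\<bar> * indicator {x. real n < \<bar>F x\<bar>} x) \<longlonglongrightarrow> 0" by (rule tendsto_eventually)
    qed
    show "(\<lambda>x. \<bar>h x\<bar> * indicator {x. real n < \<bar>F x\<bar>} x) \<in> borel_measurable M" for n
      unfolding indicator_def by measurable
  qed (auto simp: indicator_def)
  then have "eventually (\<lambda>n. (LINT x|M. \<bar>h x\<bar> * indicator {x. real n < \<bar>F x\<bar>} x) < \<eta>) sequentially"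
    using \<eta> by (intro order_tendstoD(2)) auto
  then obtain n where "(LINT x|M. \<bar>h x\<bar> * indicator {x. real n < \<bar>F x\<bar>} x) < \<eta>"
    by (auto simp: eventually_sequentially)
  then show ?thesis by (intro exI[of _ "real n"]) auto
qed

text \<open>For the infinite exponent the bound is required at every point: the majorants above are evaluated
on the diagonal, and bounds off a null set in each variable would not control them there.\<close>

definition Lp_borel :: "ennreal \<Rightarrow> ('a::euclidean_space \<Rightarrow> real) \<Rightarrow> bool" where
  "Lp_borel r f \<longleftrightarrow> f \<in> borel_measurable borel \<and>
    (if r = \<infinity> then \<exists>C. \<forall>x. \<bar>f x\<bar> \<le> C else integrable lborel (\<lambda>x. \<bar>f x\<bar> powr enn2real r))"

lemma pairable_bounded_right:
  assumes F: "integrable lborel F" and G: "integrable lborel G" "\<And>x. \<bar>G x\<bar> \<le> C"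
  shows "pairable F G"
  unfolding pairable_def
proof (intro conjI allI impI F G(1))
  fix \<eta> :: real assume \<eta>: "0 < \<eta>"
  have C: "0 \<le> C" using G(2)[of undefined] by linarith
  have [measurable]: "F \<in> borel_measurable borel" using borel_measurable_integrable[OF F] by simp
  obtain m where m: "0 \<le> m" "(LINT x|lborel. \<bar>C * F x\<bar> * indicator {x. m < \<bar>F x\<bar>} x) \<le> \<eta>"
    using truncation_small[of lborel "\<lambda>x. C * F x" F \<eta>] F \<eta> by auto
  define F' where "F' x = (if \<bar>F x\<bar> \<le> m then F x else 0)" for x
  have [measurable]: "F' \<in> borel_measurable borel" unfolding F'_def by measurable
  have F'i: "integrable lborel F'"
    by (rule Bochner_Integration.integrable_bound[OF F]) (auto simp: F'_def)
  show "separated_error \<eta> F G"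
    unfolding separated_error_def
  proof (rule exI[of _ F'], rule exI[of _ m], rule exI[of _ "\<lambda>x. C * \<bar>F x - F' x\<bar>"],
      rule exI[of _ "\<lambda>_. 0"], intro conjI allI)
    show "\<bar>F' x\<bar> \<le> m" for x using m by (auto simp: F'_def)
    show "\<bar>F x - F' x\<bar> * \<bar>G y\<bar> \<le> C * \<bar>F x - F' x\<bar> + 0" for x y
      using mult_left_mono[OF G(2)[of y] abs_ge_zero[of "F x - F' x"]] by (simp add: mult.commute)
    have "(LINT x|lborel. C * \<bar>F x - F' x\<bar>) = (LINT x|lborel. \<bar>C * F x\<bar> * indicator {x. m < \<bar>F x\<bar>} x)"
      using C by (intro Bochner_Integration.integral_cong refl) (auto simp: F'_def abs_mult)
    then show "(LINT x|lborel. C * \<bar>F x - F' x\<bar>) + (LINT y::'a|lborel. 0) \<le> \<eta>" using m by simp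
  qed (use F F'i C in auto)
qed

lemma pairable_bounded_left:
  assumes F: "integrable lborel F" "\<And>x. \<bar>F x\<bar> \<le> C" and G: "integrable lborel G"
  shows "pairable F G"
  unfolding pairable_def
proof (intro conjI allI impI F(1) G)
  fix \<eta> :: real assume "0 < \<eta>"
  with F show "separated_error \<eta> F G"
    unfolding separated_error_def
    by (intro exI[of _ F], intro exI[of _ C] exI[of _ "\<lambda>_. 0"]) auto
qed

text \<open>By Young's inequality \<open>a * b = (t * a) * (b / t) \<le> (t * a)\<^sup>s + (b / t)\<^sup>s'\<close>. A large
\<open>t\<close> makes the part of \<open>G\<close> small; after that, truncating \<open>F\<close> at a high level makes the other part small.\<close>

lemma pairable_conjugate:
  assumes s: "1 < s" and F: "integrable lborel F" "integrable lborel (\<lambda>x. \<bar>F x\<bar> powr s)"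
    and G: "integrable lborel G" "integrable lborel (\<lambda>x. \<bar>G x\<bar> powr (s / (s - 1)))"
  shows "pairable F G"
  unfolding pairable_def
proof (intro conjI allI impI F(1) G(1))
  fix \<eta> :: real assume \<eta>: "0 < \<eta>"
  define s' where "s' = s / (s - 1)"
  have s': "1 < s'" "1 / s + 1 / s' = 1" using s by (auto simp: s'_def field_simps)
  have [measurable]: "F \<in> borel_measurable borel" "G \<in> borel_measurable borel"
    using borel_measurable_integrable[OF F(1)] borel_measurable_integrable[OF G(1)] by auto
  define J where "J = (LINT x|lborel. \<bar>G x\<bar> powr s')"
  have J: "0 \<le> J" by (auto simp: J_def)
  \<comment> \<open>Since \<open>t \<ge> 1\<close> and \<open>s' > 1\<close>, dividing by \<open>t\<close> instead of \<open>t powr s'\<close> only enlarges the bound.\<close>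
  define t where "t = max 1 (2 * J / \<eta>)"
  have t: "1 \<le> t" "J / t \<le> \<eta> / 2"
  proof -
    show "1 \<le> t" by (simp add: t_def)
    have "2 * J / \<eta> \<le> t" by (simp add: t_def)
    then show "J / t \<le> \<eta> / 2" using \<eta> \<open>1 \<le> t\<close> by (simp add: field_simps)
  qed
  obtain m where m: "0 \<le> m" "(LINT x|lborel. \<bar>t powr s * \<bar>F x\<bar> powr s\<bar> * indicator {x. m < \<bar>F x\<bar>} x) \<le> \<eta> / 2"
    using truncation_small[of lborel "\<lambda>x. t powr s * \<bar>F x\<bar> powr s" F "\<eta>/2"] F \<eta> by auto
  define F' where "F' x = (if \<bar>F x\<bar> \<le> m then F x else 0)" for x
  have [measurable]: "F' \<in> borel_measurable borel" unfolding F'_def by measurable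
  have F'i: "integrable lborel F'"
    by (rule Bochner_Integration.integrable_bound[OF F(1)]) (auto simp: F'_def)
  have Fd: "integrable lborel (\<lambda>x. t powr s * \<bar>F x - F' x\<bar> powr s)"
    by (rule Bochner_Integration.integrable_bound[of _ "\<lambda>x. t powr s * \<bar>F x\<bar> powr s"])
       (use F t in \<open>auto simp: F'_def\<close>)
  show "separated_error \<eta> F G"
    unfolding separated_error_def
  proof (rule exI[of _ F'], rule exI[of _ m], rule exI[of _ "\<lambda>x. t powr s * \<bar>F x - F' x\<bar> powr s"],
      rule exI[of _ "\<lambda>y. \<bar>G y\<bar> powr s' / t"], intro conjI allI)
    show "\<bar>F' x\<bar> \<le> m" for x using m by (auto simp: F'_def)
    show "\<bar>F x - F' x\<bar> * \<bar>G y\<bar> \<le> t powr s * \<bar>F x - F' x\<bar> powr s + \<bar>G y\<bar> powr s' / t" for x y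
    proof -
      define a b where "a = \<bar>F x - F' x\<bar>" and "b = \<bar>G y\<bar>"
      have ab: "0 \<le> a" "0 \<le> b" by (auto simp: a_def b_def)
      have "a * b = (t * a) * (b / t)" using t by simp
      also have "\<dots> \<le> (t * a) powr s / s + (b / t) powr s' / s'"
        using s s' ab t by (intro Youngs_inequality) auto
      also have "\<dots> \<le> (t * a) powr s + (b / t) powr s'"
      proof -
        have "x / r \<le> x" if "0 \<le> x" "1 < r" for x r :: real
          using that mult_left_mono[of 1 r x] by (simp add: divide_le_eq)
        from this[OF powr_ge_zero s] this[OF powr_ge_zero s'(1)] show ?thesis by (rule add_mono)
      qed
      also have "(t * a) powr s = t powr s * a powr s" using ab t by (simp add: powr_mult)
      also have "(b / t) powr s' = b powr s' / t powr s'" using ab t by (simp add: powr_divide)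
      also have "\<dots> \<le> b powr s' / t powr 1"
        using t s' by (intro divide_left_mono powr_mono) auto
      finally show ?thesis using t by (simp add: a_def b_def)
    qed
    have "(LINT x|lborel. t powr s * \<bar>F x - F' x\<bar> powr s) =
        (LINT x|lborel. \<bar>t powr s * \<bar>F x\<bar> powr s\<bar> * indicator {x. m < \<bar>F x\<bar>} x)"
      by (intro Bochner_Integration.integral_cong refl) (auto simp: F'_def)
    then have "(LINT x|lborel. t powr s * \<bar>F x - F' x\<bar> powr s) \<le> \<eta> / 2" using m by simp
    moreover have "(LINT x|lborel. \<bar>G x\<bar> powr s' / t) = J / t" by (simp add: J_def)
    ultimately show "(LINT x|lborel. t powr s * \<bar>F x - F' x\<bar> powr s) + (LINT y|lborel. \<bar>G y\<bar> powr s' / t) \<le> \<eta>"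
      using t(2) by linarith
  qed (use F'i Fd G t in \<open>auto simp: s'_def\<close>)
qed

lemma pairable_Lp:
  assumes r: "1 \<le> r" and F: "Lp_borel r F" "integrable lborel F"
    and G: "Lp_borel (dual_exp r) G" "integrable lborel G"
  shows "pairable F G"
  using r
proof (cases rule: ennreal_exponent_cases)
  case 1
  then obtain C where "\<And>x. \<bar>G x\<bar> \<le> C" using G by (auto simp: Lp_borel_def dual_exp_one)
  then show ?thesis using pairable_bounded_right F G by blast
next
  case 2
  then obtain C where "\<And>x. \<bar>F x\<bar> \<le> C" using F by (auto simp: Lp_borel_def)
  then show ?thesis using pairable_bounded_left F G by blast
next
  case (3 s)
  then have "0 \<le> s / (s - 1)" by simp
  then show ?thesis using F G 3
    by (intro pairable_conjugate[of s]) (auto simp: Lp_borel_def dual_exp_real)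
qed

lemma Lp_borel_mono:
  assumes f: "Lp_borel r f" and supp: "\<And>x. x \<notin> \<Omega> \<Longrightarrow> f x = 0" and \<Omega>: "\<Omega> \<in> sets borel" "bounded \<Omega>"
    and s: "1 \<le> s" "s \<le> r"
  shows "Lp_borel s f"
proof (cases "s = \<infinity>")
  case True
  then show ?thesis using assms by (simp add: top_unique)
next
  case s_fin: False
  have [measurable]: "f \<in> borel_measurable borel" "\<Omega> \<in> sets borel" using f \<Omega> by (auto simp: Lp_borel_def)
  have i1: "integrable lborel (indicator \<Omega> :: 'a \<Rightarrow> real)"
    using \<Omega> emeasure_bounded_finite[OF \<Omega>(2)] by (auto simp: less_top[symmetric])
  have s1: "1 \<le> enn2real s" using s_fin s(1) by (cases s) (auto simp: ennreal_1[symmetric] simp del: ennreal_1)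
  have "integrable lborel (\<lambda>x. \<bar>f x\<bar> powr enn2real s)"
  proof (cases "r = \<infinity>")
    case True
    then obtain C where C: "\<And>x. \<bar>f x\<bar> \<le> C" using f by (auto simp: Lp_borel_def)
    show ?thesis
    proof (rule Bochner_Integration.integrable_bound)
      show "integrable lborel (\<lambda>x. C powr enn2real s * indicator \<Omega> x)" using i1 by auto
      show "AE x in lborel. norm (\<bar>f x\<bar> powr enn2real s) \<le> norm (C powr enn2real s * indicator \<Omega> x)"
        using C supp s1 by (intro AE_I2) (auto simp: indicator_def intro!: powr_mono2)
    qed measurable
  next
    case False
    have le: "enn2real s \<le> enn2real r" using s False by (intro enn2real_mono) (auto simp: less_top)
    show ?thesis
    proof (rule Bochner_Integration.integrable_bound)
      show "integrable lborel (\<lambda>x. \<bar>f x\<bar> powr enn2real r + indicator \<Omega> x)" using f False i1 by (auto simp: Lp_borel_def)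
      have "\<bar>f x\<bar> powr enn2real s \<le> \<bar>f x\<bar> powr enn2real r + indicator \<Omega> x" for x
      proof (cases "\<bar>f x\<bar> \<le> 1")
        case True
        then have "\<bar>f x\<bar> powr enn2real s \<le> 1" using s1 by (intro powr_le1) auto
        then show ?thesis using supp[of x] by (cases "x \<in> \<Omega>") (auto simp: add_increasing)
      next
        case False
        then have "\<bar>f x\<bar> powr enn2real s \<le> \<bar>f x\<bar> powr enn2real r" using le by (intro powr_mono) auto
        then show ?thesis by (simp add: add_increasing2)
      qed
      then show "AE x in lborel. norm (\<bar>f x\<bar> powr enn2real s) \<le> norm (\<bar>f x\<bar> powr enn2real r + indicator \<Omega> x)"
        by (intro AE_I2) (auto simp: abs_of_nonneg)
    qed measurable
  qed
  then show ?thesis using s_fin by (simp add: Lp_borel_def)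
qed

lemma Lp_borel_integrable:
  assumes "Lp_borel r f" "\<And>x. x \<notin> \<Omega> \<Longrightarrow> f x = 0" "\<Omega> \<in> sets borel" "bounded \<Omega>" "1 \<le> r"
  shows "integrable lborel f"
proof -
  have 1: "Lp_borel 1 f" by (rule Lp_borel_mono[OF assms(1-4)]) (use assms in auto)
  then have "integrable lborel (\<lambda>x. \<bar>f x\<bar>)" by (simp add: Lp_borel_def)
  then show ?thesis using 1 by (subst (asm) integrable_abs_iff) (auto simp: Lp_borel_def)
qed

lemma AE_lebesgue_on_iff:
  assumes "\<Omega> \<in> sets borel"
  shows "(AE x in lebesgue_on \<Omega>. P x) \<longleftrightarrow> (AE x in lborel. x \<in> \<Omega> \<longrightarrow> P x)"
  using assms by (subst AE_restrict_space_iff) (auto simp: AE_completion_iff)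

lemma integral_lebesgue_on_eq_lborel:
  fixes g :: "'a::euclidean_space \<Rightarrow> 'b::euclidean_space"
  assumes \<Omega>: "\<Omega> \<in> sets borel" and g: "g \<in> borel_measurable (lebesgue_on \<Omega>)" and g': "g' \<in> borel_measurable borel"
    and eq: "AE x in lborel. x \<in> \<Omega> \<longrightarrow> g x = g' x" and supp: "\<And>x. x \<notin> \<Omega> \<Longrightarrow> g' x = 0"
  shows "(LINT x|lebesgue_on \<Omega>. g x) = (LINT x|lborel. g' x)"
    and "integrable (lebesgue_on \<Omega>) g \<longleftrightarrow> integrable lborel g'"
proof -
  have g'l: "g' \<in> borel_measurable (lebesgue_on \<Omega>)"
    using g' by (intro measurable_restrict_space1 measurable_completion) auto
  have AE: "AE x in lebesgue_on \<Omega>. g x = g' x" using eq by (simp add: AE_lebesgue_on_iff[OF \<Omega>])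
  have ind: "indicator \<Omega> x *\<^sub>R g' x = g' x" for x using supp by (auto simp: indicator_def)
  have "(LINT x|lebesgue_on \<Omega>. g x) = (LINT x|lebesgue_on \<Omega>. g' x)"
    by (rule integral_cong_AE[OF g g'l AE])
  also have "\<dots> = (LINT x|lebesgue. g' x)"
    using \<Omega> by (subst integral_restrict_space) (auto simp: ind)
  also have "\<dots> = (LINT x|lborel. g' x)" using g' by (intro integral_completion) auto
  finally show "(LINT x|lebesgue_on \<Omega>. g x) = (LINT x|lborel. g' x)" .
  have "integrable (lebesgue_on \<Omega>) g \<longleftrightarrow> integrable (lebesgue_on \<Omega>) g'"
    by (rule integrable_cong_AE[OF g g'l AE])
  also have "\<dots> \<longleftrightarrow> integrable lebesgue g'"
    using \<Omega> by (subst integrable_restrict_space) (auto simp: ind)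
  also have "\<dots> \<longleftrightarrow> integrable lborel g'" using g' by (intro integrable_completion) auto
  finally show "integrable (lebesgue_on \<Omega>) g \<longleftrightarrow> integrable lborel g'" .
qed

text \<open>Tonelli's theorem for the convolutions needs Borel functions on the whole space, while the
data are Lebesgue measurable functions on \<open>\<Omega>\<close>.\<close>

lemma in_Lp_borel_representative:
  fixes f :: "'a::euclidean_space \<Rightarrow> real"
  assumes \<Omega>: "\<Omega> \<in> sets borel" and f: "in_Lp r \<Omega> f" and r: "1 \<le> r"
  shows "\<exists>f'. Lp_borel r f' \<and> (\<forall>x. x \<notin> \<Omega> \<longrightarrow> f' x = 0) \<and> (AE x in lborel. x \<in> \<Omega> \<longrightarrow> f x = f' x)"
proof -
  have fm: "f \<in> borel_measurable (lebesgue_on \<Omega>)" using f by (simp add: in_Lp_def)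
  then have "(\<lambda>x. if x \<in> \<Omega> then f x else 0) \<in> borel_measurable lebesgue"
    using \<Omega> by (subst borel_measurable_if) auto
  then obtain h where h[measurable]: "h \<in> borel_measurable lborel" and
    ae: "AE x in lborel. (if x \<in> \<Omega> then f x else 0) = h x"
    using completion_ex_borel_measurable_real by blast
  note [measurable] = \<Omega>
  show ?thesis
  proof (cases "r = \<infinity>")
    case True
    define C where "C = enn2real (esssup (lebesgue_on \<Omega>) (\<lambda>x. ennreal (norm (f x))))"
    have fin: "esssup (lebesgue_on \<Omega>) (\<lambda>x. ennreal (norm (f x))) < \<infinity>" using f True by (simp add: in_Lp_def)
    have "AE x in lebesgue_on \<Omega>. ennreal (norm (f x)) \<le> ennreal C"
      using esssup_AE[of "\<lambda>x. ennreal (norm (f x))" "lebesgue_on \<Omega>"] fin by (simp add: C_def)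
    then have "AE x in lborel. x \<in> \<Omega> \<longrightarrow> \<bar>f x\<bar> \<le> C"
      by (simp add: AE_lebesgue_on_iff[OF \<Omega>] C_def)
    then have ae2: "AE x in lborel. x \<in> \<Omega> \<longrightarrow> f x = (if x \<in> \<Omega> \<and> \<bar>h x\<bar> \<le> C then h x else 0)"
      using ae by eventually_elim auto
    have "0 \<le> C" by (simp add: C_def)
    then have "\<bar>if x \<in> \<Omega> \<and> \<bar>h x\<bar> \<le> C then h x else 0\<bar> \<le> C" for x by auto
    moreover have "(\<lambda>x. if x \<in> \<Omega> \<and> \<bar>h x\<bar> \<le> C then h x else 0) \<in> borel_measurable borel" by measurable
    ultimately have "Lp_borel r (\<lambda>x. if x \<in> \<Omega> \<and> \<bar>h x\<bar> \<le> C then h x else 0)"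
      unfolding Lp_borel_def if_P[OF True] by blast
    then show ?thesis using ae2
      by (intro exI[of _ "\<lambda>x. if x \<in> \<Omega> \<and> \<bar>h x\<bar> \<le> C then h x else 0"]) auto
  next
    case False
    define f' where "f' x = (if x \<in> \<Omega> then h x else 0)" for x
    have f'm[measurable]: "f' \<in> borel_measurable borel" unfolding f'_def by measurable
    have ae2: "AE x in lborel. x \<in> \<Omega> \<longrightarrow> f x = f' x" using ae by eventually_elim (auto simp: f'_def)
    have "integrable (lebesgue_on \<Omega>) (\<lambda>x. norm (f x) powr enn2real r)" using f False by (simp add: in_Lp_def)
    moreover have "integrable (lebesgue_on \<Omega>) (\<lambda>x. norm (f x) powr enn2real r) \<longleftrightarrow> integrable lborel (\<lambda>x. \<bar>f' x\<bar> powr enn2real r)"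
    proof (rule integral_lebesgue_on_eq_lborel(2)[OF \<Omega>])
      show "AE x in lborel. x \<in> \<Omega> \<longrightarrow> norm (f x) powr enn2real r = \<bar>f' x\<bar> powr enn2real r"
        using ae2 by eventually_elim auto
    qed (use fm in \<open>auto simp: f'_def[of _]\<close>)
    ultimately show ?thesis using ae2 False by (intro exI[of _ f']) (auto simp: Lp_borel_def f'_def)
  qed
qed

text \<open>Young's inequality for the two functions divided by their norms.\<close>

lemma Holder_integral:
  fixes f g :: "'a \<Rightarrow> real"
  assumes s: "1 < s" and s': "s' = s / (s - 1)" and m: "f \<in> borel_measurable M" "g \<in> borel_measurable M"
    and f: "integrable M (\<lambda>x. \<bar>f x\<bar> powr s')" and g: "integrable M (\<lambda>x. \<bar>g x\<bar> powr s)"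
  shows "integrable M (\<lambda>x. \<bar>f x\<bar> * \<bar>g x\<bar>)"
    and "(LINT x|M. \<bar>f x\<bar> * \<bar>g x\<bar>) \<le> (LINT x|M. \<bar>f x\<bar> powr s') powr (1 / s') * (LINT x|M. \<bar>g x\<bar> powr s) powr (1 / s)"
proof -
  have c: "1 < s'" "1 / s' + 1 / s = 1" using s by (auto simp: s' field_simps)
  note [measurable] = m
  have young: "a * b \<le> a powr s' / s' + b powr s / s" if "0 \<le> a" "0 \<le> b" for a b
    using that s c by (intro Youngs_inequality) auto
  show int: "integrable M (\<lambda>x. \<bar>f x\<bar> * \<bar>g x\<bar>)"
  proof (rule Bochner_Integration.integrable_bound)
    show "integrable M (\<lambda>x. \<bar>f x\<bar> powr s' / s' + \<bar>g x\<bar> powr s / s)" using f g by auto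
    show "AE x in M. norm (\<bar>f x\<bar> * \<bar>g x\<bar>) \<le> norm (\<bar>f x\<bar> powr s' / s' + \<bar>g x\<bar> powr s / s)"
    proof (rule AE_I2)
      fix x show "norm (\<bar>f x\<bar> * \<bar>g x\<bar>) \<le> norm (\<bar>f x\<bar> powr s' / s' + \<bar>g x\<bar> powr s / s)"
        using young[of "\<bar>f x\<bar>" "\<bar>g x\<bar>"] by (simp add: abs_mult)
    qed
  qed measurable
  define I J where "I = (LINT x|M. \<bar>f x\<bar> powr s')" and "J = (LINT x|M. \<bar>g x\<bar> powr s)"
  define A B where "A = I powr (1 / s')" and "B = J powr (1 / s)"
  have nn: "0 \<le> I" "0 \<le> J" "0 \<le> A" "0 \<le> B" by (auto simp: I_def J_def A_def B_def)
  have "(LINT x|M. \<bar>f x\<bar> * \<bar>g x\<bar>) \<le> A * B"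
  proof (cases "I = 0 \<or> J = 0")
    case True
    have "AE x in M. \<bar>f x\<bar> * \<bar>g x\<bar> = 0"
    proof (cases "I = 0")
      case True
      then have "AE x in M. \<bar>f x\<bar> powr s' = 0"
        unfolding I_def using integral_nonneg_eq_0_iff_AE[OF f] by auto
      then show ?thesis by eventually_elim auto
    next
      case False
      then have "AE x in M. \<bar>g x\<bar> powr s = 0"
        using True unfolding J_def using integral_nonneg_eq_0_iff_AE[OF g] by auto
      then show ?thesis by eventually_elim auto
    qed
    then have "(LINT x|M. \<bar>f x\<bar> * \<bar>g x\<bar>) = 0" by (intro integral_eq_zero_AE) auto
    then show ?thesis using nn by simp
  next
    case False
    then have pos: "0 < A" "0 < B" using nn by (auto simp: A_def B_def)
    have Ap: "A powr s' = I" "B powr s = J" using nn c s by (auto simp: A_def B_def powr_powr)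
    have IJ: "I > 0" "J > 0" using False nn by auto
    have "(LINT x|M. \<bar>f x\<bar> * \<bar>g x\<bar>) \<le> (LINT x|M. A * B * (\<bar>f x\<bar> powr s' / (I * s') + \<bar>g x\<bar> powr s / (J * s)))"
    proof (rule integral_mono[OF int])
      show "integrable M (\<lambda>x. A * B * (\<bar>f x\<bar> powr s' / (I * s') + \<bar>g x\<bar> powr s / (J * s)))" using f g by auto
      show "\<bar>f x\<bar> * \<bar>g x\<bar> \<le> A * B * (\<bar>f x\<bar> powr s' / (I * s') + \<bar>g x\<bar> powr s / (J * s))" for x
      proof -
        have "\<bar>f x\<bar> * \<bar>g x\<bar> = A * B * ((\<bar>f x\<bar> / A) * (\<bar>g x\<bar> / B))" using pos by simp
        also have "\<dots> \<le> A * B * ((\<bar>f x\<bar> / A) powr s' / s' + (\<bar>g x\<bar> / B) powr s / s)"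
          using pos by (intro mult_left_mono young) auto
        also have "\<dots> = A * B * (\<bar>f x\<bar> powr s' / (I * s') + \<bar>g x\<bar> powr s / (J * s))"
          using pos by (simp add: powr_divide Ap)
        finally show ?thesis .
      qed
    qed
    also have "\<dots> = A * B * (I / (I * s') + J / (J * s))"
      using f g by (simp add: I_def J_def)
    also have "\<dots> = A * B * (1 / s' + 1 / s)" using IJ by simp
    also have "\<dots> = A * B" using c by simp
    finally show ?thesis .
  qed
  then show "(LINT x|M. \<bar>f x\<bar> * \<bar>g x\<bar>) \<le> (LINT x|M. \<bar>f x\<bar> powr s') powr (1 / s') * (LINT x|M. \<bar>g x\<bar> powr s) powr (1 / s)"
    by (simp add: A_def B_def I_def J_def)
qed

lemma in_Lp_inner_Basis:
  assumes f: "in_Lp r \<Omega> f" and c: "c \<in> Basis" and r: "1 \<le> r"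
  shows "in_Lp r \<Omega> (\<lambda>x. f x \<bullet> c)"
proof -
  have fm[measurable]: "f \<in> borel_measurable (lebesgue_on \<Omega>)" using f by (simp add: in_Lp_def)
  have m: "(\<lambda>x. f x \<bullet> c) \<in> borel_measurable (lebesgue_on \<Omega>)" by measurable
  have le: "norm (f x \<bullet> c) \<le> norm (f x)" for x using Basis_le_norm[OF c] by simp
  show ?thesis
  proof (cases "r = \<infinity>")
    case True
    have "esssup (lebesgue_on \<Omega>) (\<lambda>x. ennreal (norm (f x \<bullet> c))) \<le> esssup (lebesgue_on \<Omega>) (\<lambda>x. ennreal (norm (f x)))"
      by (rule esssup_mono) (use m le in \<open>auto intro: ennreal_leI\<close>)
    also have "\<dots> < \<infinity>" using f True by (simp add: in_Lp_def)
    finally show ?thesis using True m by (simp add: in_Lp_def)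
  next
    case False
    have "integrable (lebesgue_on \<Omega>) (\<lambda>x. norm (f x \<bullet> c) powr enn2real r)"
    proof (rule Bochner_Integration.integrable_bound)
      show "integrable (lebesgue_on \<Omega>) (\<lambda>x. norm (f x) powr enn2real r)" using f False by (simp add: in_Lp_def)
      show "AE x in lebesgue_on \<Omega>. norm (norm (f x \<bullet> c) powr enn2real r) \<le> norm (norm (f x) powr enn2real r)"
        using le by (intro AE_I2) (auto intro!: powr_mono2)
    qed (use m in measurable)
    then show ?thesis using False m by (simp add: in_Lp_def)
  qed
qed

lemma lborel_to_lebesgue_on_measurable:
  "h \<in> borel_measurable borel \<Longrightarrow> h \<in> borel_measurable (lebesgue_on \<Omega>)"
  by (intro measurable_restrict_space1 measurable_completion) auto

lemma Lp_norm_real: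
  "0 \<le> s \<Longrightarrow> Lp_norm (ennreal s) \<Omega> f = ennreal ((LINT x|lebesgue_on \<Omega>. norm (f x) powr s) powr (1 / s))"
  by (simp add: Lp_norm_def)

lemma Holder_set_integral:
  fixes v w :: "'a::euclidean_space \<Rightarrow> 'b::euclidean_space"
  assumes s: "1 < s" and v: "in_Lp (dual_exp (ennreal s)) \<Omega> v" and w: "in_Lp (ennreal s) \<Omega> w"
    and B: "B \<in> sets borel"
  shows "ennreal \<bar>LINT x|lebesgue_on \<Omega>. indicator B x * (v x \<bullet> w x)\<bar> \<le>
      Lp_norm (dual_exp (ennreal s)) \<Omega> v * Lp_norm (ennreal s) \<Omega> w"
proof -
  define s' where "s' = s / (s - 1)"
  have s': "1 < s'" using s by (simp add: s'_def)
  have dual: "dual_exp (ennreal s) = ennreal s'" using dual_exp_real[OF s] by (simp add: s'_def)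
  have vw[measurable]: "v \<in> borel_measurable (lebesgue_on \<Omega>)" "w \<in> borel_measurable (lebesgue_on \<Omega>)"
    using v w by (auto simp: in_Lp_def)
  have ind[measurable]: "(indicator B :: 'a \<Rightarrow> real) \<in> borel_measurable (lebesgue_on \<Omega>)"
    using B by (intro lborel_to_lebesgue_on_measurable) auto
  have iv: "integrable (lebesgue_on \<Omega>) (\<lambda>x. \<bar>norm (v x)\<bar> powr s')"
    and iw: "integrable (lebesgue_on \<Omega>) (\<lambda>x. \<bar>norm (w x)\<bar> powr s)"
    using v w s s' by (auto simp: in_Lp_def dual)
  note H = Holder_integral[OF s s'_def _ _ iv iw]
  have le: "\<bar>indicator B x * (v x \<bullet> w x)\<bar> \<le> \<bar>norm (v x)\<bar> * \<bar>norm (w x)\<bar>" for x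
    using Cauchy_Schwarz_ineq2[of "v x" "w x"] by (auto simp: indicator_def abs_mult)
  have int: "integrable (lebesgue_on \<Omega>) (\<lambda>x. indicator B x * (v x \<bullet> w x))"
    by (rule Bochner_Integration.integrable_bound[OF H(1)]) (use le in auto)
  have "\<bar>LINT x|lebesgue_on \<Omega>. indicator B x * (v x \<bullet> w x)\<bar> \<le> (LINT x|lebesgue_on \<Omega>. \<bar>indicator B x * (v x \<bullet> w x)\<bar>)"
    by (rule integral_abs_bound)
  also have "\<dots> \<le> (LINT x|lebesgue_on \<Omega>. \<bar>norm (v x)\<bar> * \<bar>norm (w x)\<bar>)"
    using int H(1) le by (intro integral_mono) auto
  also note H(2)
  finally show "ennreal \<bar>LINT x|lebesgue_on \<Omega>. indicator B x * (v x \<bullet> w x)\<bar> \<le>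
      Lp_norm (dual_exp (ennreal s)) \<Omega> v * Lp_norm (ennreal s) \<Omega> w"
    using s s' by (simp add: dual Lp_norm_real ennreal_mult[symmetric] ennreal_leI)
qed

section \<open>Passing to the limit in the mollified field\<close>

lemma test_functionsD:
  assumes "\<phi> \<in> test_functions \<Omega>"
  obtains K where "smooth \<phi>" "compact K" "K \<subseteq> \<Omega>" "{x. \<phi> x \<noteq> 0} \<subseteq> K"
proof
  show "smooth \<phi>" "compact (closure {x. \<phi> x \<noteq> 0})" "closure {x. \<phi> x \<noteq> 0} \<subseteq> \<Omega>"
    using assms by (auto simp: test_functions_def smooth_def)
  show "{x. \<phi> x \<noteq> 0} \<subseteq> closure {x. \<phi> x \<noteq> 0}" by (rule closure_subset)
qed

lemma test_functionsI:
  assumes "smooth \<phi>" "compact K" "K \<subseteq> \<Omega>" "{x. \<phi> x \<noteq> 0} \<subseteq> K"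
  shows "\<phi> \<in> test_functions \<Omega>"
proof -
  have "closure {x. \<phi> x \<noteq> 0} \<subseteq> K"
    using assms by (intro closure_minimal compact_imp_closed) auto
  moreover from this have "compact (closure {x. \<phi> x \<noteq> 0})"
    using assms(2) by (meson bounded_subset closed_closure compact_eq_bounded_closed)
  ultimately show ?thesis
    using assms unfolding test_functions_def smooth_def by auto
qed

lemma compact_support_bounded:
  fixes f :: "'a::euclidean_space \<Rightarrow> real"
  assumes f: "smooth f" and K: "compact K" "{x. f x \<noteq> 0} \<subseteq> K"
  shows "f \<in> borel_measurable borel" "\<exists>C. \<forall>x. \<bar>f x\<bar> \<le> C"
    "b \<in> Basis \<Longrightarrow> partial b f \<in> borel_measurable borel" "b \<in> Basis \<Longrightarrow> \<exists>C. \<forall>x. \<bar>partial b f x\<bar> \<le> C"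
proof -
  obtain R where "\<forall>x\<in>K. norm x \<le> R" using compact_imp_bounded[OF K(1)] by (auto simp: bounded_iff)
  then have R: "f x = 0" if "R < norm x" for x using K(2) that by force
  show "f \<in> borel_measurable borel"
    using smooth_continuous[OF f] by (rule borel_measurable_continuous_onI)
  show "\<exists>C. \<forall>x. \<bar>f x\<bar> \<le> C" by (rule bounded_of_bounded_support[OF smooth_continuous[OF f] R])
  show "partial b f \<in> borel_measurable borel" if "b \<in> Basis"
    using smooth_continuous[OF smooth_partial[OF f that]] by (rule borel_measurable_continuous_onI)
  show "\<exists>C. \<forall>x. \<bar>partial b f x\<bar> \<le> C" if "b \<in> Basis"
    by (rule bounded_of_bounded_support[OF smooth_continuous[OF smooth_partial[OF f that]] partial_bounded_support[OF R]])
qed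

text \<open>\<open>U\<close>, \<open>D\<close>, \<open>Z c\<close> and \<open>G c\<close> represent \<open>u\<close>, the divergence of \<open>z\<close>, the
component of \<open>z\<close> in direction \<open>c\<close>, and the weak derivative of \<open>u\<close> in direction \<open>c\<close>, extended by zero. In the
directions in \<open>S\<close> the derivative of \<open>u\<close> is only a measure, with density \<open>f c\<close> with respect to \<open>M\<close>. The
number \<open>C\<close> bounds the part of the field in these directions.\<close>

locale mollified_pairing =
  fixes \<Omega> :: "'a::euclidean_space set" and S :: "'a set"
    and U D :: "'a \<Rightarrow> real" and Z G :: "'a \<Rightarrow> 'a \<Rightarrow> real"
    and M :: "'a measure" and f :: "'a \<Rightarrow> 'a \<Rightarrow> real" and C :: real
  assumes \<Omega>: "open \<Omega>" and S: "S \<subseteq> Basis"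
    and UD: "pairable U D" and UZ: "\<And>c. c \<in> Basis \<Longrightarrow> pairable U (Z c)"
    and GZ: "\<And>c. c \<in> Basis - S \<Longrightarrow> pairable (G c) (Z c)"
    and weak_divergence: "\<And>\<phi>. \<phi> \<in> test_functions \<Omega> \<Longrightarrow>
      (\<Sum>c\<in>Basis. LINT x|lborel. Z c x * partial c \<phi> x) = - (LINT x|lborel. D x * \<phi> x)"
    and M: "finite_measure M" "sets M = borel_subsets \<Omega>"
    and f: "\<And>c. c \<in> S \<Longrightarrow> integrable M (f c)"
    and deriv_measure: "\<And>c \<phi>. c \<in> S \<Longrightarrow> \<phi> \<in> test_functions \<Omega> \<Longrightarrow>
      (LINT x|lborel. U x * partial c \<phi> x) = - (LINT x|M. \<phi> x * f c x)"
    and deriv_function: "\<And>c \<phi>. c \<in> Basis - S \<Longrightarrow> \<phi> \<in> test_functions \<Omega> \<Longrightarrow>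
      (LINT x|lborel. U x * partial c \<phi> x) = - (LINT x|lborel. G c x * \<phi> x)"
    and Z_bound: "AE x in lborel. norm (\<Sum>c\<in>S. Z c x *\<^sub>R c) \<le> C"
begin

lemma integrable_data:
  "integrable lborel U" "c \<in> Basis \<Longrightarrow> integrable lborel (Z c)"
  using UD UZ by (auto simp: pairable_def)

lemma borel_imp_measurable_M: "h \<in> borel_measurable borel \<Longrightarrow> h \<in> borel_measurable M"
proof -
  assume h: "h \<in> borel_measurable borel"
  have "\<Omega> \<in> sets borel" using \<Omega> by auto
  then have s: "sets M = sets (restrict_space borel \<Omega>)" using M(2) borel_subsets_eq_restrict by simp
  show ?thesis unfolding measurable_cong_sets[OF s refl] using h by (rule measurable_restrict_space1)
qed

text \<open>Test the weak divergence against \<open>\<lambda>y. \<rho> (x - y)\<close>; this needs the ball of radius \<open>r\<close>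
around \<open>x\<close> to lie in \<open>\<Omega>\<close>.\<close>

lemma divergence_conv:
  assumes \<rho>: "mollifier r \<rho>" and x: "cball x r \<subseteq> \<Omega>"
  shows "(\<Sum>c\<in>Basis. conv (partial c \<rho>) (Z c) x) = conv \<rho> D x"
proof -
  note rho = mollifierD[OF \<rho>]
  have "{y. \<rho> (x - y) \<noteq> 0} \<subseteq> cball x r"
    using rho(3) by (auto simp: dist_norm) (meson not_le)
  then have "(\<lambda>y. \<rho> (x - y)) \<in> test_functions \<Omega>"
    by (intro test_functionsI[OF smooth_reflect(1)[OF rho(1)] compact_cball x])
  from weak_divergence[OF this]
  have "(\<Sum>c\<in>Basis. LINT y|lborel. Z c y * (- partial c \<rho> (x - y))) = - (LINT y|lborel. D y * \<rho> (x - y))"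
    by (simp add: smooth_reflect(2)[OF rho(1)] cong: sum.cong)
  then show ?thesis by (simp add: conv_def sum_negf mult.commute)
qed

lemma norm_conv_le:
  assumes \<rho>: "mollifier r \<rho>"
  shows "norm (\<Sum>c\<in>S. conv \<rho> (Z c) x *\<^sub>R c) \<le> C"
proof -
  note rho = mollifierD[OF \<rho>]
  have i: "integrable lborel (\<lambda>y. (\<rho> (x - y) * Z c y) *\<^sub>R c)" if "c \<in> S" for c
    using conv_integrable_mollifier[OF \<rho> integrable_data(2)] that S by auto
  have "(\<Sum>c\<in>S. conv \<rho> (Z c) x *\<^sub>R c) = (\<Sum>c\<in>S. LINT y|lborel. (\<rho> (x - y) * Z c y) *\<^sub>R c)"
    using conv_integrable_mollifier[OF \<rho> integrable_data(2)] S unfolding conv_def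
    by (intro sum.cong refl integral_scaleR_left[symmetric]) auto
  also have "\<dots> = (LINT y|lborel. (\<Sum>c\<in>S. (\<rho> (x - y) * Z c y) *\<^sub>R c))"
    by (rule Bochner_Integration.integral_sum[symmetric]) (rule i)
  finally have "norm (\<Sum>c\<in>S. conv \<rho> (Z c) x *\<^sub>R c) \<le> (LINT y|lborel. norm (\<Sum>c\<in>S. (\<rho> (x - y) * Z c y) *\<^sub>R c))"
    using integral_norm_bound[of lborel "\<lambda>y. \<Sum>c\<in>S. (\<rho> (x - y) * Z c y) *\<^sub>R c"] by simp
  also have "\<dots> \<le> (LINT y|lborel. \<rho> (x - y) * C)"
  proof (rule integral_mono_AE)
    show "integrable lborel (\<lambda>y. norm (\<Sum>c\<in>S. (\<rho> (x - y) * Z c y) *\<^sub>R c))"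
      by (intro integrable_norm Bochner_Integration.integrable_sum i)
    show "integrable lborel (\<lambda>y. \<rho> (x - y) * C)" using rho(8)[of x] by auto
    show "AE y in lborel. norm (\<Sum>c\<in>S. (\<rho> (x - y) * Z c y) *\<^sub>R c) \<le> \<rho> (x - y) * C"
      using Z_bound
    proof eventually_elim
      case (elim y)
      have "(\<Sum>c\<in>S. (\<rho> (x - y) * Z c y) *\<^sub>R c) = \<rho> (x - y) *\<^sub>R (\<Sum>c\<in>S. Z c y *\<^sub>R c)"
        by (simp add: scaleR_sum_right)
      then show ?case using elim rho(2)[of "x - y"] by (simp add: mult_left_mono)
    qed
  qed
  also have "\<dots> = C" using rho(7)[of x] by simp
  finally show ?thesis .
qed

text \<open>The distribution \<open>(z\<^sub>1, D\<^sub>1 u)\<close>.\<close>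

definition limit_functional :: "('a \<Rightarrow> real) \<Rightarrow> real" where
  "limit_functional \<phi> = - (LINT x|lborel. (\<phi> x * U x) * D x)
     - (\<Sum>c\<in>Basis. LINT x|lborel. (partial c \<phi> x * U x) * Z c x)
     - (\<Sum>c\<in>Basis - S. LINT x|lborel. (\<phi> x * G c x) * Z c x)"

text \<open>The derivative of \<open>u\<close> is tested against the components of \<open>\<phi>\<close> times the mollified
field. By the product rule the derivatives that fall on the field sum up to its divergence.\<close>

lemma mollified_identity:
  assumes \<rho>: "mollifier r \<rho>" and \<phi>: "smooth \<phi>" and K: "compact K" "{x. \<phi> x \<noteq> 0} \<subseteq> K"
    and r: "\<And>x. x \<in> K \<Longrightarrow> cball x r \<subseteq> \<Omega>"
  shows "(\<Sum>c\<in>S. LINT x|M. \<phi> x * conv \<rho> (Z c) x * f c x) =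
     - (LINT x|lborel. (\<phi> x * U x) * conv \<rho> D x)
     - (\<Sum>c\<in>Basis. LINT x|lborel. (partial c \<phi> x * U x) * conv \<rho> (Z c) x)
     - (\<Sum>c\<in>Basis - S. LINT x|lborel. (\<phi> x * G c x) * conv \<rho> (Z c) x)"
proof -
  note rho = mollifierD[OF \<rho>]
  have r0: "0 \<le> r"
  proof (rule ccontr)
    assume "\<not> 0 \<le> r"
    then have "\<rho> x = 0" for x using rho(3)[of x] norm_ge_zero[of x] by linarith
    then show False using rho(4) by simp
  qed
  have K\<Omega>: "K \<subseteq> \<Omega>" using r r0 by force
  have K0: "\<phi> x = 0" if "x \<notin> K" for x using K(2) that by auto
  note \<phi>b = compact_support_bounded[OF \<phi> K]
  have sZ: "smooth (conv \<rho> (Z c))" if "c \<in> Basis" for c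
    by (rule smooth_conv[OF rho(1) rho(3) integrable_data(2)[OF that]])
  have test: "(\<lambda>x. \<phi> x * conv \<rho> (Z c) x) \<in> test_functions \<Omega>" if "c \<in> Basis" for c
    by (rule test_functionsI[OF smooth_mult[OF \<phi> sZ[OF that]] K(1) K\<Omega>]) (use K(2) in auto)
  have dz: "partial c (\<lambda>x. \<phi> x * conv \<rho> (Z c) x) = (\<lambda>x. \<phi> x * conv (partial c \<rho>) (Z c) x + partial c \<phi> x * conv \<rho> (Z c) x)"
    if "c \<in> Basis" for c
    by (simp add: partial_mult[OF \<phi> sZ[OF that]] partial_conv[OF rho(1) rho(3) integrable_data(2)[OF that] that])
  have int1: "integrable lborel (\<lambda>x. (\<phi> x * conv (partial c \<rho>) (Z c) x) * U x)" if c: "c \<in> Basis" for c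
  proof -
    have sm: "smooth (\<lambda>x. \<phi> x * conv (partial c \<rho>) (Z c) x)"
      using smooth_conv[OF smooth_partial[OF rho(1) c] partial_bounded_support[OF rho(3)] integrable_data(2)[OF c]] \<phi>
      by (intro smooth_mult)
    have "{x. \<phi> x * conv (partial c \<rho>) (Z c) x \<noteq> 0} \<subseteq> K" using K(2) by auto
    note b = compact_support_bounded(1,2)[OF sm K(1) this]
    from b(2) obtain B where B: "\<And>x. \<bar>\<phi> x * conv (partial c \<rho>) (Z c) x\<bar> \<le> B" by blast
    show ?thesis by (rule integrable_bounded_mult[OF _ B integrable_data(1)]) (use b(1) in simp)
  qed
  have int2: "integrable lborel (\<lambda>x. (partial c \<phi> x * U x) * conv \<rho> (Z c) x)" if c: "c \<in> Basis" for c
  proof -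
    obtain B where "\<And>x. \<bar>partial c \<phi> x\<bar> \<le> B" using \<phi>b(4)[OF c] by blast
    from pairable_conv_integrable[OF \<rho> pairable_bounded_mult[OF UZ[OF c] \<phi>b(3)[OF c] this]] show ?thesis .
  qed
  have U_eq: "(LINT x|lborel. U x * partial c (\<lambda>x. \<phi> x * conv \<rho> (Z c) x) x) =
    (LINT x|lborel. (\<phi> x * conv (partial c \<rho>) (Z c) x) * U x) + (LINT x|lborel. (partial c \<phi> x * U x) * conv \<rho> (Z c) x)"
    if c: "c \<in> Basis" for c
  proof -
    have "(LINT x|lborel. U x * partial c (\<lambda>x. \<phi> x * conv \<rho> (Z c) x) x) =
      (LINT x|lborel. (\<phi> x * conv (partial c \<rho>) (Z c) x) * U x + (partial c \<phi> x * U x) * conv \<rho> (Z c) x)"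
      unfolding dz[OF c] by (intro Bochner_Integration.integral_cong refl) (simp add: algebra_simps)
    then show ?thesis using int1[OF c] int2[OF c] by simp
  qed
  \<comment> \<open>Outside \<open>K\<close>, where the divergence of the mollified field is not under control, \<open>\<phi>\<close> vanishes.\<close>
  have div: "(\<Sum>c\<in>Basis. LINT x|lborel. (\<phi> x * conv (partial c \<rho>) (Z c) x) * U x) = (LINT x|lborel. (\<phi> x * U x) * conv \<rho> D x)"
  proof -
    have "(\<Sum>c\<in>Basis. LINT x|lborel. (\<phi> x * conv (partial c \<rho>) (Z c) x) * U x) =
      (LINT x|lborel. (\<Sum>c\<in>Basis. (\<phi> x * conv (partial c \<rho>) (Z c) x) * U x))"
      by (rule Bochner_Integration.integral_sum[symmetric]) (rule int1)
    also have "\<dots> = (LINT x|lborel. (\<phi> x * U x) * conv \<rho> D x)"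
    proof (intro Bochner_Integration.integral_cong refl)
      fix x
      show "(\<Sum>c\<in>Basis. (\<phi> x * conv (partial c \<rho>) (Z c) x) * U x) = (\<phi> x * U x) * conv \<rho> D x"
      proof (cases "x \<in> K")
        case True
        have "(\<Sum>c\<in>Basis. (\<phi> x * conv (partial c \<rho>) (Z c) x) * U x) = \<phi> x * U x * (\<Sum>c\<in>Basis. conv (partial c \<rho>) (Z c) x)"
          by (simp add: sum_distrib_left mult_ac)
        then show ?thesis using divergence_conv[OF \<rho> r[OF True]] by simp
      qed (simp add: K0)
    qed
    finally show ?thesis .
  qed
  have "(\<Sum>c\<in>Basis. LINT x|lborel. U x * partial c (\<lambda>x. \<phi> x * conv \<rho> (Z c) x) x) =
    (\<Sum>c\<in>S. LINT x|lborel. U x * partial c (\<lambda>x. \<phi> x * conv \<rho> (Z c) x) x) +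
    (\<Sum>c\<in>Basis - S. LINT x|lborel. U x * partial c (\<lambda>x. \<phi> x * conv \<rho> (Z c) x) x)"
    using sum.subset_diff[OF S finite_Basis] by (simp add: add.commute)
  also have "\<dots> = - (\<Sum>c\<in>S. LINT x|M. \<phi> x * conv \<rho> (Z c) x * f c x) - (\<Sum>c\<in>Basis - S. LINT x|lborel. (\<phi> x * G c x) * conv \<rho> (Z c) x)"
  proof -
    have "(\<Sum>c\<in>S. LINT x|lborel. U x * partial c (\<lambda>x. \<phi> x * conv \<rho> (Z c) x) x) = (\<Sum>c\<in>S. - (LINT x|M. \<phi> x * conv \<rho> (Z c) x * f c x))"
      using S by (intro sum.cong refl deriv_measure test) auto
    moreover have "(\<Sum>c\<in>Basis - S. LINT x|lborel. U x * partial c (\<lambda>x. \<phi> x * conv \<rho> (Z c) x) x) =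
      (\<Sum>c\<in>Basis - S. - (LINT x|lborel. (\<phi> x * G c x) * conv \<rho> (Z c) x))"
      by (intro sum.cong refl trans[OF deriv_function] test) (auto simp: mult_ac)
    ultimately show ?thesis by (simp add: sum_negf)
  qed
  finally have "(\<Sum>c\<in>S. LINT x|M. \<phi> x * conv \<rho> (Z c) x * f c x) =
    - (\<Sum>c\<in>Basis. LINT x|lborel. U x * partial c (\<lambda>x. \<phi> x * conv \<rho> (Z c) x) x)
    - (\<Sum>c\<in>Basis - S. LINT x|lborel. (\<phi> x * G c x) * conv \<rho> (Z c) x)" by simp
  also have "(\<Sum>c\<in>Basis. LINT x|lborel. U x * partial c (\<lambda>x. \<phi> x * conv \<rho> (Z c) x) x) =
    (LINT x|lborel. (\<phi> x * U x) * conv \<rho> D x) + (\<Sum>c\<in>Basis. LINT x|lborel. (partial c \<phi> x * U x) * conv \<rho> (Z c) x)"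
    using div by (simp add: U_eq sum.distrib cong: sum.cong)
  finally show ?thesis by simp
qed

text \<open>In \<open>mollified_identity\<close> the right side converges to \<open>limit_functional \<phi>\<close>,
and the left side is the pairing of \<open>\<phi> f\<close> with a uniformly bounded sequence of fields.\<close>

lemma limit_functional_representation:
  "\<exists>w\<in>borel_measurable M. (\<forall>x. norm (w x) \<le> C) \<and>
    (\<forall>\<phi>\<in>test_functions \<Omega>. (LINT x|M. \<phi> x * ((\<Sum>c\<in>S. f c x *\<^sub>R c) \<bullet> w x)) = limit_functional \<phi>)"
proof -
  define r where "r n = 1 / real (Suc n)" for n
  have r: "0 < r n" "r \<longlonglongrightarrow> 0" for n
    unfolding r_def using LIMSEQ_Suc[OF lim_1_over_n] by auto
  obtain \<rho> :: "nat \<Rightarrow> 'a \<Rightarrow> real" where \<rho>: "\<And>n. mollifier (r n) (\<rho> n)"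
  proof -
    have "\<forall>n. \<exists>\<rho>::'a \<Rightarrow> real. mollifier (r n) \<rho>" using mollifier_exists r(1) by blast
    then show ?thesis using that by metis
  qed
  define g where "g n x = (\<Sum>c\<in>S. conv (\<rho> n) (Z c) x *\<^sub>R c)" for n x
  have fS: "finite S" using S finite_subset finite_Basis by blast
  have gm: "g n \<in> borel_measurable M" for n
  proof (rule borel_imp_measurable_M)
    have "conv (\<rho> n) (Z c) \<in> borel_measurable borel" if "c \<in> S" for c
      using conv_measurable[OF \<rho> integrable_data(2)] that S by auto
    then show "g n \<in> borel_measurable borel" unfolding g_def by measurable
  qed
  have gb: "norm (g n x) \<le> C" for n x unfolding g_def by (rule norm_conv_le[OF \<rho>])
  obtain w where w: "w \<in> borel_measurable M" "\<forall>x. norm (w x) \<le> C"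
    "\<forall>F L. integrable M F \<longrightarrow> (\<lambda>n. LINT x|M. F x \<bullet> g n x) \<longlonglongrightarrow> L \<longrightarrow> (LINT x|M. F x \<bullet> w x) = L"
    using bounded_sequence_weak_limit[of M g C, OF M(1) gm gb] by (elim bexE conjE) (rule that)
  have "(LINT x|M. \<phi> x * ((\<Sum>c\<in>S. f c x *\<^sub>R c) \<bullet> w x)) = limit_functional \<phi>" if t: "\<phi> \<in> test_functions \<Omega>" for \<phi>
  proof -
    obtain K where K: "smooth \<phi>" "compact K" "K \<subseteq> \<Omega>" "{x. \<phi> x \<noteq> 0} \<subseteq> K"
      using test_functionsD[OF t] by blast
    note \<phi>b = compact_support_bounded[OF K(1,2,4)]
    obtain B where B: "\<And>x. \<bar>\<phi> x\<bar> \<le> B" using \<phi>b(2) by blast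
    have \<phi>M: "\<phi> \<in> borel_measurable M" using \<phi>b(1) by (rule borel_imp_measurable_M)
    have \<phi>f: "integrable M (\<lambda>x. \<phi> x * f c x)" if "c \<in> S" for c
      by (rule integrable_bounded_mult[OF \<phi>M B f[OF that]])
    define F where "F x = (\<Sum>c\<in>S. (\<phi> x * f c x) *\<^sub>R c)" for x
    have F: "integrable M F" unfolding F_def using \<phi>f by auto
    have FF: "F x \<bullet> v = \<phi> x * ((\<Sum>c\<in>S. f c x *\<^sub>R c) \<bullet> v)" for x v
      by (simp add: F_def inner_sum_left sum_distrib_left mult.assoc)
    have Fg: "F x \<bullet> g n x = (\<Sum>c\<in>S. \<phi> x * conv (\<rho> n) (Z c) x * f c x)" for x n
    proof -
      have "c \<bullet> g n x = conv (\<rho> n) (Z c) x" if "c \<in> S" for c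
      proof -
        have "c \<bullet> g n x = (\<Sum>d\<in>S. conv (\<rho> n) (Z d) x * (c \<bullet> d))" by (simp add: g_def inner_sum_right)
        also have "\<dots> = (\<Sum>d\<in>S. if d = c then conv (\<rho> n) (Z d) x else 0)"
        proof (intro sum.cong refl)
          fix d assume "d \<in> S"
          then have "c \<in> Basis" "d \<in> Basis" using that S by auto
          then show "conv (\<rho> n) (Z d) x * (c \<bullet> d) = (if d = c then conv (\<rho> n) (Z d) x else 0)"
            by (auto simp: inner_Basis)
        qed
        finally show ?thesis using that fS by simp
      qed
      then show ?thesis by (simp add: F_def inner_sum_left mult_ac cong: sum.cong)
    qed
    obtain e where e: "0 < e" "(\<Union>x\<in>K. cball x e) \<subseteq> \<Omega>"
      using compact_subset_open_imp_cball_epsilon_subset[OF K(2) \<Omega> K(3)] .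
    have "eventually (\<lambda>n. r n < e) sequentially" using order_tendstoD(2)[OF r(2) e(1)] .
    then have "eventually (\<lambda>n. - (LINT x|lborel. (\<phi> x * U x) * conv (\<rho> n) D x)
       - (\<Sum>c\<in>Basis. LINT x|lborel. (partial c \<phi> x * U x) * conv (\<rho> n) (Z c) x)
       - (\<Sum>c\<in>Basis - S. LINT x|lborel. (\<phi> x * G c x) * conv (\<rho> n) (Z c) x) = (LINT x|M. F x \<bullet> g n x)) sequentially"
    proof eventually_elim
      case (elim n)
      have "(LINT x|M. F x \<bullet> g n x) = (\<Sum>c\<in>S. LINT x|M. \<phi> x * conv (\<rho> n) (Z c) x * f c x)"
        unfolding Fg
      proof (rule Bochner_Integration.integral_sum)
        fix c assume c: "c \<in> S"
        then have cB: "c \<in> Basis" using S by auto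
        have sm: "smooth (\<lambda>x. \<phi> x * conv (\<rho> n) (Z c) x)"
          using smooth_conv[OF mollifierD(1)[OF \<rho>] mollifierD(3)[OF \<rho>] integrable_data(2)[OF cB]] K(1)
          by (intro smooth_mult)
        have "{x. \<phi> x * conv (\<rho> n) (Z c) x \<noteq> 0} \<subseteq> K" using K(4) by auto
        note sb = compact_support_bounded(1,2)[OF sm K(2) this]
        then obtain B' where "\<And>x. \<bar>\<phi> x * conv (\<rho> n) (Z c) x\<bar> \<le> B'" by blast
        from integrable_bounded_mult[OF borel_imp_measurable_M[OF sb(1)] this f[OF c]]
        show "integrable M (\<lambda>x. \<phi> x * conv (\<rho> n) (Z c) x * f c x)" .
      qed
      moreover have "cball x (r n) \<subseteq> \<Omega>" if "x \<in> K" for x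
        using e(2) that elim subset_cball[of "r n" e x] by (meson UN_subset_iff less_imp_le order_trans)
      note mollified_identity[OF \<rho> K(1,2,4) this]
      ultimately show ?case by (simp only:)
    qed
    moreover have "(\<lambda>n. - (LINT x|lborel. (\<phi> x * U x) * conv (\<rho> n) D x)
       - (\<Sum>c\<in>Basis. LINT x|lborel. (partial c \<phi> x * U x) * conv (\<rho> n) (Z c) x)
       - (\<Sum>c\<in>Basis - S. LINT x|lborel. (\<phi> x * G c x) * conv (\<rho> n) (Z c) x)) \<longlonglongrightarrow> limit_functional \<phi>"
      unfolding limit_functional_def
    proof (intro tendsto_diff tendsto_minus tendsto_sum tendsto_conv_pairing[OF \<rho> r(2)])
      show "pairable (\<lambda>x. \<phi> x * U x) D" by (rule pairable_bounded_mult[OF UD \<phi>b(1) B])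
      show "pairable (\<lambda>x. partial c \<phi> x * U x) (Z c)" if "c \<in> Basis" for c
        using \<phi>b(4)[OF that] pairable_bounded_mult[OF UZ[OF that] \<phi>b(3)[OF that]] by blast
      show "pairable (\<lambda>x. \<phi> x * G c x) (Z c)" if "c \<in> Basis - S" for c
        by (rule pairable_bounded_mult[OF GZ[OF that] \<phi>b(1) B])
    qed
    ultimately have "(\<lambda>n. LINT x|M. F x \<bullet> g n x) \<longlonglongrightarrow> limit_functional \<phi>"
      by (rule Lim_transform_eventually[rotated])
    from w(3)[rule_format, OF F this] show ?thesis by (simp add: FF)
  qed
  then show ?thesis using w(1,2) by blast
qed

end

section \<open>The pairing measures\<close>

lemma inner_block: "c \<in> Basis \<Longrightarrow> block bl i x \<bullet> c = (if bl c = i then x \<bullet> c else 0)"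
proof -
  assume c: "c \<in> Basis"
  have "block bl i x \<bullet> c = (\<Sum>b\<in>{b\<in>Basis. bl b = i}. (x \<bullet> b) * (b \<bullet> c))"
    by (simp add: block_def inner_sum_left)
  also have "\<dots> = (\<Sum>b\<in>{b\<in>Basis. bl b = i}. if b = c then x \<bullet> b else 0)"
    using c by (intro sum.cong refl) (auto simp: inner_Basis)
  finally show ?thesis using c by auto
qed

lemma inner_block_block:
  "block bl i x \<bullet> block bl i y = (\<Sum>c\<in>{c\<in>Basis. bl c = i}. (x \<bullet> c) * (y \<bullet> c))"
proof -
  have "block bl i x \<bullet> block bl i y = (\<Sum>c\<in>{c\<in>Basis. bl c = i}. (y \<bullet> c) * (block bl i x \<bullet> c))"
    unfolding block_def[of bl i y] by (simp add: inner_sum_right)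
  also have "\<dots> = (\<Sum>c\<in>{c\<in>Basis. bl c = i}. (x \<bullet> c) * (y \<bullet> c))"
    by (intro sum.cong refl) (auto simp: inner_block)
  finally show ?thesis .
qed

lemma inner_grad: "c \<in> Basis \<Longrightarrow> grad \<phi> x \<bullet> c = partial c \<phi> x"
proof -
  assume c: "c \<in> Basis"
  have "grad \<phi> x \<bullet> c = (\<Sum>b\<in>Basis. (c \<bullet> b) * partial b \<phi> x)"
    by (auto simp: grad_def inner_sum_left inner_commute[of c] mult.commute intro!: sum.cong)
  then show ?thesis using sum_inner_Basis_mult[OF c] by simp
qed

text \<open>The labelling of the basis carries the whole block structure, so the argument takes
place on a bounded open set with labelled directions. The measures are \<open>(F \<bullet> w) M\<close>, where
\<open>F\<close> is the density of \<open>D\<^sub>1 u\<close> and \<open>w\<close> the limit field, and the sum of this one and \<open>H\<close> times Lebesgue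
measure, where \<open>H\<close> is the sum of the \<open>z\<^sub>i \<cdot> \<nabla>\<^sub>i u\<close>.\<close>

lemma anisotropic_pairing_measures:
  fixes \<Omega> :: "'a::euclidean_space set" and bl :: "'a \<Rightarrow> nat" and p :: "nat \<Rightarrow> real"
  assumes \<Omega>: "open \<Omega>" "bounded \<Omega>" and bl: "bl ` Basis \<subseteq> {1..k}"
    and p: "p 1 = 1" "\<And>i. i \<in> {2..k} \<Longrightarrow> 1 < p i" "\<And>i. i \<in> {1..k} \<Longrightarrow> p i \<le> p k" and q: "1 \<le> q"
    and u: "u \<in> BV_aniso \<Omega> bl k p" "in_Lp (max (ennreal (p k)) q) \<Omega> u"
    and z: "z \<in> X_aniso \<Omega> bl k p (dual_exp q)" and k: "1 \<le> k"
  shows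
    "(\<exists>\<mu>. radon_measure \<Omega> \<mu> \<and> represents \<Omega> \<mu> (pairing \<Omega> bl k z u) \<and>
        (\<forall>B\<in>borel_subsets \<Omega>. ennreal \<bar>\<mu> B\<bar> \<le>
           Lp_norm \<infinity> \<Omega> (\<lambda>x. block bl 1 (z x)) * total_variation (block_deriv_measure \<Omega> bl 1 u) B
           + (\<Sum>i=2..k. Lp_norm (dual_exp (ennreal (p i))) \<Omega> (\<lambda>x. block bl i (z x))
                        * Lp_norm (ennreal (p i)) \<Omega> (weak_grad \<Omega> bl i u)))) \<and>
     (\<exists>\<mu>1. radon_measure \<Omega> \<mu>1 \<and> represents \<Omega> \<mu>1 (pairing_1 \<Omega> bl k z u) \<and>
        (\<forall>B\<in>borel_subsets \<Omega>. ennreal \<bar>\<mu>1 B\<bar> \<le>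
           Lp_norm \<infinity> \<Omega> (\<lambda>x. block bl 1 (z x)) * total_variation (block_deriv_measure \<Omega> bl 1 u) B) \<and>
        abs_continuous \<Omega> \<mu>1 (block_deriv_measure \<Omega> bl 1 u))"
proof -
  have \<Omega>b: "\<Omega> \<in> sets borel" using \<Omega> by auto
  define R where "R = max (ennreal (p k)) q"
  have p1: "1 \<le> p i" if "i \<in> {1..k}" for i
    using p(1) p(2)[of i] that by (cases "i = 1") auto
  have pe: "1 \<le> ennreal (p i)" "ennreal (p i) \<le> R" if "i \<in> {1..k}" for i
    using p1[OF that] p(3)[OF that] by (auto simp: R_def ennreal_1[symmetric] le_max_iff_disj ennreal_leI simp del: ennreal_1)
  have R1: "1 \<le> R" using q by (simp_all add: R_def le_max_iff_disj)
  have blc: "bl c \<in> {1..k}" if "c \<in> Basis" for c using bl that by auto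
  define S where "S = {c \<in> Basis. bl c = 1}"
  have S: "S \<subseteq> Basis" by (auto simp: S_def)
  have fS: "finite S" using S finite_subset finite_Basis by blast
  have T: "Basis - S = {c \<in> Basis. bl c \<noteq> 1}" by (auto simp: S_def)
  have Tc: "bl c \<in> {2..k}" if "c \<in> Basis - S" for c using that blc[of c] by (auto simp: S_def)

  have "\<exists>d. is_weak_div \<Omega> z d" using z by (simp add: X_aniso_def)
  then have wd: "is_weak_div \<Omega> z (weak_div \<Omega> z)" unfolding weak_div_def by (rule someI_ex)
  have wg: "is_weak_grad \<Omega> bl i u (weak_grad \<Omega> bl i u)" if "i \<in> {2..k}" for i
  proof -
    have "\<exists>g. is_weak_grad \<Omega> bl i u g" using u(1) that unfolding BV_aniso_def by blast
    then show ?thesis unfolding weak_grad_def by (rule someI_ex)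
  qed
  define \<nu> where "\<nu> = deriv_measure \<Omega> u"
  have "\<exists>\<nu>. is_deriv_measure \<Omega> u \<nu>" using u(1) unfolding BV_aniso_def BV_def by blast
  then have \<nu>: "is_deriv_measure \<Omega> u \<nu>" unfolding \<nu>_def deriv_measure_def by (rule someI_ex)

  \<comment> \<open>Borel representatives, extended by zero, of all functions involved.\<close>
  obtain U where U: "Lp_borel R U" "\<And>x. x \<notin> \<Omega> \<Longrightarrow> U x = 0" "AE x in lborel. x \<in> \<Omega> \<longrightarrow> u x = U x"
    using in_Lp_borel_representative[OF \<Omega>b u(2)[folded R_def] R1] by auto
  obtain D where D: "Lp_borel (dual_exp q) D" "\<And>x. x \<notin> \<Omega> \<Longrightarrow> D x = 0"
    "AE x in lborel. x \<in> \<Omega> \<longrightarrow> weak_div \<Omega> z x = D x"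
    using in_Lp_borel_representative[OF \<Omega>b _ one_le_dual_exp[OF q], of "weak_div \<Omega> z"] z
    by (auto simp: X_aniso_def)
  have "\<forall>c\<in>Basis. \<exists>Z. Lp_borel (dual_exp (ennreal (p (bl c)))) Z \<and> (\<forall>x. x \<notin> \<Omega> \<longrightarrow> Z x = 0) \<and>
      (AE x in lborel. x \<in> \<Omega> \<longrightarrow> z x \<bullet> c = Z x)"
  proof
    fix c :: 'a assume c: "c \<in> Basis"
    have "in_Lp (dual_exp (ennreal (p (bl c)))) \<Omega> (\<lambda>x. block bl (bl c) (z x) \<bullet> c)"
      using z blc[OF c] one_le_dual_exp[OF pe(1)[OF blc[OF c]]] c
      by (intro in_Lp_inner_Basis) (auto simp: X_aniso_def)
    then have "in_Lp (dual_exp (ennreal (p (bl c)))) \<Omega> (\<lambda>x. z x \<bullet> c)" using c by (simp add: inner_block)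
    from in_Lp_borel_representative[OF \<Omega>b this one_le_dual_exp[OF pe(1)[OF blc[OF c]]]]
    show "\<exists>Z. Lp_borel (dual_exp (ennreal (p (bl c)))) Z \<and> (\<forall>x. x \<notin> \<Omega> \<longrightarrow> Z x = 0) \<and>
      (AE x in lborel. x \<in> \<Omega> \<longrightarrow> z x \<bullet> c = Z x)" .
  qed
  from bchoice[OF this] obtain Z where Z_all: "\<forall>c\<in>Basis. Lp_borel (dual_exp (ennreal (p (bl c)))) (Z c) \<and> (\<forall>x. x \<notin> \<Omega> \<longrightarrow> Z c x = 0) \<and>
      (AE x in lborel. x \<in> \<Omega> \<longrightarrow> z x \<bullet> c = Z c x)"
    by (elim exE) (rule that)
  have Z: "\<And>c. c \<in> Basis \<Longrightarrow> Lp_borel (dual_exp (ennreal (p (bl c)))) (Z c)"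
    "\<And>c x. c \<in> Basis \<Longrightarrow> x \<notin> \<Omega> \<Longrightarrow> Z c x = 0" "\<And>c. c \<in> Basis \<Longrightarrow> AE x in lborel. x \<in> \<Omega> \<longrightarrow> z x \<bullet> c = Z c x"
    using Z_all by simp_all
  have "\<forall>c\<in>Basis - S. \<exists>G. Lp_borel (ennreal (p (bl c))) G \<and> (\<forall>x. x \<notin> \<Omega> \<longrightarrow> G x = 0) \<and>
      (AE x in lborel. x \<in> \<Omega> \<longrightarrow> weak_grad \<Omega> bl (bl c) u x \<bullet> c = G x)"
  proof
    fix c assume c: "c \<in> Basis - S"
    then have cB: "c \<in> Basis" by simp
    have "in_Lp (ennreal (p (bl c))) \<Omega> (\<lambda>x. weak_grad \<Omega> bl (bl c) u x \<bullet> c)"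
      using u(1) Tc[OF c] cB pe(1)[OF blc[OF cB]] by (intro in_Lp_inner_Basis) (simp_all add: BV_aniso_def)
    from in_Lp_borel_representative[OF \<Omega>b this pe(1)[OF blc[OF cB]]]
    show "\<exists>G. Lp_borel (ennreal (p (bl c))) G \<and> (\<forall>x. x \<notin> \<Omega> \<longrightarrow> G x = 0) \<and>
      (AE x in lborel. x \<in> \<Omega> \<longrightarrow> weak_grad \<Omega> bl (bl c) u x \<bullet> c = G x)" .
  qed
  from bchoice[OF this] obtain G where G_all: "\<forall>c\<in>Basis - S. Lp_borel (ennreal (p (bl c))) (G c) \<and> (\<forall>x. x \<notin> \<Omega> \<longrightarrow> G c x = 0) \<and>
      (AE x in lborel. x \<in> \<Omega> \<longrightarrow> weak_grad \<Omega> bl (bl c) u x \<bullet> c = G c x)"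
    by (elim exE) (rule that)
  have G: "\<And>c. c \<in> Basis - S \<Longrightarrow> Lp_borel (ennreal (p (bl c))) (G c)"
    "\<And>c x. c \<in> Basis - S \<Longrightarrow> x \<notin> \<Omega> \<Longrightarrow> G c x = 0"
    "\<And>c. c \<in> Basis - S \<Longrightarrow> AE x in lborel. x \<in> \<Omega> \<longrightarrow> weak_grad \<Omega> bl (bl c) u x \<bullet> c = G c x"
    using G_all by simp_all
  have Ui: "integrable lborel U" by (rule Lp_borel_integrable[OF U(1,2) \<Omega>b \<Omega>(2) R1])
  have Di: "integrable lborel D" by (rule Lp_borel_integrable[OF D(1,2) \<Omega>b \<Omega>(2) one_le_dual_exp[OF q]])
  have Zi: "integrable lborel (Z c)" if "c \<in> Basis" for c
    by (rule Lp_borel_integrable[OF Z(1,2) \<Omega>b \<Omega>(2) one_le_dual_exp[OF pe(1)[OF blc]]]) (use that in auto)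
  have Gi: "integrable lborel (G c)" if "c \<in> Basis - S" for c
    by (rule Lp_borel_integrable[OF G(1,2) \<Omega>b \<Omega>(2) pe(1)[OF blc]]) (use that in auto)
  have UD: "pairable U D"
    by (rule pairable_Lp[OF q Lp_borel_mono[OF U(1,2) \<Omega>b \<Omega>(2) q] Ui D(1) Di]) (simp_all add: R_def le_max_iff_disj)
  have UZ: "pairable U (Z c)" if c: "c \<in> Basis" for c
    by (rule pairable_Lp[OF pe(1)[OF blc[OF c]] Lp_borel_mono[OF U(1,2) \<Omega>b \<Omega>(2) pe[OF blc[OF c]]] Ui Z(1)[OF c] Zi[OF c]])
  have GZ: "pairable (G c) (Z c)" if c: "c \<in> Basis - S" for c
    by (rule pairable_Lp[OF pe(1)[OF blc] G(1)[OF c] Gi[OF c] Z(1) Zi]) (use c in auto)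
  have meas_lborel[measurable]: "U \<in> borel_measurable borel" "D \<in> borel_measurable borel"
    using U(1) D(1) by (auto simp: Lp_borel_def)
  have Zm[measurable]: "Z c \<in> borel_measurable borel" if "c \<in> Basis" for c using Z(1)[OF that] by (auto simp: Lp_borel_def)
  have Gm[measurable]: "G c \<in> borel_measurable borel" if "c \<in> Basis - S" for c using G(1)[OF that] by (auto simp: Lp_borel_def)
  have um[measurable]: "u \<in> borel_measurable (lebesgue_on \<Omega>)" using u(2) by (simp add: in_Lp_def)
  have dm[measurable]: "weak_div \<Omega> z \<in> borel_measurable (lebesgue_on \<Omega>)" using z by (simp add: X_aniso_def in_Lp_def)
  have zm: "(\<lambda>x. z x \<bullet> c) \<in> borel_measurable (lebesgue_on \<Omega>)" if c: "c \<in> Basis" for c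
  proof -
    have "(\<lambda>x. block bl (bl c) (z x)) \<in> borel_measurable (lebesgue_on \<Omega>)"
      using z blc[OF c] by (auto simp: X_aniso_def in_Lp_def)
    then have "(\<lambda>x. block bl (bl c) (z x) \<bullet> c) \<in> borel_measurable (lebesgue_on \<Omega>)" by measurable
    then show ?thesis using c by (simp add: inner_block)
  qed
  have gm: "(\<lambda>x. weak_grad \<Omega> bl (bl c) u x \<bullet> c) \<in> borel_measurable (lebesgue_on \<Omega>)" if c: "c \<in> Basis - S" for c
  proof -
    have "weak_grad \<Omega> bl (bl c) u \<in> borel_measurable (lebesgue_on \<Omega>)"
      using u(1) Tc[OF c] by (auto simp: BV_aniso_def in_Lp_def)
    then show ?thesis by measurable
  qed

  have "radon_measure \<Omega> \<nu>" using \<nu> by (simp add: is_deriv_measure_def)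
  from vector_measure_density[OF \<Omega> this]
  obtain M f e where M: "finite_measure M" "sets M = borel_subsets \<Omega>"
    and \<nu>_density: "\<forall>c\<in>Basis. integrable M (f c) \<and> (\<forall>B\<in>borel_subsets \<Omega>. \<nu> B \<bullet> c = (LINT x|M. indicator B x * f c x))"
    and e: "\<forall>H :: 'a \<Rightarrow> real. integrable lborel H \<longrightarrow> integrable M (\<lambda>x. e x * H x) \<and>
      (\<forall>B\<in>borel_subsets \<Omega>. (LINT x|lborel. indicator B x * H x) = (LINT x|M. indicator B x * (e x * H x)))"
    by (elim exE conjE) (rule that)
  have spM: "space M = \<Omega>"
    using sets_eq_imp_space_eq[of M "restrict_space borel \<Omega>"] M(2) borel_subsets_eq_restrict[OF \<Omega>b] by (simp add: space_restrict_space)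
  have \<phi>M: "\<phi> \<in> borel_measurable M" if "\<phi> \<in> borel_measurable borel" for \<phi> :: "'a \<Rightarrow> real"
    using measurable_cong_sets[of M "restrict_space borel \<Omega>" borel borel] M(2) borel_subsets_eq_restrict[OF \<Omega>b]
      measurable_restrict_space1[OF that, of \<Omega>] by simp

  define C where "C = enn2real (esssup (lebesgue_on \<Omega>) (\<lambda>x. ennreal (norm (block bl 1 (z x)))))"
  have "in_Lp \<infinity> \<Omega> (\<lambda>x. block bl 1 (z x))"
    using z k p(1) dual_exp_one by (force simp: X_aniso_def)
  then have C_eq: "Lp_norm \<infinity> \<Omega> (\<lambda>x. block bl 1 (z x)) = ennreal C"
    by (simp add: C_def Lp_norm_def in_Lp_def less_top)
  have C0: "0 \<le> C" by (simp add: C_def)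
  have Z_bound: "AE x in lborel. norm (\<Sum>c\<in>S. Z c x *\<^sub>R c) \<le> C"
  proof -
    have "AE x in lebesgue_on \<Omega>. ennreal (norm (block bl 1 (z x))) \<le> ennreal C"
      using esssup_AE[of "\<lambda>x. ennreal (norm (block bl 1 (z x)))" "lebesgue_on \<Omega>"] C_eq by (simp add: Lp_norm_def)
    then have "AE x in lborel. x \<in> \<Omega> \<longrightarrow> norm (block bl 1 (z x)) \<le> C"
      using C0 by (simp add: AE_lebesgue_on_iff[OF \<Omega>b])
    moreover have "AE x in lborel. \<forall>c\<in>S. x \<in> \<Omega> \<longrightarrow> z x \<bullet> c = Z c x"
      using Z(3) S fS by (intro AE_finite_allI) auto
    ultimately show ?thesis
    proof eventually_elim
      case (elim x)
      show ?case
      proof (cases "x \<in> \<Omega>")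
        case True
        have "(\<Sum>c\<in>S. Z c x *\<^sub>R c) = block bl 1 (z x)"
          unfolding block_def S_def[symmetric] using elim True by (intro sum.cong) auto
        then show ?thesis using elim True by simp
      next
        case False
        then have "(\<Sum>c\<in>S. Z c x *\<^sub>R c) = 0" using Z(2) S by (intro sum.neutral) auto
        then show ?thesis using C0 by simp
      qed
    qed
  qed

  have test: "\<phi> \<in> borel_measurable borel" "\<exists>B. \<forall>x. \<bar>\<phi> x\<bar> \<le> B"
    "\<And>c. c \<in> Basis \<Longrightarrow> partial c \<phi> \<in> borel_measurable borel" "\<And>c. c \<in> Basis \<Longrightarrow> \<exists>B. \<forall>x. \<bar>partial c \<phi> x\<bar> \<le> B"
    if t: "\<phi> \<in> test_functions \<Omega>" for \<phi>
  proof -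
    obtain K where K: "smooth \<phi>" "compact K" "K \<subseteq> \<Omega>" "{x. \<phi> x \<noteq> 0} \<subseteq> K" using test_functionsD[OF t] by blast
    note * = compact_support_bounded[OF K(1,2,4)]
    show "\<phi> \<in> borel_measurable borel" "\<exists>B. \<forall>x. \<bar>\<phi> x\<bar> \<le> B"
      "\<And>c. c \<in> Basis \<Longrightarrow> partial c \<phi> \<in> borel_measurable borel" "\<And>c. c \<in> Basis \<Longrightarrow> \<exists>B. \<forall>x. \<bar>partial c \<phi> x\<bar> \<le> B"
      by (rule *(1) *(2) *(3) *(4); assumption?)+
  qed

  have AE_Z: "AE x in lborel. \<forall>c\<in>Basis. x \<in> \<Omega> \<longrightarrow> z x \<bullet> c = Z c x"
    using Z(3) by (intro AE_finite_allI) auto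
  have AE_G: "AE x in lborel. \<forall>c\<in>Basis - S. x \<in> \<Omega> \<longrightarrow> weak_grad \<Omega> bl (bl c) u x \<bullet> c = G c x"
    using G(3) by (intro AE_finite_allI) auto
  have U_transfer: "(LINT x|lebesgue_on \<Omega>. u x * h x) = (LINT x|lborel. U x * h x)"
    if h: "h \<in> borel_measurable borel" for h
  proof (rule integral_lebesgue_on_eq_lborel(1)[OF \<Omega>b])
    note [measurable] = h lborel_to_lebesgue_on_measurable[OF h]
    show "(\<lambda>x. u x * h x) \<in> borel_measurable (lebesgue_on \<Omega>)" by measurable
    show "(\<lambda>x. U x * h x) \<in> borel_measurable borel" by measurable
    show "AE x in lborel. x \<in> \<Omega> \<longrightarrow> u x * h x = U x * h x" using U(3) by eventually_elim auto
  qed (simp add: U(2))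

  interpret mollified_pairing \<Omega> S U D Z G M f C
  proof (rule mollified_pairing.intro)
    show "open \<Omega>" "S \<subseteq> Basis" "pairable U D" by fact+
    show "pairable U (Z c)" if "c \<in> Basis" for c by (rule UZ[OF that])
    show "pairable (G c) (Z c)" if "c \<in> Basis - S" for c by (rule GZ[OF that])
    show "finite_measure M" "sets M = borel_subsets \<Omega>" by fact+
    show "integrable M (f c)" if "c \<in> S" for c using \<nu>_density S that by blast
    show "AE x in lborel. norm (\<Sum>c\<in>S. Z c x *\<^sub>R c) \<le> C" by fact
    fix \<phi> assume t: "\<phi> \<in> test_functions \<Omega>"
    note tm = test[OF t]
    note [measurable] = tm(1) lborel_to_lebesgue_on_measurable[OF tm(1)]
    show "(\<Sum>c\<in>Basis. LINT x|lborel. Z c x * partial c \<phi> x) = - (LINT x|lborel. D x * \<phi> x)"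
    proof -
      have int: "integrable lborel (\<lambda>x. Z c x * partial c \<phi> x)" if c: "c \<in> Basis" for c
      proof -
        obtain B where "\<And>x. \<bar>partial c \<phi> x\<bar> \<le> B" using tm(4)[OF c] by blast
        from integrable_bounded_mult[OF _ this Zi[OF c]] tm(3)[OF c]
        show ?thesis by (simp add: mult.commute)
      qed
      have eq: "z x \<bullet> grad \<phi> x = (\<Sum>c\<in>Basis. (z x \<bullet> c) * partial c \<phi> x)" for x
        by (subst euclidean_inner) (simp add: inner_grad)
      have "(\<Sum>c\<in>Basis. LINT x|lborel. Z c x * partial c \<phi> x) = (LINT x|lborel. (\<Sum>c\<in>Basis. Z c x * partial c \<phi> x))"
        by (rule Bochner_Integration.integral_sum[symmetric]) (rule int)
      also have "\<dots> = (LINT x|lebesgue_on \<Omega>. z x \<bullet> grad \<phi> x)"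
        unfolding eq
      proof (rule integral_lebesgue_on_eq_lborel(1)[OF \<Omega>b, symmetric])
        show "(\<lambda>x. \<Sum>c\<in>Basis. (z x \<bullet> c) * partial c \<phi> x) \<in> borel_measurable (lebesgue_on \<Omega>)"
          by (intro borel_measurable_sum borel_measurable_times zm lborel_to_lebesgue_on_measurable[OF tm(3)])
        show "(\<lambda>x. \<Sum>c\<in>Basis. Z c x * partial c \<phi> x) \<in> borel_measurable borel"
          using Zm tm(3) by (intro borel_measurable_sum borel_measurable_times)
        show "AE x in lborel. x \<in> \<Omega> \<longrightarrow> (\<Sum>c\<in>Basis. (z x \<bullet> c) * partial c \<phi> x) = (\<Sum>c\<in>Basis. Z c x * partial c \<phi> x)"
          using AE_Z by eventually_elim (auto intro!: sum.cong)
      qed (simp add: Z(2))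
      also have "\<dots> = - (LINT x|lebesgue_on \<Omega>. weak_div \<Omega> z x * \<phi> x)"
        using wd t by (simp add: is_weak_div_def)
      also have "(LINT x|lebesgue_on \<Omega>. weak_div \<Omega> z x * \<phi> x) = (LINT x|lborel. D x * \<phi> x)"
      proof (rule integral_lebesgue_on_eq_lborel(1)[OF \<Omega>b])
        show "AE x in lborel. x \<in> \<Omega> \<longrightarrow> weak_div \<Omega> z x * \<phi> x = D x * \<phi> x" using D(3) by eventually_elim auto
      qed (simp_all add: D(2))
      finally show ?thesis .
    qed
    show "(LINT x|lborel. U x * partial c \<phi> x) = - (LINT x|M. \<phi> x * f c x)" if c: "c \<in> S" for c
    proof -
      have cB: "c \<in> Basis" using c S by auto
      obtain B where B: "\<And>x. \<bar>\<phi> x\<bar> \<le> B" using tm(2) by blast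
      have "(LINT x|lborel. U x * partial c \<phi> x) = (LINT x|lebesgue_on \<Omega>. u x * partial c \<phi> x)"
        by (rule U_transfer[symmetric]) (rule tm(3)[OF cB])
      also have "\<dots> = - signed_integral \<Omega> (\<lambda>B. \<nu> B \<bullet> c) \<phi>"
        using \<nu> cB t unfolding is_deriv_measure_def by blast
      also have "signed_integral \<Omega> (\<lambda>B. \<nu> B \<bullet> c) \<phi> = (LINT x|M. \<phi> x * f c x)"
        by (rule signed_integral_density[OF \<Omega>b M(2) spM _ _ \<phi>M[OF tm(1)] B]) (use \<nu>_density cB M(2) in auto)
      finally show ?thesis .
    qed
    show "(LINT x|lborel. U x * partial c \<phi> x) = - (LINT x|lborel. G c x * \<phi> x)" if c: "c \<in> Basis - S" for c
    proof -
      have cB: "c \<in> Basis" using c by auto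
      have "(LINT x|lborel. U x * partial c \<phi> x) = (LINT x|lebesgue_on \<Omega>. u x * partial c \<phi> x)"
        by (rule U_transfer[symmetric]) (rule tm(3)[OF cB])
      also have "\<dots> = - (LINT x|lebesgue_on \<Omega>. (weak_grad \<Omega> bl (bl c) u x \<bullet> c) * \<phi> x)"
        using wg[OF Tc[OF c]] cB t unfolding is_weak_grad_def by blast
      also have "(LINT x|lebesgue_on \<Omega>. (weak_grad \<Omega> bl (bl c) u x \<bullet> c) * \<phi> x) = (LINT x|lborel. G c x * \<phi> x)"
      proof (rule integral_lebesgue_on_eq_lborel(1)[OF \<Omega>b])
        note [measurable] = gm[OF c] Gm[OF c]
        show "(\<lambda>x. (weak_grad \<Omega> bl (bl c) u x \<bullet> c) * \<phi> x) \<in> borel_measurable (lebesgue_on \<Omega>)" by measurable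
        show "(\<lambda>x. G c x * \<phi> x) \<in> borel_measurable borel" by measurable
        show "AE x in lborel. x \<in> \<Omega> \<longrightarrow> (weak_grad \<Omega> bl (bl c) u x \<bullet> c) * \<phi> x = G c x * \<phi> x"
          using G(3)[OF c] by eventually_elim auto
      qed (simp add: G(2)[OF c])
      finally show ?thesis .
    qed
  qed

  obtain w where w: "w \<in> borel_measurable M" "\<forall>x. norm (w x) \<le> C"
    "\<forall>\<phi>\<in>test_functions \<Omega>. (LINT x|M. \<phi> x * ((\<Sum>c\<in>S. f c x *\<^sub>R c) \<bullet> w x)) = limit_functional \<phi>"
    using limit_functional_representation by (elim bexE conjE) (rule that)
  define F where "F x = (\<Sum>c\<in>S. f c x *\<^sub>R c)" for x
  define g where "g x = F x \<bullet> w x" for x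
  define H where "H x = (\<Sum>c\<in>Basis - S. G c x * Z c x)" for x
  have F: "integrable M F" unfolding F_def using f S by (intro Bochner_Integration.integrable_sum integrable_scaleR_left) auto
  have g: "integrable M g" unfolding g_def by (rule integrable_bounded_inner[OF F w(1), of C]) (use w(2) in auto)
  have GZi: "integrable lborel (\<lambda>x. G c x * Z c x)" if "c \<in> Basis - S" for c
    by (rule pairable_integrable_mult[OF GZ[OF that]])
  have H: "integrable lborel H" unfolding H_def by (intro Bochner_Integration.integrable_sum GZi)
  have H0: "H x = 0" if "x \<notin> \<Omega>" for x unfolding H_def using G(2) that by (intro sum.neutral) auto

  \<comment> \<open>Needed for test functions, in the representation, and for indicators, in the bound.\<close>
  have H_transfer: "(\<Sum>i=2..k. LINT x|lebesgue_on \<Omega>. \<psi> x * (block bl i (z x) \<bullet> weak_grad \<Omega> bl i u x)) = (LINT x|lborel. \<psi> x * H x)"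
    "(LINT x|lborel. \<psi> x * H x) = (\<Sum>c\<in>Basis - S. LINT x|lborel. (\<psi> x * G c x) * Z c x)"
    if \<psi>: "\<psi> \<in> borel_measurable borel" "\<And>x. \<bar>\<psi> x\<bar> \<le> B" for \<psi> B
  proof -
    have int: "integrable lborel (\<lambda>x. \<psi> x * (G c x * Z c x))" if "c \<in> Basis - S" for c
      by (rule integrable_bounded_mult[OF _ \<psi>(2) GZi[OF that]]) (use \<psi> in simp)
    have one: "(LINT x|lebesgue_on \<Omega>. \<psi> x * (block bl i (z x) \<bullet> weak_grad \<Omega> bl i u x)) =
      (\<Sum>c\<in>{c. c \<in> Basis - S \<and> bl c = i}. LINT x|lborel. \<psi> x * (G c x * Z c x))" if i: "i \<in> {2..k}" for i
    proof -
      have set_eq: "{c \<in> Basis. bl c = i} = {c. c \<in> Basis - S \<and> bl c = i}" using i by (auto simp: S_def)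
      have eq: "\<psi> x * (block bl i (z x) \<bullet> weak_grad \<Omega> bl i u x) =
        (\<Sum>c\<in>{c. c \<in> Basis - S \<and> bl c = i}. \<psi> x * ((weak_grad \<Omega> bl (bl c) u x \<bullet> c) * (z x \<bullet> c)))" for x
      proof -
        have "block bl i (z x) \<bullet> weak_grad \<Omega> bl i u x = block bl i (z x) \<bullet> block bl i (weak_grad \<Omega> bl i u x)"
          using wg[OF i] by (simp add: is_weak_grad_def)
        also have "\<dots> = (\<Sum>c\<in>{c. c \<in> Basis - S \<and> bl c = i}. (weak_grad \<Omega> bl (bl c) u x \<bullet> c) * (z x \<bullet> c))"
          unfolding inner_block_block set_eq by (intro sum.cong refl) auto
        finally show ?thesis by (simp add: sum_distrib_left)
      qed
      have "(LINT x|lebesgue_on \<Omega>. \<psi> x * (block bl i (z x) \<bullet> weak_grad \<Omega> bl i u x)) =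
        (LINT x|lborel. (\<Sum>c\<in>{c. c \<in> Basis - S \<and> bl c = i}. \<psi> x * (G c x * Z c x)))"
        unfolding eq
      proof (rule integral_lebesgue_on_eq_lborel(1)[OF \<Omega>b])
        show "(\<lambda>x. \<Sum>c\<in>{c. c \<in> Basis - S \<and> bl c = i}. \<psi> x * ((weak_grad \<Omega> bl (bl c) u x \<bullet> c) * (z x \<bullet> c))) \<in> borel_measurable (lebesgue_on \<Omega>)"
          using gm zm lborel_to_lebesgue_on_measurable[OF \<psi>(1)]
          by (intro borel_measurable_sum borel_measurable_times) auto
        show "(\<lambda>x. \<Sum>c\<in>{c. c \<in> Basis - S \<and> bl c = i}. \<psi> x * (G c x * Z c x)) \<in> borel_measurable borel"
          using Gm Zm \<psi>(1) by (intro borel_measurable_sum borel_measurable_times) auto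
        show "AE x in lborel. x \<in> \<Omega> \<longrightarrow> (\<Sum>c\<in>{c. c \<in> Basis - S \<and> bl c = i}. \<psi> x * ((weak_grad \<Omega> bl (bl c) u x \<bullet> c) * (z x \<bullet> c))) =
          (\<Sum>c\<in>{c. c \<in> Basis - S \<and> bl c = i}. \<psi> x * (G c x * Z c x))"
          using AE_Z AE_G by eventually_elim (intro impI sum.cong refl, auto)
        show "(\<Sum>c\<in>{c. c \<in> Basis - S \<and> bl c = i}. \<psi> x * (G c x * Z c x)) = 0" if "x \<notin> \<Omega>" for x
          using G(2) that by (intro sum.neutral) auto
      qed
      also have "\<dots> = (\<Sum>c\<in>{c. c \<in> Basis - S \<and> bl c = i}. LINT x|lborel. \<psi> x * (G c x * Z c x))"
        by (rule Bochner_Integration.integral_sum) (use int in auto)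
      finally show ?thesis .
    qed
    have "(\<Sum>i=2..k. LINT x|lebesgue_on \<Omega>. \<psi> x * (block bl i (z x) \<bullet> weak_grad \<Omega> bl i u x)) =
      (\<Sum>i=2..k. \<Sum>c\<in>{c. c \<in> Basis - S \<and> bl c = i}. LINT x|lborel. \<psi> x * (G c x * Z c x))"
      by (intro sum.cong refl one) auto
    also have "\<dots> = (\<Sum>c\<in>Basis - S. LINT x|lborel. \<psi> x * (G c x * Z c x))"
      by (rule sum.group) (use Tc in auto)
    also have "\<dots> = (LINT x|lborel. (\<Sum>c\<in>Basis - S. \<psi> x * (G c x * Z c x)))"
      by (rule Bochner_Integration.integral_sum[symmetric]) (rule int)
    finally show "(\<Sum>i=2..k. LINT x|lebesgue_on \<Omega>. \<psi> x * (block bl i (z x) \<bullet> weak_grad \<Omega> bl i u x)) = (LINT x|lborel. \<psi> x * H x)"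
      by (simp add: H_def sum_distrib_left)
    have "(LINT x|lborel. \<psi> x * H x) = (LINT x|lborel. (\<Sum>c\<in>Basis - S. \<psi> x * (G c x * Z c x)))"
      by (simp add: H_def sum_distrib_left)
    also have "\<dots> = (\<Sum>c\<in>Basis - S. LINT x|lborel. \<psi> x * (G c x * Z c x))"
      by (rule Bochner_Integration.integral_sum) (rule int)
    finally show "(LINT x|lborel. \<psi> x * H x) = (\<Sum>c\<in>Basis - S. LINT x|lborel. (\<psi> x * G c x) * Z c x)"
      by (simp add: mult.assoc)
  qed

  have pairing: "pairing \<Omega> bl k z u \<phi> = - (LINT x|lborel. (\<phi> x * U x) * D x)
      - (\<Sum>c\<in>Basis. LINT x|lborel. (partial c \<phi> x * U x) * Z c x)" if t: "\<phi> \<in> test_functions \<Omega>" for \<phi>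
  proof -
    note tm = test[OF t]
    note [measurable] = tm(1) lborel_to_lebesgue_on_measurable[OF tm(1)]
    have 1: "(LINT x|lebesgue_on \<Omega>. u x * \<phi> x * weak_div \<Omega> z x) = (LINT x|lborel. (\<phi> x * U x) * D x)"
    proof (rule integral_lebesgue_on_eq_lborel(1)[OF \<Omega>b])
      show "AE x in lborel. x \<in> \<Omega> \<longrightarrow> u x * \<phi> x * weak_div \<Omega> z x = \<phi> x * U x * D x"
        using U(3) D(3) by eventually_elim auto
    qed (simp_all add: D(2))
    have int: "integrable lborel (\<lambda>x. (partial c \<phi> x * U x) * Z c x)" if c: "c \<in> Basis" for c
    proof -
      obtain B where "\<And>x. \<bar>partial c \<phi> x\<bar> \<le> B" using tm(4)[OF c] by blast
      from pairable_integrable_mult[OF pairable_bounded_mult[OF UZ[OF c] tm(3)[OF c] this]] show ?thesis .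
    qed
    have 2: "(LINT x|lebesgue_on \<Omega>. u x * (block bl i (z x) \<bullet> block bl i (grad \<phi> x))) =
      (\<Sum>c\<in>{c. c \<in> Basis \<and> bl c = i}. LINT x|lborel. (partial c \<phi> x * U x) * Z c x)" for i
    proof -
      have eq: "u x * (block bl i (z x) \<bullet> block bl i (grad \<phi> x)) =
        (\<Sum>c\<in>{c. c \<in> Basis \<and> bl c = i}. (partial c \<phi> x * u x) * (z x \<bullet> c))" for x
        unfolding inner_block_block sum_distrib_left by (intro sum.cong refl) (auto simp: inner_grad)
      have "(LINT x|lebesgue_on \<Omega>. u x * (block bl i (z x) \<bullet> block bl i (grad \<phi> x))) =
        (LINT x|lborel. (\<Sum>c\<in>{c. c \<in> Basis \<and> bl c = i}. (partial c \<phi> x * U x) * Z c x))"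
        unfolding eq
      proof (rule integral_lebesgue_on_eq_lborel(1)[OF \<Omega>b])
        show "(\<lambda>x. \<Sum>c\<in>{c. c \<in> Basis \<and> bl c = i}. (partial c \<phi> x * u x) * (z x \<bullet> c)) \<in> borel_measurable (lebesgue_on \<Omega>)"
          by (intro borel_measurable_sum borel_measurable_times zm um lborel_to_lebesgue_on_measurable[OF tm(3)]) auto
        show "(\<lambda>x. \<Sum>c\<in>{c. c \<in> Basis \<and> bl c = i}. (partial c \<phi> x * U x) * Z c x) \<in> borel_measurable borel"
          using Zm tm(3) meas_lborel by (intro borel_measurable_sum borel_measurable_times) auto
        show "AE x in lborel. x \<in> \<Omega> \<longrightarrow> (\<Sum>c\<in>{c. c \<in> Basis \<and> bl c = i}. (partial c \<phi> x * u x) * (z x \<bullet> c)) =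
           (\<Sum>c\<in>{c. c \<in> Basis \<and> bl c = i}. (partial c \<phi> x * U x) * Z c x)"
          using AE_Z U(3) by eventually_elim (intro impI sum.cong refl, auto)
        show "(\<Sum>c\<in>{c. c \<in> Basis \<and> bl c = i}. (partial c \<phi> x * U x) * Z c x) = 0" if "x \<notin> \<Omega>" for x
          using U(2) that by simp
      qed
      also have "\<dots> = (\<Sum>c\<in>{c. c \<in> Basis \<and> bl c = i}. LINT x|lborel. (partial c \<phi> x * U x) * Z c x)"
        by (rule Bochner_Integration.integral_sum) (use int in auto)
      finally show ?thesis .
    qed
    have "(\<Sum>i=1..k. LINT x|lebesgue_on \<Omega>. u x * (block bl i (z x) \<bullet> block bl i (grad \<phi> x))) =
      (\<Sum>c\<in>Basis. LINT x|lborel. (partial c \<phi> x * U x) * Z c x)"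
      unfolding 2 by (rule sum.group) (use bl in auto)
    then show ?thesis unfolding pairing_def 1 by simp
  qed
  have pairing_1: "pairing_1 \<Omega> bl k z u \<phi> = limit_functional \<phi>"
    and pairing_0: "pairing \<Omega> bl k z u \<phi> = limit_functional \<phi> + (LINT x|lborel. \<phi> x * H x)"
    if t: "\<phi> \<in> test_functions \<Omega>" for \<phi>
  proof -
    obtain B where B: "\<And>x. \<bar>\<phi> x\<bar> \<le> B" using test(2)[OF t] by blast
    note HT = H_transfer[OF test(1)[OF t] B]
    show "pairing \<Omega> bl k z u \<phi> = limit_functional \<phi> + (LINT x|lborel. \<phi> x * H x)"
      unfolding pairing[OF t] limit_functional_def HT(2) by simp
    then show "pairing_1 \<Omega> bl k z u \<phi> = limit_functional \<phi>"
      unfolding pairing_1_def HT(1) by simp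
  qed

  define \<mu>1 where "\<mu>1 B = (LINT x|M. indicator B x * g x)" for B
  define \<mu> where "\<mu> B = (LINT x|M. indicator B x * (g x + e x * H x))" for B
  have eH: "integrable M (\<lambda>x. e x * H x)" using e H by blast
  have gH: "integrable M (\<lambda>x. g x + e x * H x)" using g eH by auto
  have radon: "radon_measure \<Omega> \<mu>1" "radon_measure \<Omega> \<mu>"
    unfolding \<mu>1_def \<mu>_def by (rule radon_measure_density[OF M(2)], fact)+
  have rep1: "represents \<Omega> \<mu>1 (pairing_1 \<Omega> bl k z u)"
    unfolding represents_def
  proof
    fix \<phi> assume t: "\<phi> \<in> test_functions \<Omega>"
    obtain B where B: "\<And>x. \<bar>\<phi> x\<bar> \<le> B" using test(2)[OF t] by blast
    have "signed_integral \<Omega> \<mu>1 \<phi> = (LINT x|M. \<phi> x * g x)"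
      by (rule signed_integral_density[OF \<Omega>b M(2) spM g _ \<phi>M[OF test(1)[OF t]] B]) (simp add: \<mu>1_def)
    also have "\<dots> = limit_functional \<phi>" using w(3) t by (simp add: g_def F_def)
    finally show "pairing_1 \<Omega> bl k z u \<phi> = signed_integral \<Omega> \<mu>1 \<phi>" using pairing_1[OF t] by simp
  qed
  have rep: "represents \<Omega> \<mu> (pairing \<Omega> bl k z u)"
    unfolding represents_def
  proof
    fix \<phi> assume t: "\<phi> \<in> test_functions \<Omega>"
    obtain B where B: "\<And>x. \<bar>\<phi> x\<bar> \<le> B" using test(2)[OF t] by blast
    have \<phi>H: "integrable lborel (\<lambda>x. \<phi> x * H x)"
      by (rule integrable_bounded_mult[OF _ B H]) (use test(1)[OF t] in simp)
    \<comment> \<open>The change of base measure is known for integrals over Borel sets; apply it to \<open>\<phi> H\<close> on all of \<open>\<Omega>\<close>.\<close>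
    have "\<Omega> \<in> borel_subsets \<Omega>" using \<Omega>b by (simp add: borel_subsets_def)
    with e \<phi>H have "(LINT x|lborel. indicator \<Omega> x * (\<phi> x * H x)) = (LINT x|M. indicator \<Omega> x * (e x * (\<phi> x * H x)))"
      by blast
    also have "(LINT x|lborel. indicator \<Omega> x * (\<phi> x * H x)) = (LINT x|lborel. \<phi> x * H x)"
      using H0 by (intro Bochner_Integration.integral_cong refl) (auto simp: indicator_def)
    also have "(LINT x|M. indicator \<Omega> x * (e x * (\<phi> x * H x))) = (LINT x|M. \<phi> x * (e x * H x))"
      by (intro Bochner_Integration.integral_cong refl) (auto simp: indicator_def spM)
    finally have eq: "(LINT x|M. \<phi> x * (e x * H x)) = (LINT x|lborel. \<phi> x * H x)" ..
    have "signed_integral \<Omega> \<mu> \<phi> = (LINT x|M. \<phi> x * (g x + e x * H x))"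
      by (rule signed_integral_density[OF \<Omega>b M(2) spM gH _ \<phi>M[OF test(1)[OF t]] B]) (simp add: \<mu>_def)
    also have "\<dots> = (LINT x|M. \<phi> x * g x) + (LINT x|M. \<phi> x * (e x * H x))"
      using integrable_bounded_mult[OF \<phi>M[OF test(1)[OF t]] B g] integrable_bounded_mult[OF \<phi>M[OF test(1)[OF t]] B eH]
      by (simp add: distrib_left)
    also have "(LINT x|M. \<phi> x * g x) = limit_functional \<phi>" using w(3) t by (simp add: g_def F_def)
    finally show "pairing \<Omega> bl k z u \<phi> = signed_integral \<Omega> \<mu> \<phi>" using pairing_0[OF t] eq by simp
  qed

  have block_density: "block_deriv_measure \<Omega> bl 1 u B = (LINT x|M. indicator B x *\<^sub>R F x)" if B: "B \<in> sets M" for B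
  proof -
    have i: "integrable M (\<lambda>x. indicator B x * f c x)" if "c \<in> S" for c
      using integrable_mult_indicator[OF B, of "f c"] f S that by auto
    have "block_deriv_measure \<Omega> bl 1 u B = (\<Sum>c\<in>S. (\<nu> B \<bullet> c) *\<^sub>R c)"
      by (simp add: block_deriv_measure_def block_def S_def \<nu>_def)
    also have "\<dots> = (\<Sum>c\<in>S. (LINT x|M. (indicator B x * f c x) *\<^sub>R c))"
    proof (intro sum.cong refl)
      fix c assume c: "c \<in> S"
      then have cB: "c \<in> Basis" using S by auto
      have "\<nu> B \<bullet> c = (LINT x|M. indicator B x * f c x)"
        by (rule bspec[OF conjunct2[OF bspec[OF \<nu>_density cB]] B[unfolded M(2)]])
      then show "(\<nu> B \<bullet> c) *\<^sub>R c = (LINT x|M. (indicator B x * f c x) *\<^sub>R c)"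
        using i[OF c] by simp
    qed
    also have "\<dots> = (LINT x|M. (\<Sum>c\<in>S. (indicator B x * f c x) *\<^sub>R c))"
      by (rule Bochner_Integration.integral_sum[symmetric]) (use i in auto)
    also have "\<dots> = (LINT x|M. indicator B x *\<^sub>R F x)" by (simp add: F_def scaleR_sum_right)
    finally show ?thesis .
  qed
  define V where "V = block_deriv_measure \<Omega> bl 1 u"
  have TV: "(\<integral>\<^sup>+x. ennreal (norm (F x)) * indicator B x \<partial>M) \<le> total_variation V B" if "B \<in> sets M" for B
    unfolding V_def by (rule nn_integral_norm_le_total_variation[OF M F block_density that])
  have [measurable]: "F \<in> borel_measurable M" using F by auto
  have \<mu>1_le: "ennreal \<bar>\<mu>1 A\<bar> \<le> ennreal C * (\<integral>\<^sup>+x. ennreal (norm (F x)) * indicator A x \<partial>M)" if A: "A \<in> sets M" for A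
  proof -
    have "integrable M (\<lambda>x. indicator A x * g x)" using integrable_mult_indicator[OF A g] by simp
    then have "ennreal \<bar>\<mu>1 A\<bar> \<le> (\<integral>\<^sup>+x. ennreal (norm (indicator A x * g x)) \<partial>M)"
      using integral_norm_bound_ennreal unfolding \<mu>1_def real_norm_def[symmetric] by blast
    also have "\<dots> \<le> (\<integral>\<^sup>+x. ennreal C * (ennreal (norm (F x)) * indicator A x) \<partial>M)"
    proof (intro nn_integral_mono)
      fix x
      have "\<bar>g x\<bar> \<le> norm (F x) * norm (w x)" unfolding g_def by (rule Cauchy_Schwarz_ineq2)
      also have "\<dots> \<le> norm (F x) * C" using w(2) by (intro mult_left_mono) auto
      finally show "ennreal (norm (indicator A x * g x)) \<le> ennreal C * (ennreal (norm (F x)) * indicator A x)"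
        using C0 by (auto simp: indicator_def ennreal_mult[symmetric] mult.commute intro: ennreal_leI)
    qed
    also have "\<dots> = ennreal C * (\<integral>\<^sup>+x. ennreal (norm (F x)) * indicator A x \<partial>M)"
      using A by (intro nn_integral_cmult borel_measurable_times_ennreal borel_measurable_indicator) auto
    finally show ?thesis .
  qed
  have bound1: "ennreal \<bar>\<mu>1 B\<bar> \<le> ennreal C * total_variation V B" if "B \<in> borel_subsets \<Omega>" for B
    using order_trans[OF \<mu>1_le mult_left_mono[OF TV]] that M(2) by simp
  have ac: "abs_continuous \<Omega> \<mu>1 V"
    unfolding abs_continuous_def
  proof (intro ballI impI)
    fix B assume B: "B \<in> borel_subsets \<Omega>" and 0: "total_variation V B = 0"
    have FB: "(\<integral>\<^sup>+x. ennreal (norm (F x)) * indicator B x \<partial>M) = 0" using TV[of B] B M(2) 0 by simp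
    have zero: "ennreal (norm (\<mu>1 A)) = 0" if A: "A \<in> sets borel" "A \<subseteq> B" for A
    proof -
      have Am: "A \<in> sets M" using A B M(2) by (auto simp: borel_subsets_def)
      have "(\<integral>\<^sup>+x. ennreal (norm (F x)) * indicator A x \<partial>M) \<le> (\<integral>\<^sup>+x. ennreal (norm (F x)) * indicator B x \<partial>M)"
        using A by (intro nn_integral_mono) (auto simp: indicator_def)
      then have "(\<integral>\<^sup>+x. ennreal (norm (F x)) * indicator A x \<partial>M) = 0" using FB by simp
      then show ?thesis using \<mu>1_le[OF Am] by simp
    qed
    have "total_variation \<mu>1 B \<le> 0"
      unfolding total_variation_def
    proof (rule SUP_least)
      fix A :: "nat \<Rightarrow> 'a set"
      assume "A \<in> {A. range A \<subseteq> sets borel \<and> disjoint_family A \<and> (\<Union>n. A n) = B}"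
      then have "ennreal (norm (\<mu>1 (A n))) = 0" for n by (intro zero) auto
      then show "(\<Sum>n. ennreal (norm (\<mu>1 (A n)))) \<le> 0" by (simp only: suminf_zero order_refl)
    qed
    then show "total_variation \<mu>1 B = 0" by simp
  qed
  have bound: "ennreal \<bar>\<mu> B\<bar> \<le> ennreal C * total_variation V B
           + (\<Sum>i=2..k. Lp_norm (dual_exp (ennreal (p i))) \<Omega> (\<lambda>x. block bl i (z x))
                        * Lp_norm (ennreal (p i)) \<Omega> (weak_grad \<Omega> bl i u))" if B: "B \<in> borel_subsets \<Omega>" for B
  proof -
    have Bb: "B \<in> sets borel" and BM: "B \<in> sets M" using B M(2) by (auto simp: borel_subsets_def)
    define I where "I i = (LINT x|lebesgue_on \<Omega>. indicator B x * (block bl i (z x) \<bullet> weak_grad \<Omega> bl i u x))" for i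
    have Ile: "ennreal \<bar>I i\<bar> \<le> Lp_norm (dual_exp (ennreal (p i))) \<Omega> (\<lambda>x. block bl i (z x)) * Lp_norm (ennreal (p i)) \<Omega> (weak_grad \<Omega> bl i u)"
      if i: "i \<in> {2..k}" for i
      unfolding I_def by (rule Holder_set_integral) (use p(2) i z u(1) Bb in \<open>auto simp: X_aniso_def BV_aniso_def\<close>)
    have "(\<Sum>i=2..k. I i) = (LINT x|lborel. indicator B x * H x)"
      unfolding I_def by (rule H_transfer(1)[of _ 1]) (use Bb in \<open>auto simp: indicator_def\<close>)
    also have "\<dots> = (LINT x|M. indicator B x * (e x * H x))" using e H B by blast
    finally have sumI: "(LINT x|M. indicator B x * (e x * H x)) = (\<Sum>i=2..k. I i)" ..
    have "\<mu> B = \<mu>1 B + (\<Sum>i=2..k. I i)"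
      unfolding sumI[symmetric] \<mu>_def \<mu>1_def
      using integrable_mult_indicator[OF BM g] integrable_mult_indicator[OF BM eH] by (simp add: distrib_left)
    then have "\<bar>\<mu> B\<bar> \<le> \<bar>\<mu>1 B\<bar> + (\<Sum>i=2..k. \<bar>I i\<bar>)"
      using sum_abs[of I "{2..k}"] abs_triangle_ineq[of "\<mu>1 B" "\<Sum>i=2..k. I i"] by linarith
    then have "ennreal \<bar>\<mu> B\<bar> \<le> ennreal (\<bar>\<mu>1 B\<bar> + (\<Sum>i=2..k. \<bar>I i\<bar>))" by (rule ennreal_leI)
    also have "\<dots> = ennreal \<bar>\<mu>1 B\<bar> + (\<Sum>i=2..k. ennreal \<bar>I i\<bar>)"
      by (simp add: ennreal_plus sum_nonneg sum_ennreal)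
    also have "\<dots> \<le> ennreal C * total_variation V B
           + (\<Sum>i=2..k. Lp_norm (dual_exp (ennreal (p i))) \<Omega> (\<lambda>x. block bl i (z x))
                        * Lp_norm (ennreal (p i)) \<Omega> (weak_grad \<Omega> bl i u))"
      by (intro add_mono bound1 B sum_mono Ile)
    finally show ?thesis .
  qed
  show ?thesis
    unfolding C_eq V_def[symmetric] using radon rep rep1 bound bound1 ac by blast
qed

lemma prod_blocks_image:
  fixes bl :: "'b::euclidean_space \<Rightarrow> nat"
  assumes "bl ` Basis = {2..k}" "2 \<le> k"
  shows "prod_blocks bl ` (Basis :: ('a::euclidean_space \<times> 'b) set) \<subseteq> {1..k}"
proof -
  have "bl b \<in> {1..k}" if "b \<in> Basis" for b using assms that by force
  then show ?thesis using assms(2) by (auto simp: Basis_prod_def prod_blocks_def)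
qed

theorem proposition3p4:
  fixes \<Omega>1 :: "'a::euclidean_space set" and \<Omega>2 :: "'b::euclidean_space set"
    and k :: nat and bl :: "'b \<Rightarrow> nat" and p :: "nat \<Rightarrow> real" and q :: ennreal
    and u :: "'a \<times> 'b \<Rightarrow> real" and z :: "'a \<times> 'b \<Rightarrow> 'a \<times> 'b"
  defines "\<Omega> \<equiv> \<Omega>1 \<times> \<Omega>2"
    and "b \<equiv> prod_blocks bl"
  assumes "k \<ge> 2"
    and "bl ` Basis = {2..k}"
    and "open \<Omega>1" "bounded \<Omega>1" "open \<Omega>2" "bounded \<Omega>2"
    and "lipschitz_boundary \<Omega>"
    and "p 1 = 1" "\<forall>i\<in>{2..k}. 1 < p i" "mono_on {2..k} p"
    and "1 \<le> q"
    and "u \<in> BV_aniso \<Omega> b k p" "in_Lp (max (ennreal (p k)) q) \<Omega> u"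
    and "z \<in> X_aniso \<Omega> b k p (dual_exp q)"
  shows
    "(\<exists>\<mu>. radon_measure \<Omega> \<mu> \<and> represents \<Omega> \<mu> (pairing \<Omega> b k z u) \<and>
        (\<forall>B\<in>borel_subsets \<Omega>. ennreal \<bar>\<mu> B\<bar> \<le>
           Lp_norm \<infinity> \<Omega> (\<lambda>x. block b 1 (z x)) * total_variation (block_deriv_measure \<Omega> b 1 u) B
           + (\<Sum>i=2..k. Lp_norm (dual_exp (ennreal (p i))) \<Omega> (\<lambda>x. block b i (z x))
                        * Lp_norm (ennreal (p i)) \<Omega> (weak_grad \<Omega> b i u)))) \<and>
     (\<exists>\<mu>1. radon_measure \<Omega> \<mu>1 \<and> represents \<Omega> \<mu>1 (pairing_1 \<Omega> b k z u) \<and>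
        (\<forall>B\<in>borel_subsets \<Omega>. ennreal \<bar>\<mu>1 B\<bar> \<le>
           Lp_norm \<infinity> \<Omega> (\<lambda>x. block b 1 (z x)) * total_variation (block_deriv_measure \<Omega> b 1 u) B) \<and>
        abs_continuous \<Omega> \<mu>1 (block_deriv_measure \<Omega> b 1 u))"
proof -
  have \<Omega>: "open \<Omega>" "bounded \<Omega>"
    unfolding \<Omega>_def using assms by (auto intro: open_Times bounded_Times)
  have le: "p i \<le> p k" if "i \<in> {1..k}" for i
  proof (cases "i = 1")
    case True
    have "1 < p k" using assms(3) \<open>\<forall>i\<in>{2..k}. 1 < p i\<close> by auto
    then show ?thesis using True \<open>p 1 = 1\<close> by simp
  next
    case False
    then show ?thesis using that assms(3) by (intro mono_onD[OF \<open>mono_on {2..k} p\<close>]) auto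
  qed
  have "b ` Basis \<subseteq> {1..k}"
    unfolding b_def by (rule prod_blocks_image) fact+
  then show ?thesis
    by (rule anisotropic_pairing_measures[OF \<Omega>]) (use assms le in auto)
qed

end
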